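(* Let $K$ be a local field of characteristic $p$ and let $\phi$ be a Drinfeld $A$-module over $K$ of stable reduction with residual characteristic $\bar{\mathfrak p}$. Let $(\psi,M)$ be its Tate uniformization, where $\psi$ is a Drinfeld $A$-module of good reduction over $\mathcal O_K$, and assume that the lattice $M$ is contained in $K$. For every prime $\mathfrak p\ne\bar{\mathfrak p}$ of $A$, the image of $T_{\mathfrak p}(\psi)$ in $T_{\mathfrak p}(\phi)$ is precisely the submodule of $I_K$-invariants in $T_{\mathfrak p}(\phi)$.
   Context: Fields. $K$ is a local field of characteristic $p$ with valuation ring $\mathcal O_K$, maximal ideal $\mathfrak m_K$, finite residue field $k$; $K^{\rm alg}$ is an algebraic closure with valuation ring $\mathcal O_{K^{\rm alg}}$, and $I_K$ is the inertia subgroup of $\mathrm{Gal}(K^{\rm sep}/K)\cong\mathrm{Aut}(K^{\rm alg}/K)$. Drinfeld modules. $A$ is the ring of elements of a global function field $F$ of characteristic $p$ that are regular outside a fixed place $\infty$; a prime of $A$ is a nonzero prime ideal, with completions $A_{\mathfrak p}\subset F_{\mathfrak p}$. A Drinfeld $A$-module over $K$ is a ring homomorphism $\phi:A\to K[\tau]$ ($\tau x=x^p\tau$), $a\mapsto\phi_a$, of positive rank. Polynomials $\sum f_i\tau^i$ act by $\xi\mapsto\sum f_i\xi^{p^i}$, and $(H,\phi)$ denotes $H$ with $A$ acting through $\phi$. $\phi$ has stable reduction if it has coefficients in $\mathcal O_K$ and its reduction modulo $\mathfrak m_K$ is a Drinfeld $A$-module $\bar\phi$ of positive rank over $k$. The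 residual characteristic $\bar{\mathfrak p}\subset A$ is the characteristic ideal of $\bar\phi$, i.e. the kernel of the homomorphism $A\to k$ sending $a$ to the constant coefficient of $\bar\phi_a$; it is a maximal ideal. Good reduction of $\psi$ means that $\psi$ has coefficients in $\mathcal O_K$ and for every $a\ne0$ the highest coefficient of $\psi_a$ is a unit in $\mathcal O_K$. Tate uniformization. There exist a unique Drinfeld $A$-module $\psi$ over $\mathcal O_K$ of good reduction, a unique finitely generated projective $A$-submodule $M\subset(K^{\rm alg},\psi)$ with $M\cap\mathcal O_{K^{\rm alg}}=\{0\}$, and a unique everywhere converging power series $e\in\mathcal O_K[[\tau]]$ with constant coefficient $1$ and $e\equiv1$ modulo $\mathfrak m_K$, such that $e\circ\psi_a=\phi_a\circ e$ for all $a\in A$ and $\ker(e|K^{\rm alg})=M$. Tate modules. $T_{\mathfrak p}(\phi):=\mathrm{Hom}_A\bigl(F_{\mathfrak p}/A_{\mathfrak p},(K^{\rm alg},\phi)\bigr)$ and likewise for $\psi$, with the $I_K$-action induced from that on $K^{\rm alg}$. Composition with $e$ gives the natural injection $T_{\mathfrak p}(\psi)\hookrightarrow T_{\mathfrak p}(\phi)$, which fits into a Galois equivariant short exact sequence $0\to T_{\mathfrak p}(\psi)\to T_{\mathfrak p}(\phi)\to A_{\mathfrak p}\otimes_AM\to0$. *)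

theory Defs
  imports
    "HOL-Algebra.Ideal"
    "HOL-Algebra.Algebraic_Closure_Type"
    "HOL-Library.Set_Algebras"
    "HOL-Library.FuncSet"
    "HOL-Computational_Algebra.Computational_Algebra"
begin

hide_const (open) Divisibility.prime

abbreviation ring_on :: "'a::field set \<Rightarrow> 'a ring" where
  "ring_on S \<equiv> ring_of_type_algebra\<lparr>carrier := S\<rparr>"


section \<open>Valuations\<close>

text \<open>
  Valuations are written additively. The value at \<open>0\<close>, which should be infinite, is not
  constrained here, so every comparison of values below treats \<open>0\<close> separately.
\<close>

definition valuation :: "('a::field \<Rightarrow> 'g::linordered_ab_group_add) \<Rightarrow> bool" where
  "valuation w \<longleftrightarrow>
     (\<forall>x y. x \<noteq> 0 \<longrightarrow> y \<noteq> 0 \<longrightarrow> w (x * y) = w x + w y) \<and>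
     (\<forall>x y. x \<noteq> 0 \<longrightarrow> y \<noteq> 0 \<longrightarrow> x + y \<noteq> 0 \<longrightarrow> min (w x) (w y) \<le> w (x + y))"

text \<open>
  Normalized discrete valuations. The junk value \<open>v 0 = 0\<close> makes two of them equal as functions
  as soon as they agree on the nonzero elements; hence normalized discrete valuations of a global
  function field are in bijection with its places.
\<close>

definition discrete_valuation :: "('a::field \<Rightarrow> int) \<Rightarrow> bool" where
  "discrete_valuation v \<longleftrightarrow> valuation v \<and> v ` (UNIV - {0}) = UNIV \<and> v 0 = 0"

definition val_ring :: "('a::field \<Rightarrow> 'g::linordered_ab_group_add) \<Rightarrow> 'a set" where
  "val_ring w = {x. x = 0 \<or> 0 \<le> w x}"

definition max_ideal :: "('a::field \<Rightarrow> 'g::linordered_ab_group_add) \<Rightarrow> 'a set" where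
  "max_ideal w = {x. x = 0 \<or> 0 < w x}"

definition val_lim ::
    "('a::field \<Rightarrow> 'g::linordered_ab_group_add) \<Rightarrow> (nat \<Rightarrow> 'a) \<Rightarrow> 'a \<Rightarrow> bool" where
  "val_lim w s L \<longleftrightarrow> (\<forall>C. \<exists>N. \<forall>n\<ge>N. s n = L \<or> C < w (s n - L))"

definition val_complete :: "('a::field \<Rightarrow> 'g::linordered_ab_group_add) \<Rightarrow> bool" where
  "val_complete w \<longleftrightarrow>
     (\<forall>s. (\<forall>C. \<exists>N. \<forall>m\<ge>N. \<forall>n\<ge>N. s m = s n \<or> C < w (s m - s n)) \<longrightarrow> (\<exists>L. val_lim w s L))"

definition local_field :: "nat \<Rightarrow> ('k::field \<Rightarrow> int) \<Rightarrow> bool" where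
  "local_field p v \<longleftrightarrow> prime p \<and> CHAR('k) = p \<and> discrete_valuation v \<and> val_complete v \<and>
     finite ((\<lambda>x. x +o max_ideal v) ` val_ring v)"

text \<open>
  \<open>red\<close> presents the type \<open>'r\<close> as the residue field; its values outside the valuation ring are
  irrelevant.
\<close>

definition residue_map :: "('k::field \<Rightarrow> int) \<Rightarrow> ('k \<Rightarrow> 'r::field) \<Rightarrow> bool" where
  "residue_map v red \<longleftrightarrow>
     red \<in> ring_hom (ring_on (val_ring v)) (ring_on UNIV) \<and> red ` val_ring v = UNIV \<and>
     {x \<in> val_ring v. red x = 0} = max_ideal v"

text \<open>\<open>w\<close> is the (unique) extension of \<open>v\<close> to the algebraic closure.\<close>

definition valuation_extension ::
    "('k::field \<Rightarrow> int) \<Rightarrow> ('k alg_closure \<Rightarrow> real) \<Rightarrow> bool" where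
  "valuation_extension v w \<longleftrightarrow>
     valuation w \<and> (\<forall>x. x \<noteq> 0 \<longrightarrow> w (to_ac x) = real_of_int (v x))"

definition inertia_group :: "('k::field alg_closure \<Rightarrow> real) \<Rightarrow> ('k alg_closure \<Rightarrow> 'k alg_closure) set"
  where
  "inertia_group w = {\<sigma> \<in> ring_iso (ring_on UNIV) (ring_on UNIV).
     (\<forall>c. \<sigma> (to_ac c) = to_ac c) \<and> (\<forall>x \<in> val_ring w. \<sigma> x - x \<in> max_ideal w)}"


section \<open>Global function fields\<close>

text \<open>
  In characteristic \<open>p\<close> the set \<open>\<int> = range of_int\<close> is the prime field, so
  \<open>prime_rational_functions t\<close> is the subfield generated by \<open>t\<close>.
\<close>

definition prime_rational_functions :: "'f::field \<Rightarrow> 'f set" where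
  "prime_rational_functions t =
     {poly a t / poly b t | a b. (\<forall>i. Polynomial.coeff a i \<in> \<int>) \<and> (\<forall>i. Polynomial.coeff b i \<in> \<int>)}"

definition global_function_field :: "nat \<Rightarrow> 'f::field itself \<Rightarrow> bool" where
  "global_function_field p TYPE('f) \<longleftrightarrow> prime p \<and> CHAR('f) = p \<and>
     (\<exists>t::'f. (\<forall>q. (\<forall>i. Polynomial.coeff q i \<in> \<int>) \<longrightarrow> q \<noteq> 0 \<longrightarrow> poly q t \<noteq> 0) \<and>
        (\<exists>B. finite B \<and>
           (\<forall>x. \<exists>c. (\<forall>b\<in>B. c b \<in> prime_rational_functions t) \<and> x = (\<Sum>b\<in>B. c b * b))))"

definition regular_outside :: "('f::field \<Rightarrow> int) \<Rightarrow> 'f set" where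
  "regular_outside vinf = {x. \<forall>v. discrete_valuation v \<longrightarrow> v \<noteq> vinf \<longrightarrow> x \<in> val_ring v}"

definition prime_of :: "'f::field set \<Rightarrow> 'f set \<Rightarrow> bool" where
  "prime_of A P \<longleftrightarrow> primeideal P (ring_on A) \<and> P \<noteq> {0}"

text \<open>The valuation of the place of \<open>F\<close> attached to the prime \<open>P\<close> of \<open>A\<close>.\<close>

definition valuation_at :: "'f::field set \<Rightarrow> 'f set \<Rightarrow> ('f \<Rightarrow> int) \<Rightarrow> bool" where
  "valuation_at A P v \<longleftrightarrow> discrete_valuation v \<and> A \<subseteq> val_ring v \<and> P = A \<inter> max_ideal v"

text \<open>
  \<open>\<iota>\<close> presents the type \<open>'c\<close>, with valuation \<open>vc\<close>, as the completion of \<open>'f\<close> for \<open>v\<close>. If \<open>v\<close> is the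
  valuation at a prime \<open>P\<close> of \<open>A\<close>, then \<open>'c\<close> is \<open>F\<^sub>P\<close> and \<open>val_ring vc\<close> is \<open>A\<^sub>P\<close>.
\<close>

definition completion ::
    "('f::field \<Rightarrow> int) \<Rightarrow> ('f \<Rightarrow> 'c::field) \<Rightarrow> ('c \<Rightarrow> int) \<Rightarrow> bool" where
  "completion v \<iota> vc \<longleftrightarrow> \<iota> \<in> ring_hom (ring_on UNIV) (ring_on UNIV) \<and>
     discrete_valuation vc \<and> val_complete vc \<and> (\<forall>x. vc (\<iota> x) = v x) \<and>
     (\<forall>x C. \<exists>y. x = \<iota> y \<or> C < vc (x - \<iota> y))"


section \<open>Twisted polynomials and power series\<close>

text \<open>
  Elements of \<open>K[\<tau>]\<close> and \<open>K[[\<tau>]]\<close> are stored as ordinary polynomials and power series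
  (coefficients on the left of the powers of \<open>\<tau>\<close>); only their multiplication is replaced by the
  one determined by \<open>\<tau> x = x\<^sup>p \<tau>\<close>.
\<close>

definition tau_mult :: "nat \<Rightarrow> 'a::field poly \<Rightarrow> 'a poly \<Rightarrow> 'a poly" where
  "tau_mult p f g = (\<Sum>i\<le>Polynomial.degree f. \<Sum>j\<le>Polynomial.degree g.
     Polynomial.monom (Polynomial.coeff f i * Polynomial.coeff g j ^ (p ^ i)) (i + j))"

definition tau_ring :: "nat \<Rightarrow> 'a::field poly ring" where
  "tau_ring p = \<lparr>carrier = UNIV, monoid.mult = tau_mult p, one = 1, ring.zero = 0, add = (+)\<rparr>"

definition fps_tau_mult :: "nat \<Rightarrow> 'a::field fps \<Rightarrow> 'a fps \<Rightarrow> 'a fps" where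
  "fps_tau_mult p f g = Abs_fps (\<lambda>n. \<Sum>i\<le>n. fps_nth f i * fps_nth g (n - i) ^ (p ^ i))"

lemma coeff_tau_mult:
  assumes "p > 0"
  shows "Polynomial.coeff (tau_mult p f g) n =
           (\<Sum>i\<le>n. Polynomial.coeff f i * Polynomial.coeff g (n - i) ^ (p ^ i))"
proof -
  let ?t = "\<lambda>i j. Polynomial.coeff f i * Polynomial.coeff g j ^ (p ^ i)"
  have inner: "(\<Sum>j\<le>Polynomial.degree g. if i + j = n then ?t i j else 0) =
                 (if i \<le> n then ?t i (n - i) else 0)" for i
  proof (cases "i \<le> n")
    case True
    have "(\<Sum>j\<le>Polynomial.degree g. if i + j = n then ?t i j else 0) =
            (\<Sum>j\<le>Polynomial.degree g. if j = n - i then ?t i (n - i) else 0)"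
      using True by (intro sum.cong) auto
    also have "\<dots> = ?t i (n - i)"
      using assms by (auto simp: sum.delta coeff_eq_0)
    finally show ?thesis using True by simp
  qed (auto intro!: sum.neutral)
  have "Polynomial.coeff (tau_mult p f g) n =
          (\<Sum>i\<le>Polynomial.degree f. if i \<le> n then ?t i (n - i) else 0)"
    unfolding tau_mult_def by (simp add: coeff_sum inner[symmetric])
  also have "\<dots> = (\<Sum>i\<le>max n (Polynomial.degree f). if i \<le> n then ?t i (n - i) else 0)"
    by (rule sum.mono_neutral_left) (auto simp: coeff_eq_0)
  also have "\<dots> = (\<Sum>i\<le>n. ?t i (n - i))"
    by (rule sum.mono_neutral_cong_right) auto
  finally show ?thesis .
qed

lemma fps_of_poly_tau_mult:
  "p > 0 \<Longrightarrow>
     fps_of_poly (tau_mult p f g) = fps_tau_mult p (fps_of_poly f) (fps_of_poly g)"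
  by (rule fps_ext) (simp add: fps_tau_mult_def coeff_tau_mult)

definition tau_eval :: "nat \<Rightarrow> 'k::field poly \<Rightarrow> 'k alg_closure \<Rightarrow> 'k alg_closure" where
  "tau_eval p f \<xi> = (\<Sum>i\<le>Polynomial.degree f. to_ac (Polynomial.coeff f i) * \<xi> ^ (p ^ i))"

definition tau_partial_sums ::
    "nat \<Rightarrow> 'k::field fps \<Rightarrow> 'k alg_closure \<Rightarrow> nat \<Rightarrow> 'k alg_closure" where
  "tau_partial_sums p e \<xi> n = (\<Sum>i<n. to_ac (fps_nth e i) * \<xi> ^ (p ^ i))"

definition everywhere_convergent ::
    "nat \<Rightarrow> ('k::field alg_closure \<Rightarrow> real) \<Rightarrow> 'k fps \<Rightarrow> bool" where
  "everywhere_convergent p w e \<longleftrightarrow> (\<forall>\<xi>. \<exists>L. val_lim w (tau_partial_sums p e \<xi>) L)"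

definition fps_tau_eval ::
    "nat \<Rightarrow> ('k::field alg_closure \<Rightarrow> real) \<Rightarrow> 'k fps \<Rightarrow> 'k alg_closure \<Rightarrow> 'k alg_closure" where
  "fps_tau_eval p w e \<xi> = (THE L. val_lim w (tau_partial_sums p e \<xi>) L)"


section \<open>Drinfeld modules\<close>

text \<open>
  The rank \<open>r\<close> is given by \<open>deg\<^sub>\<tau> \<phi>\<^sub>a = r * deg a\<close>, where \<open>p\<close> to the power \<open>deg a\<close> is the cardinality
  of \<open>A / aA\<close>.
\<close>

definition has_rank :: "nat \<Rightarrow> 'f::field set \<Rightarrow> ('f \<Rightarrow> 'a::field poly) \<Rightarrow> nat \<Rightarrow> bool" where
  "has_rank p A \<phi> r \<longleftrightarrow> (\<forall>a\<in>A. a \<noteq> 0 \<longrightarrow>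
     \<phi> a \<noteq> 0 \<and> p ^ Polynomial.degree (\<phi> a) = card ((\<lambda>x. x +o ((*) a ` A)) ` A) ^ r)"

definition drinfeld_module :: "nat \<Rightarrow> 'f::field set \<Rightarrow> ('f \<Rightarrow> 'a::field poly) \<Rightarrow> bool" where
  "drinfeld_module p A \<phi> \<longleftrightarrow> \<phi> \<in> ring_hom (ring_on A) (tau_ring p) \<and> (\<exists>r>0. has_rank p A \<phi> r)"

definition integral_coeffs ::
    "('k::field \<Rightarrow> int) \<Rightarrow> 'f set \<Rightarrow> ('f \<Rightarrow> 'k poly) \<Rightarrow> bool" where
  "integral_coeffs v A \<phi> \<longleftrightarrow> (\<forall>a\<in>A. \<forall>i. Polynomial.coeff (\<phi> a) i \<in> val_ring v)"

definition reduction :: "('k::field \<Rightarrow> 'r::field) \<Rightarrow> ('f \<Rightarrow> 'k poly) \<Rightarrow> 'f \<Rightarrow> 'r poly" where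
  "reduction red \<phi> a = map_poly red (\<phi> a)"

definition stable_reduction ::
    "nat \<Rightarrow> ('k::field \<Rightarrow> int) \<Rightarrow> ('k \<Rightarrow> 'r::field) \<Rightarrow> 'f::field set \<Rightarrow> ('f \<Rightarrow> 'k poly) \<Rightarrow> bool" where
  "stable_reduction p v red A \<phi> \<longleftrightarrow>
     integral_coeffs v A \<phi> \<and> drinfeld_module p A (reduction red \<phi>)"

definition characteristic_ideal :: "'f::field set \<Rightarrow> ('f \<Rightarrow> 'a::field poly) \<Rightarrow> 'f set" where
  "characteristic_ideal A \<phi> = {a \<in> A. Polynomial.coeff (\<phi> a) 0 = 0}"

definition residual_characteristic ::
    "('k::field \<Rightarrow> 'r::field) \<Rightarrow> 'f::field set \<Rightarrow> ('f \<Rightarrow> 'k poly) \<Rightarrow> 'f set" where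
  "residual_characteristic red A \<phi> = characteristic_ideal A (reduction red \<phi>)"

definition good_reduction ::
    "('k::field \<Rightarrow> int) \<Rightarrow> 'f::field set \<Rightarrow> ('f \<Rightarrow> 'k poly) \<Rightarrow> bool" where
  "good_reduction v A \<psi> \<longleftrightarrow> integral_coeffs v A \<psi> \<and>
     (\<forall>a\<in>A. a \<noteq> 0 \<longrightarrow> lead_coeff (\<psi> a) \<noteq> 0 \<and> v (lead_coeff (\<psi> a)) = 0)"


section \<open>Lattices and Tate uniformization\<close>

definition submodule_of ::
    "'f set \<Rightarrow> ('f \<Rightarrow> 'l \<Rightarrow> 'l) \<Rightarrow> 'l::ab_group_add set \<Rightarrow> bool" where
  "submodule_of A act M \<longleftrightarrow> 0 \<in> M \<and> (\<forall>x\<in>M. \<forall>y\<in>M. x + y \<in> M) \<and> (\<forall>a\<in>A. \<forall>x\<in>M. act a x \<in> M)"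

definition free_module :: "'f::field set \<Rightarrow> nat \<Rightarrow> (nat \<Rightarrow> 'f) set" where
  "free_module A n = {x. \<forall>i. if i < n then x i \<in> A else x i = 0}"

text \<open>
  A direct summand of some \<open>A\<^sup>n\<close>: \<open>s\<close> and \<open>\<pi>\<close> are \<open>A\<close>-linear with \<open>\<pi> \<circ> s = id\<close>.
\<close>

definition fg_projective ::
    "'f::field set \<Rightarrow> ('f \<Rightarrow> 'l \<Rightarrow> 'l) \<Rightarrow> 'l::ab_group_add set \<Rightarrow> bool" where
  "fg_projective A act M \<longleftrightarrow> (\<exists>n s \<pi>.
     s \<in> M \<rightarrow> free_module A n \<and>
     (\<forall>x\<in>M. \<forall>y\<in>M. s (x + y) = (\<lambda>i. s x i + s y i)) \<and>
     (\<forall>a\<in>A. \<forall>x\<in>M. s (act a x) = (\<lambda>i. a * s x i)) \<and>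
     \<pi> \<in> free_module A n \<rightarrow> M \<and>
     (\<forall>x\<in>free_module A n. \<forall>y\<in>free_module A n. \<pi> (\<lambda>i. x i + y i) = \<pi> x + \<pi> y) \<and>
     (\<forall>a\<in>A. \<forall>x\<in>free_module A n. \<pi> (\<lambda>i. a * x i) = act a (\<pi> x)) \<and>
     (\<forall>x\<in>M. \<pi> (s x) = x))"

definition tate_uniformization ::
    "nat \<Rightarrow> ('k::field \<Rightarrow> int) \<Rightarrow> ('k alg_closure \<Rightarrow> real) \<Rightarrow> 'f::field set \<Rightarrow> ('f \<Rightarrow> 'k poly) \<Rightarrow>
     ('f \<Rightarrow> 'k poly) \<Rightarrow> 'k alg_closure set \<Rightarrow> 'k fps \<Rightarrow> bool" where
  "tate_uniformization p v w A \<phi> \<psi> M e \<longleftrightarrow>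
     drinfeld_module p A \<psi> \<and> good_reduction v A \<psi> \<and>
     submodule_of A (\<lambda>a. tau_eval p (\<psi> a)) M \<and> fg_projective A (\<lambda>a. tau_eval p (\<psi> a)) M \<and>
     M \<inter> val_ring w = {0} \<and>
     (\<forall>i. fps_nth e i \<in> val_ring v) \<and> everywhere_convergent p w e \<and>
     fps_nth e 0 = 1 \<and> (\<forall>i>0. fps_nth e i \<in> max_ideal v) \<and>
     (\<forall>a\<in>A. fps_tau_mult p e (fps_of_poly (\<psi> a)) = fps_tau_mult p (fps_of_poly (\<phi> a)) e) \<and>
     {\<xi>. fps_tau_eval p w e \<xi> = 0} = M"


section \<open>Tate modules\<close>

text \<open>\<open>F\<^sub>P / A\<^sub>P\<close> as a set of cosets.\<close>

definition torsion_quotient :: "('c::field \<Rightarrow> int) \<Rightarrow> 'c set set" where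
  "torsion_quotient vc = range (\<lambda>x. x +o val_ring vc)"

text \<open>
  The \<open>A\<close>-linear maps from \<open>F\<^sub>P / A\<^sub>P\<close> to \<open>(K\<^sup>a\<^sup>l\<^sup>g, \<phi>)\<close>, with \<open>A\<close> acting on \<open>F\<^sub>P / A\<^sub>P\<close> through \<open>\<iota>\<close>.
\<close>

definition tate_module ::
    "nat \<Rightarrow> 'f::field set \<Rightarrow> ('f \<Rightarrow> 'c::field) \<Rightarrow> ('c \<Rightarrow> int) \<Rightarrow> ('f \<Rightarrow> 'k::field poly) \<Rightarrow>
     ('c set \<Rightarrow> 'k alg_closure) set" where
  "tate_module p A \<iota> vc \<phi> = {f \<in> extensional (torsion_quotient vc).
     (\<forall>x y. f ((x + y) +o val_ring vc) = f (x +o val_ring vc) + f (y +o val_ring vc)) \<and>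
     (\<forall>a\<in>A. \<forall>x. f ((\<iota> a * x) +o val_ring vc) = tau_eval p (\<phi> a) (f (x +o val_ring vc)))}"

definition tate_invariants ::
    "('k::field alg_closure \<Rightarrow> 'k alg_closure) set \<Rightarrow> ('c::field \<Rightarrow> int) \<Rightarrow>
     ('c set \<Rightarrow> 'k alg_closure) set \<Rightarrow> ('c set \<Rightarrow> 'k alg_closure) set" where
  "tate_invariants I vc T = {f \<in> T. \<forall>\<sigma>\<in>I. compose (torsion_quotient vc) \<sigma> f = f}"

end

theory Submission
  imports Defs
begin

text \<open>
  Measure \<open>K\<^sup>a\<^sup>l\<^sup>g\<close> by the absolute value \<open>N x = 2 powr (- w x)\<close>, let \<open>O\<close> be its valuation ring and
  write \<open>E\<close> for the map given by the power series \<open>e\<close>. It is additive, commutes with inertia,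
  carries the action of \<open>\<psi>\<close> to that of \<open>\<phi>\<close>, has kernel \<open>M\<close>, and is injective on
  \<open>O\<close> because \<open>M \<inter> O = 0\<close>.

  Composition with \<open>E\<close> lands in the invariants because torsion of \<open>\<psi>\<close> outside the residual
  characteristic is unramified. The values of an element of \<open>T\<^sub>P(\<psi>)\<close> are killed by some
  \<open>\<psi>\<^sub>b\<close> whose constant coefficient is a unit (\<open>exists_separating_element\<close>). Such values \<open>t\<close> are
  integral, so \<open>\<sigma> t - t\<close> is a root of \<open>\<psi>\<^sub>b\<close> in the maximal ideal for every \<open>\<sigma>\<close> in inertia; there
  the linear term of \<open>\<psi>\<^sub>b\<close> dominates, and the root is zero (\<open>tau_eval_small_root\<close>).

  Conversely let \<open>f \<in> T\<^sub>P(\<phi>)\<close> be invariant and \<open>x \<in> F\<^sub>P\<close>. Fix \<open>a \<in> P\<close> outside the residual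
  characteristic and, \<open>E\<close> being surjective, choose \<open>y\<^sub>i\<close> with \<open>E y\<^sub>i = f (x / a\<^sup>i)\<close>. Then
  \<open>\<psi>\<^sub>a y\<^sub>i\<^sub>+\<^sub>1 - y\<^sub>i \<in> M\<close>, and a power of \<open>\<psi>\<^sub>a\<close> takes \<open>y\<^sub>i\<close> into \<open>M\<close>. Since \<open>M \<subseteq> K\<close> and
  \<open>M \<inter> O = 0\<close>, invariance of \<open>f\<close> forces inertia to fix \<open>y\<^sub>i\<close> itself (\<open>division_point_unramified\<close>),
  so \<open>y\<^sub>i\<close> lies in the maximal unramified extension of \<open>K\<close>, on which \<open>N\<close> takes no value strictly
  between 1 and 2.

  The remaining step compares two growth rates (\<open>divisible_near_lattice\<close>). Put
  \<open>D = p ^ degree \<psi>\<^sub>a\<close>. On elements outside \<open>O\<close> the map \<open>\<psi>\<^sub>a\<close> raises \<open>N\<close> to the power \<open>D\<close>, so after a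
  translation by \<open>M\<close> all \<open>y\<^sub>i\<close> satisfy \<open>N y\<^sub>i \<le> C\<close> for one constant \<open>C\<close>. If \<open>y\<^sub>0, \<dots>, y\<^sub>J\<close> were distinct
  modulo \<open>O\<close>, then their images under \<open>\<psi>\<^sub>a\<^sup>n\<close> would be \<open>J + 1\<close> elements of \<open>M\<close> in a ball of radius
  \<open>C ^ (D ^ n)\<close> with mutual distances at least \<open>2 ^ (D ^ n)\<close>. A box count in terms of the finite
  group \<open>M / aM\<close> bounds the number of such elements independently of \<open>n\<close>. Hence for large \<open>J\<close>
  two of the \<open>y\<^sub>i\<close> agree modulo \<open>O\<close>. Then some \<open>y\<^sub>j\<close> is fixed modulo \<open>M + O\<close> by a positive power of
  \<open>\<psi>\<^sub>a\<close>, while another power of \<open>\<psi>\<^sub>a\<close> kills it there, so it vanishes, and so does \<open>y\<^sub>0\<close>. Thus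
  \<open>f (x) = E t\<close> with \<open>t \<in> O\<close>; injectivity of \<open>E\<close> on \<open>O\<close> makes \<open>t\<close> depend \<open>A\<close>-linearly on \<open>x\<close>.

  Three general facts carry this argument. Surjectivity of \<open>E\<close> (\<open>E_surj\<close>): a truncation of
  \<open>E y = x\<close> has a root no larger than \<open>x\<close>, the error is integral, and on \<open>O\<close> the map \<open>E\<close> is a
  perturbation of the identity that can be inverted by a Neumann series. Uniqueness of the
  extension of an absolute value from a complete field (\<open>extension_unique\<close>), so that all
  automorphisms over \<open>K\<close> are isometries. Existence of enough automorphisms
  (\<open>separable_conjugate\<close>), so that separable elements fixed by inertia are unramified.
\<close>

section \<open>Extending embeddings to the algebraic closure\<close>

text \<open>
  An embedding over \<open>K\<close> of an intermediate ring of \<open>K\<^sup>a\<^sup>l\<^sup>g\<close> is stored as its graph, a subring of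
  the product ring. The union of a chain of such graphs is again one, which is what Zorn's lemma
  asks for, and by additivity a graph is single-valued as soon as it is so at zero.
\<close>

definition partial_embedding :: "('k::field alg_closure \<times> 'k alg_closure) set \<Rightarrow> bool" where
  "partial_embedding G \<longleftrightarrow>
     (\<forall>c. (to_ac c, to_ac c) \<in> G) \<and>
     (\<forall>x x' y y'. (x, x') \<in> G \<longrightarrow> (y, y') \<in> G \<longrightarrow> (x + y, x' + y') \<in> G \<and> (x * y, x' * y') \<in> G) \<and>
     (\<forall>y. (0, y) \<in> G \<longrightarrow> y = 0)"

text \<open>
  Polynomials over the domain of an embedding, paired with their images.
\<close>

definition poly_pair :: "('a::zero \<times> 'a) set \<Rightarrow> 'a poly \<Rightarrow> 'a poly \<Rightarrow> bool" where
  "poly_pair G h h' \<longleftrightarrow> (\<forall>i. (Polynomial.coeff h i, Polynomial.coeff h' i) \<in> G)"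

definition adjoin :: "('a::comm_ring_1 \<times> 'a) set \<Rightarrow> 'a \<Rightarrow> 'a \<Rightarrow> ('a \<times> 'a) set" where
  "adjoin G x x' = {(poly h x, poly h' x') | h h'. poly_pair G h h'}"

context
  fixes G :: "('k::field alg_closure \<times> 'k alg_closure) set"
  assumes G: "partial_embedding G"
begin

lemma embedding_const: "(to_ac c, to_ac c) \<in> G"
  and embedding_add: "(x, x') \<in> G \<Longrightarrow> (y, y') \<in> G \<Longrightarrow> (x + y, x' + y') \<in> G"
  and embedding_mult: "(x, x') \<in> G \<Longrightarrow> (y, y') \<in> G \<Longrightarrow> (x * y, x' * y') \<in> G"
  and embedding_zero: "(0, y) \<in> G \<Longrightarrow> y = 0"
  using G unfolding partial_embedding_def by blast+

lemma embedding_0: "(0, 0) \<in> G" and embedding_1: "(1, 1) \<in> G"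
  using embedding_const[of 0] embedding_const[of 1] by simp_all

lemma embedding_uminus: "(x, x') \<in> G \<Longrightarrow> (- x, - x') \<in> G"
  using embedding_mult[OF embedding_const[of "- 1"], of x x'] by simp

lemma embedding_diff: "(x, x') \<in> G \<Longrightarrow> (y, y') \<in> G \<Longrightarrow> (x - y, x' - y') \<in> G"
  using embedding_add[OF _ embedding_uminus, of x x' y y'] by simp

lemma embedding_single_valued: "(x, y) \<in> G \<Longrightarrow> (x, z) \<in> G \<Longrightarrow> y = z"
  using embedding_diff[of x y x z] embedding_zero[of "y - z"] by simp

lemma embedding_sum: "(\<And>i. i \<in> I \<Longrightarrow> (f i, f' i) \<in> G) \<Longrightarrow> (sum f I, sum f' I) \<in> G"
  by (induction I rule: infinite_finite_induct) (auto intro: embedding_0 embedding_add)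

lemma embedding_power: "(x, x') \<in> G \<Longrightarrow> (x ^ n, x' ^ n) \<in> G"
  by (induction n) (auto intro: embedding_1 embedding_mult)

lemma embedding_poly_const: "(x, x') \<in> G \<Longrightarrow> (poly (map_poly to_ac q) x, poly (map_poly to_ac q) x') \<in> G"
  unfolding poly_altdef by (intro embedding_sum embedding_mult embedding_power) (auto simp: coeff_map_poly intro: embedding_const)

end

text \<open>
  Dividing an algebraic equation of \<open>x\<close> by its constant term expresses the inverse of \<open>x\<close>
  polynomially; hence every ring between \<open>K\<close> and \<open>K\<^sup>a\<^sup>l\<^sup>g\<close> is a field.
\<close>

lemma inverse_poly_expression:
  fixes x :: "'k::field alg_closure"
  assumes "x \<noteq> 0"
  obtains q where "x * poly (map_poly to_ac q) x = 1"
proof -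
  obtain f :: "'k poly" where f: "f \<noteq> 0" "poly (map_poly to_ac f) x = 0"
    using alg_closure_algebraic by blast
  have "\<exists>q. x * poly (map_poly to_ac q) x = 1"
    using f
  proof (induction f)
    case (pCons a f)
    have ev: "to_ac a + x * poly (map_poly to_ac f) x = 0"
      using pCons.prems(2) by (simp add: map_poly_pCons)
    show ?case
    proof (cases "a = 0")
      case True
      then show ?thesis using pCons ev assms by auto
    next
      case False
      have "map_poly to_ac (smult (- inverse a) f) = smult (- inverse (to_ac a)) (map_poly to_ac f)"
        by (rule poly_eqI) (simp add: coeff_map_poly)
      then have "x * poly (map_poly to_ac (smult (- inverse a) f)) x
                   = - inverse (to_ac a) * (x * poly (map_poly to_ac f) x)"
        by simp
      also have "x * poly (map_poly to_ac f) x = - to_ac a"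
        using ev by (simp add: eq_neg_iff_add_eq_0 add.commute)
      finally show ?thesis using False by force
    qed
  qed auto
  then show ?thesis using that by blast
qed

lemma embedding_inverse:
  assumes G: "partial_embedding G" and x: "(x, x') \<in> G" "x \<noteq> 0"
  shows "(inverse x, inverse x') \<in> G"
proof -
  obtain q where q: "x * poly (map_poly to_ac q) x = 1"
    using inverse_poly_expression[OF x(2)] .
  let ?y = "poly (map_poly to_ac q) x" and ?y' = "poly (map_poly to_ac q) x'"
  have y: "(?y, ?y') \<in> G" using embedding_poly_const[OF G x(1)] .
  have "(1, x' * ?y') \<in> G" using embedding_mult[OF G x(1) y] q by simp
  then have "x' * ?y' = 1" using embedding_single_valued[OF G _ embedding_1[OF G]] by blast
  then have "inverse x = ?y" "inverse x' = ?y'" using q by (auto intro: inverse_unique)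
  then show ?thesis using y by simp
qed

text \<open>
  The minimal polynomial of \<open>x\<close> over the domain of an embedding, together with its image.
\<close>

definition minimal_pair :: "('k::field alg_closure \<times> 'k alg_closure) set \<Rightarrow> 'k alg_closure \<Rightarrow>
    'k alg_closure poly \<Rightarrow> 'k alg_closure poly \<Rightarrow> bool" where
  "minimal_pair G x g g' \<longleftrightarrow> poly_pair G g g' \<and> lead_coeff g = 1 \<and> poly g x = 0 \<and>
     (\<forall>h h'. poly_pair G h h' \<longrightarrow> h \<noteq> 0 \<longrightarrow> poly h x = 0 \<longrightarrow> degree g \<le> degree h)"

lemma minimal_pairD:
  assumes "minimal_pair G x g g'"
  shows "poly_pair G g g'" "lead_coeff g = 1" "poly g x = 0"
    "poly_pair G h h' \<Longrightarrow> h \<noteq> 0 \<Longrightarrow> poly h x = 0 \<Longrightarrow> degree g \<le> degree h"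
  using assms unfolding minimal_pair_def by blast+

text \<open>
  Division with remainder by the monic \<open>g\<close>, performed on both components at once. A leading
  term of \<open>h\<close> is cancelled by a multiple of \<open>g\<close> and the same step is copied on the image side.
\<close>

lemma minimal_pair_dvd:
  fixes G :: "('k::field alg_closure \<times> 'k alg_closure) set"
  assumes G: "partial_embedding G"
    and g: "minimal_pair G x g g'"
    and "poly_pair G h h'" "poly h x = 0"
  shows "g dvd h" "g' dvd h'"
proof -
  have "g dvd h \<and> g' dvd h'"
    using assms(3,4)
  proof (induction "if h = 0 then 0 else Suc (degree h)" arbitrary: h h' rule: less_induct)
    case less
    show ?case
    proof (cases "h = 0")
      case True
      then have "Polynomial.coeff h' i = 0" for i
        using less.prems(1) embedding_zero[OF G] by (auto simp: poly_pair_def)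
      then have "h' = 0" by (intro poly_eqI) simp
      then show ?thesis using True by simp
    next
      case False
      define k where "k = degree h - degree g"
      have dk: "degree g + k = degree h"
        using minimal_pairD(4)[OF g less.prems(1) False less.prems(2)] by (simp add: k_def)
      let ?m = "Polynomial.monom (lead_coeff h) k"
      let ?m' = "Polynomial.monom (Polynomial.coeff h' (degree h)) k"
      have pp: "poly_pair G (h - ?m * g) (h' - ?m' * g')"
        using less.prems(1) minimal_pairD(1)[OF g]
        by (auto simp: poly_pair_def coeff_monom_mult intro!: embedding_diff[OF G] embedding_mult[OF G] embedding_0[OF G])
      have ev: "poly (h - ?m * g) x = 0" using less.prems(2) minimal_pairD(3)[OF g] by simp
      have small: "h - ?m * g = 0 \<or> degree (h - ?m * g) < degree h"
      proof (rule disjCI)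
        assume ne: "\<not> degree (h - ?m * g) < degree h"
        have "degree ?m = k" using False by (intro degree_monom_eq) simp
        then have "degree (?m * g) \<le> degree h"
          using degree_mult_le[of ?m g] dk by simp
        then have le: "degree (h - ?m * g) \<le> degree h" by (intro degree_diff_le) auto
        have "Polynomial.coeff (h - ?m * g) (degree h) = 0"
          using dk minimal_pairD(2)[OF g] by (simp add: coeff_monom_mult flip: dk)
        then show "h - ?m * g = 0" using ne le
          by (metis leading_coeff_0_iff linorder_neqE_nat not_le)
      qed
      have "g dvd h - ?m * g \<and> g' dvd h' - ?m' * g'"
        by (rule less.hyps[OF _ pp ev]) (use small False in auto)
      then have "g dvd (h - ?m * g) + ?m * g \<and> g' dvd (h' - ?m' * g') + ?m' * g'"
        by (meson dvd_add dvd_triv_right)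
      then show ?thesis by simp
    qed
  qed
  then show "g dvd h" "g' dvd h'" by blast+
qed

text \<open>
  The usual extension step: \<open>x\<close> may be sent to any root of the image of its minimal polynomial.
  Divisibility by the minimal pair says exactly that the value at \<open>x'\<close> depends only on the value
  at \<open>x\<close>.
\<close>

lemma partial_embedding_adjoin:
  fixes G :: "('k::field alg_closure \<times> 'k alg_closure) set"
  assumes G: "partial_embedding G"
    and g: "minimal_pair G x g g'" "poly g' x' = 0"
  shows "partial_embedding (adjoin G x x')" "G \<subseteq> adjoin G x x'" "(x, x') \<in> adjoin G x x'"
proof -
  have zero: "poly h' x' = 0" if "poly_pair G h h'" "poly h x = 0" for h h'
    using minimal_pair_dvd(2)[OF G g(1) that] g(2) by (metis dvd_trans poly_eq_0_iff_dvd)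
  show sub: "G \<subseteq> adjoin G x x'"
  proof
    fix z assume "z \<in> G"
    obtain y y' where [simp]: "z = (y, y')" by (cases z)
    have "poly_pair G [:y:] [:y':]"
      using \<open>z \<in> G\<close> by (auto simp: poly_pair_def coeff_pCons intro: embedding_0[OF G] split: nat.split)
    then show "z \<in> adjoin G x x'" unfolding adjoin_def by force
  qed
  have "poly_pair G [:0, 1:] [:0, 1:]"
    by (auto simp: poly_pair_def coeff_pCons intro: embedding_0[OF G] embedding_1[OF G] split: nat.split)
  then show "(x, x') \<in> adjoin G x x'" unfolding adjoin_def by force
  show "partial_embedding (adjoin G x x')"
    unfolding partial_embedding_def
  proof (intro conjI allI impI)
    show "(to_ac c, to_ac c) \<in> adjoin G x x'" for c
      using sub embedding_const[OF G] by blast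
    fix y y' z z' assume "(y, y') \<in> adjoin G x x'" "(z, z') \<in> adjoin G x x'"
    then obtain h h' k k' where h: "poly_pair G h h'" "y = poly h x" "y' = poly h' x'"
      and k: "poly_pair G k k'" "z = poly k x" "z' = poly k' x'"
      unfolding adjoin_def by blast
    have "poly_pair G (h + k) (h' + k')"
      using h(1) k(1) by (auto simp: poly_pair_def intro: embedding_add[OF G])
    then show "(y + z, y' + z') \<in> adjoin G x x'"
      unfolding adjoin_def using h k by force
    have "poly_pair G (h * k) (h' * k')"
      using h(1) k(1) by (auto simp: poly_pair_def coeff_mult intro!: embedding_sum[OF G] embedding_mult[OF G])
    then show "(y * z, y' * z') \<in> adjoin G x x'"
      unfolding adjoin_def using h k by force
  next
    show "y = 0" if "(0, y) \<in> adjoin G x x'" for y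
      using that zero unfolding adjoin_def by force
  qed
qed

lemma minimal_pair_exists:
  fixes x :: "'k::field alg_closure"
  assumes G: "partial_embedding G"
  obtains g g' where "minimal_pair G x g g'"
proof -
  define S where "S = {h. h \<noteq> 0 \<and> poly h x = 0 \<and> (\<exists>h'. poly_pair G h h')}"
  obtain f :: "'k poly" where f: "f \<noteq> 0" "poly (map_poly to_ac f) x = 0"
    using alg_closure_algebraic by blast
  have "poly_pair G (map_poly to_ac f) (map_poly to_ac f)"
    by (auto simp: poly_pair_def coeff_map_poly intro: embedding_const[OF G])
  moreover have "map_poly to_ac f \<noteq> 0" using f(1) by (auto simp: poly_eq_iff coeff_map_poly)
  ultimately have "map_poly to_ac f \<in> S" using f by (auto simp: S_def)
  then obtain h where h: "h \<in> S" and le: "\<And>k. k \<in> S \<Longrightarrow> degree h \<le> degree k"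
    using ex_has_least_nat[of "\<lambda>h. h \<in> S" _ degree] by blast
  from h obtain h' where h': "h \<noteq> 0" "poly h x = 0" "poly_pair G h h'" by (auto simp: S_def)
  let ?l = "lead_coeff h" and ?l' = "Polynomial.coeff h' (degree h)"
  have inv: "(inverse ?l, inverse ?l') \<in> G"
    using h'(1,3) by (intro embedding_inverse[OF G]) (auto simp: poly_pair_def)
  have "minimal_pair G x (smult (inverse ?l) h) (smult (inverse ?l') h')"
    unfolding minimal_pair_def
  proof (intro conjI allI impI)
    show "poly_pair G (smult (inverse ?l) h) (smult (inverse ?l') h')"
      using h'(3) inv by (auto simp: poly_pair_def intro: embedding_mult[OF G])
    show "lead_coeff (smult (inverse ?l) h) = 1" "poly (smult (inverse ?l) h) x = 0"
      using h' by auto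
    show "degree (smult (inverse ?l) h) \<le> degree k" if "poly_pair G k k'" "k \<noteq> 0" "poly k x = 0" for k k'
      using le[of k] that h'(1) by (auto simp: S_def)
  qed
  then show ?thesis by (rule that)
qed

lemma partial_embedding_total:
  fixes G :: "('k::field alg_closure \<times> 'k alg_closure) set"
  assumes G: "partial_embedding G"
  obtains H where "G \<subseteq> H" "partial_embedding H" "Domain H = UNIV"
proof -
  define \<A> where "\<A> = {H. G \<subseteq> H \<and> partial_embedding H}"
  have "\<exists>H\<in>\<A>. \<forall>Y\<in>\<A>. H \<subseteq> Y \<longrightarrow> Y = H"
  proof (rule subset_Zorn_nonempty)
    show "\<A> \<noteq> {}" using G by (auto simp: \<A>_def)
    fix \<C> assume ne: "\<C> \<noteq> {}" and ch: "subset.chain \<A> \<C>"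
    have sub: "\<And>C. C \<in> \<C> \<Longrightarrow> G \<subseteq> C \<and> partial_embedding C"
      using ch by (auto simp: subset.chain_def \<A>_def)
    have common: "\<exists>C\<in>\<C>. a \<in> C \<and> b \<in> C" if "a \<in> \<Union>\<C>" "b \<in> \<Union>\<C>" for a b
    proof -
      obtain C D where CD: "C \<in> \<C>" "a \<in> C" "D \<in> \<C>" "b \<in> D" using \<open>a \<in> \<Union>\<C>\<close> \<open>b \<in> \<Union>\<C>\<close> by blast
      then have "C \<subseteq> D \<or> D \<subseteq> C" using ch by (simp add: subset_chain_def)
      then show ?thesis using CD by blast
    qed
    have "partial_embedding (\<Union>\<C>)"
      unfolding partial_embedding_def
    proof (intro conjI allI impI)
      show "(to_ac c, to_ac c) \<in> \<Union>\<C>" for c using ne sub embedding_const by blast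
      fix x x' y y' assume "(x, x') \<in> \<Union>\<C>" "(y, y') \<in> \<Union>\<C>"
      then obtain C where "C \<in> \<C>" "(x, x') \<in> C" "(y, y') \<in> C" using common by blast
      then show "(x + y, x' + y') \<in> \<Union>\<C>" "(x * y, x' * y') \<in> \<Union>\<C>"
        using sub embedding_add embedding_mult by blast+
    next
      show "y = 0" if "(0, y) \<in> \<Union>\<C>" for y using that sub embedding_zero by blast
    qed
    then show "\<Union>\<C> \<in> \<A>" using ne sub by (auto simp: \<A>_def)
  qed
  then obtain H where H: "G \<subseteq> H" "partial_embedding H"
    and max: "\<And>Y. Y \<in> \<A> \<Longrightarrow> H \<subseteq> Y \<Longrightarrow> Y = H" by (auto simp: \<A>_def)
  have "x \<in> Domain H" for x
  proof -
    obtain g g' where g0: "minimal_pair H x g g'" using minimal_pair_exists[OF H(2)] .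
    note g = minimal_pairD[OF g0]
    have "degree g \<noteq> 0"
    proof
      assume "degree g = 0"
      then have "g = 1" using g(2) by (metis degree_0_id one_pCons)
      then show False using g(3) by simp
    qed
    moreover have "Polynomial.coeff g' (degree g) = 1"
      using g(1,2) embedding_single_valued[OF H(2) _ embedding_1[OF H(2)]] by (metis poly_pair_def)
    ultimately have "degree g' > 0" by (metis bot_nat_0.not_eq_extremum coeff_eq_0 zero_neq_one)
    then obtain x' where x': "poly g' x' = 0" using alg_closed_imp_poly_has_root by blast
    note adj = partial_embedding_adjoin[OF H(2) g0 x']
    have "adjoin H x x' = H" using adj H by (intro max) (auto simp: \<A>_def)
    then show ?thesis using adj(3) by auto
  qed
  then show ?thesis using that[of H] H by auto
qed

text \<open>
  An embedding over \<open>K\<close> permutes the finitely many roots of each polynomial over \<open>K\<close>, and every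
  element is such a root.
\<close>

lemma embedding_surj:
  fixes \<sigma> :: "'k::field alg_closure \<Rightarrow> 'k alg_closure"
  assumes add: "\<And>x y. \<sigma> (x + y) = \<sigma> x + \<sigma> y" and mult: "\<And>x y. \<sigma> (x * y) = \<sigma> x * \<sigma> y"
    and const: "\<And>c. \<sigma> (to_ac c) = to_ac c"
  shows "inj \<sigma>" "surj \<sigma>"
proof -
  have zero: "\<sigma> 0 = 0" using const[of 0] by simp
  have one: "\<sigma> 1 = 1" using const[of 1] by simp
  have diff: "\<sigma> (x - y) = \<sigma> x - \<sigma> y" for x y using add[of "x - y" y] by simp
  show inj: "inj \<sigma>"
  proof (rule injI)
    fix x y assume "\<sigma> x = \<sigma> y"
    then have *: "\<sigma> (x - y) = 0" by (simp add: diff)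
    show "x = y"
    proof (rule ccontr)
      assume "x \<noteq> y"
      then have "\<sigma> ((x - y) * inverse (x - y)) = 1" using one by simp
      then show False using * by (simp add: mult)
    qed
  qed
  have power: "\<sigma> (x ^ n) = \<sigma> x ^ n" for x n by (induction n) (auto simp: one mult)
  have sum: "\<sigma> (sum f I) = (\<Sum>i\<in>I. \<sigma> (f i))" for f :: "nat \<Rightarrow> _" and I
    by (induction I rule: infinite_finite_induct) (auto simp: zero add)
  show "surj \<sigma>"
    unfolding surj_def
  proof
    fix y
    obtain f :: "'k poly" where f: "f \<noteq> 0" "poly (map_poly to_ac f) y = 0"
      using alg_closure_algebraic by blast
    let ?Z = "{z. poly (map_poly to_ac f) z = 0}"
    have "map_poly to_ac f \<noteq> 0" using f(1) by (auto simp: poly_eq_iff coeff_map_poly)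
    then have fin: "finite ?Z" by (rule poly_roots_finite)
    have "poly (map_poly to_ac f) (\<sigma> z) = \<sigma> (poly (map_poly to_ac f) z)" for z
      by (simp add: poly_altdef sum mult const power coeff_map_poly)
    then have "\<sigma> ` ?Z \<subseteq> ?Z" by (auto simp: zero)
    then have "\<sigma> ` ?Z = ?Z" using fin inj by (intro endo_inj_surj) (auto intro: inj_on_subset)
    then have "y \<in> \<sigma> ` ?Z" using f(2) by simp
    then show "\<exists>x. y = \<sigma> x" by blast
  qed
qed

text \<open>
  Send \<open>x\<close> to another root of its minimal polynomial over \<open>L\<close> and extend. Another root exists:
  otherwise the minimal polynomial is a power of \<open>X - x\<close>, of exponent at least 2 because
  \<open>x \<notin> L\<close>, and then \<open>x\<close> is a multiple root of \<open>f\<close>.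
\<close>

lemma separable_conjugate:
  fixes L :: "'k::field alg_closure set"
  assumes L: "range to_ac \<subseteq> L" "\<And>x y. x \<in> L \<Longrightarrow> y \<in> L \<Longrightarrow> x + y \<in> L"
      "\<And>x y. x \<in> L \<Longrightarrow> y \<in> L \<Longrightarrow> x * y \<in> L"
    and x: "x \<notin> L"
    and f: "\<And>i. Polynomial.coeff f i \<in> L" "poly f x = 0" "poly (pderiv f) x \<noteq> 0"
  obtains \<sigma> where "\<sigma> \<in> ring_iso (ring_on UNIV) (ring_on UNIV)" "\<And>y. y \<in> L \<Longrightarrow> \<sigma> y = y" "\<sigma> x \<noteq> x"
proof -
  define G where "G = Id_on L"
  have G: "partial_embedding G"
    unfolding partial_embedding_def G_def using L by auto
  have pair: "h = h'" if "poly_pair G h h'" for h h'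
      proof (rule poly_eqI)
    show "Polynomial.coeff h i = Polynomial.coeff h' i" for i
      using that unfolding poly_pair_def G_def by (metis Id_onE prod.inject)
  qed
  have pair': "poly_pair G h h \<longleftrightarrow> (\<forall>i. Polynomial.coeff h i \<in> L)" for h
    by (auto simp: poly_pair_def G_def)
  obtain g where g0: "minimal_pair G x g g"
    using minimal_pair_exists[OF G] pair minimal_pairD(1) by metis
  note g = minimal_pairD[OF g0]
  have "g dvd f"
    using minimal_pair_dvd(1)[OF G g0, of f f] f(1,2) by (auto simp: pair')
  have "g \<noteq> 0" using g(2) by auto
  then obtain R where R: "size R = degree g" "g = (\<Prod>r\<in>#R. [:- r, 1:])"
    using alg_closed_imp_factorization[of g] g(2) by auto
  have "\<exists>x'. poly g x' = 0 \<and> x' \<noteq> x"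
  proof (rule ccontr)
    assume "\<not> ?thesis"
    then have all: "\<And>r. r \<in># R \<Longrightarrow> r = x"
      using R(2) by (auto simp: poly_prod_mset)
    then have "R = replicate_mset (degree g) x"
      using R(1) by (metis set_mset_subset_singletonD subsetI singleton_iff)
    then have gpow: "g = [:- x, 1:] ^ degree g" using R(2) by (metis image_replicate_mset prod_mset_replicate_mset)
    have "\<not> 2 \<le> degree g"
    proof
      assume "2 \<le> degree g"
      then have "[:- x, 1:] ^ 2 dvd f" using gpow \<open>g dvd f\<close> by (metis dvd_trans le_imp_power_dvd)
      then obtain k where "f = [:- x, 1:] * ([:- x, 1:] * k)"
        by (elim dvdE) (simp only: power2_eq_square mult.assoc)
      then have "poly (pderiv f) x = 0" by (simp only: pderiv_mult poly_add poly_mult) simp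
      then show False using f(3) by simp
    qed
    then consider "degree g = 0" | "degree g = 1" by linarith
    then show False
    proof cases
      case 1
      then show False using gpow g(3) by (metis power_0 poly_1 zero_neq_one)
    next
      case 2
      then have "g = [:- x, 1:]" using gpow by simp
      then have "- x \<in> L" using g(1) unfolding pair' by (metis coeff_pCons_0)
      then have "to_ac (- 1) * (- x) \<in> L" using L by blast
      then show False using x by simp
    qed
  qed
  then obtain x' where x': "poly g x' = 0" "x' \<noteq> x" by blast
  note adj = partial_embedding_adjoin[OF G g0 x'(1)]
  obtain H where H: "adjoin G x x' \<subseteq> H" "partial_embedding H" "Domain H = UNIV"
    using partial_embedding_total[OF adj(1)] .
  define \<sigma> where "\<sigma> y = (THE z. (y, z) \<in> H)" for y
  have \<sigma>: "(y, z) \<in> H \<Longrightarrow> \<sigma> y = z" for y z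
    unfolding \<sigma>_def using embedding_single_valued[OF H(2)] by blast
  have graph: "(y, \<sigma> y) \<in> H" for y using \<sigma> H(3) by (metis DomainE UNIV_I)
  have add: "\<sigma> (y + z) = \<sigma> y + \<sigma> z" and mult: "\<sigma> (y * z) = \<sigma> y * \<sigma> z" for y z
    using embedding_add[OF H(2) graph graph] embedding_mult[OF H(2) graph graph] by (auto intro: \<sigma>)
  have const: "\<sigma> (to_ac c) = to_ac c" for c using embedding_const[OF H(2)] by (rule \<sigma>)
  show ?thesis
  proof (rule that[of \<sigma>])
    show "\<sigma> \<in> ring_iso (ring_on UNIV) (ring_on UNIV)"
      using embedding_surj[OF add mult const] const[of 1]
      by (auto simp: ring_iso_def ring_hom_def ring_of_type_algebra_def add mult bij_def)
    show "\<sigma> y = y" if "y \<in> L" for y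
      using that H(1) adj(2) by (intro \<sigma>) (auto simp: G_def)
    show "\<sigma> x \<noteq> x" using \<sigma> adj(3) H(1) x'(2) by blast
  qed
qed

section \<open>Non-archimedean absolute values\<close>

lemma sum_lessThan_diff:
  fixes f :: "nat \<Rightarrow> 'a::ab_group_add"
  shows "n \<le> m \<Longrightarrow> (\<Sum>i<m. f i) - (\<Sum>i<n. f i) = (\<Sum>i\<in>{n..<m}. f i)"
  by (simp add: lessThan_atLeast0 sum_diff_nat_ivl)

locale ultranorm =
  fixes N :: "'a::field \<Rightarrow> real"
  assumes N_eq_0_iff [simp]: "N x = 0 \<longleftrightarrow> x = 0"
    and N_nonneg [simp]: "0 \<le> N x"
    and N_mult: "N (x * y) = N x * N y"
    and N_add: "N (x + y) \<le> max (N x) (N y)"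
begin

lemma N_0 [simp]: "N 0 = 0" by simp

lemma N_pos_iff [simp]: "0 < N x \<longleftrightarrow> x \<noteq> 0"
  using N_nonneg[of x] N_eq_0_iff[of x] by linarith

lemma N_1 [simp]: "N 1 = 1"
  using N_mult[of 1 1] by simp

lemma N_power: "N (x ^ n) = N x ^ n"
  by (induction n) (auto simp: N_mult)

lemma N_minus [simp]: "N (- x) = N x"
proof -
  have "N (- 1) * N (- 1) = 1" using N_mult[of "- 1" "- 1"] by simp
  then have "N (- 1) = 1"
    by (metis N_nonneg abs_of_nonneg abs_square_eq_1 power2_eq_square)
  then show ?thesis using N_mult[of "- 1" x] by simp
qed

lemma N_diff: "N (x - y) \<le> max (N x) (N y)"
  using N_add[of x "- y"] by simp

lemma N_diff_commute: "N (x - y) = N (y - x)"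
  using N_minus[of "x - y"] by simp

lemma N_diff_triangle: "N (x - z) \<le> max (N (x - y)) (N (y - z))"
  using N_add[of "x - y" "y - z"] by simp

lemma N_inverse: "N (inverse x) = inverse (N x)"
proof (cases "x = 0")
  case False
  then have "N x * N (inverse x) = 1" using N_mult[of x "inverse x"] by simp
  then show ?thesis by (metis inverse_unique)
qed simp

lemma N_divide: "N (x / y) = N x / N y"
  by (simp add: divide_inverse N_mult N_inverse)

lemma N_add_dominant: "N x < N y \<Longrightarrow> N (x + y) = N y"
  using N_add[of x y] N_diff[of "x + y" x] by auto

lemma N_sum_le: "0 \<le> B \<Longrightarrow> (\<And>i. i \<in> I \<Longrightarrow> N (f i) \<le> B) \<Longrightarrow> N (sum f I) \<le> B"
proof (induction I rule: infinite_finite_induct)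
  case (insert i I)
  then show ?case using N_add[of "f i" "sum f I"] by force
qed auto

lemma N_sum_less: "0 < B \<Longrightarrow> (\<And>i. i \<in> I \<Longrightarrow> N (f i) < B) \<Longrightarrow> N (sum f I) < B"
proof (induction I rule: infinite_finite_induct)
  case (insert i I)
  then show ?case using N_add[of "f i" "sum f I"] by force
qed auto

definition ulim :: "(nat \<Rightarrow> 'a) \<Rightarrow> 'a \<Rightarrow> bool" where
  "ulim s L \<longleftrightarrow> (\<forall>e>0. \<exists>k. \<forall>n\<ge>k. N (s n - L) < e)"

definition ucauchy :: "(nat \<Rightarrow> 'a) \<Rightarrow> bool" where
  "ucauchy s \<longleftrightarrow> (\<forall>e>0. \<exists>k. \<forall>m\<ge>k. \<forall>n\<ge>k. N (s m - s n) < e)"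

definition ucomplete :: "'a set \<Rightarrow> bool" where
  "ucomplete W \<longleftrightarrow> (\<forall>s. (\<forall>n. s n \<in> W) \<longrightarrow> ucauchy s \<longrightarrow> (\<exists>L\<in>W. ulim s L))"

lemma ucompleteD: "ucomplete W \<Longrightarrow> (\<And>n. s n \<in> W) \<Longrightarrow> ucauchy s \<Longrightarrow> \<exists>L\<in>W. ulim s L"
  unfolding ucomplete_def by simp

text \<open>
  Closed balls around any centre are closed.
\<close>

lemma ulim_bound:
  assumes "ulim s L" "\<And>n. k \<le> n \<Longrightarrow> N (s n - y) \<le> e"
  shows "N (L - y) \<le> e"
proof (rule field_le_epsilon)
  fix d :: real assume "d > 0"
  then obtain j where j: "\<And>n. n \<ge> j \<Longrightarrow> N (s n - L) < d"
    using assms(1) unfolding ulim_def by blast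
  have "N (L - y) \<le> max (N (L - s (max j k))) (N (s (max j k) - y))" by (rule N_diff_triangle)
  also have "\<dots> \<le> e + d"
    using j[of "max j k"] assms(2)[of "max j k"] N_diff_commute[of L "s (max j k)"] \<open>d > 0\<close>
      order_trans[OF N_nonneg assms(2)[of "max j k"]] by auto
  finally show "N (L - y) \<le> e + d" .
qed

lemma ulim_unique: "ulim s L \<Longrightarrow> ulim s L' \<Longrightarrow> L = L'"
proof (rule ccontr)
  assume lims: "ulim s L" "ulim s L'" and "L \<noteq> L'"
  then obtain k where "\<And>n. n \<ge> k \<Longrightarrow> N (s n - L') < N (L - L') / 2"
    unfolding ulim_def by (metis N_pos_iff eq_iff_diff_eq_0 half_gt_zero_iff)
  then have "N (L - L') \<le> N (L - L') / 2"
    by (intro ulim_bound[OF lims(1)]) (auto intro: less_imp_le)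
  then show False using \<open>L \<noteq> L'\<close> N_pos_iff[of "L - L'"] by auto
qed

lemma ulim_const: "ulim (\<lambda>_. c) c"
  by (simp add: ulim_def)

lemma ulim_add: "ulim s L \<Longrightarrow> ulim t M \<Longrightarrow> ulim (\<lambda>n. s n + t n) (L + M)"
  unfolding ulim_def
proof (intro allI impI)
  fix e :: real
  assume "\<forall>e>0. \<exists>k. \<forall>n\<ge>k. N (s n - L) < e" "\<forall>e>0. \<exists>k. \<forall>n\<ge>k. N (t n - M) < e" "e > 0"
  then obtain j k where "\<forall>n\<ge>j. N (s n - L) < e" "\<forall>n\<ge>k. N (t n - M) < e" by blast
  then have "\<forall>n\<ge>max j k. N (s n + t n - (L + M)) < e"
    using N_add by (metis (no_types, lifting) add_diff_add max.bounded_iff max_less_iff_conj order_le_less_trans)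
  then show "\<exists>k. \<forall>n\<ge>k. N (s n + t n - (L + M)) < e" by blast
qed

lemma ulim_mult_const: "ulim s L \<Longrightarrow> ulim (\<lambda>n. c * s n) (c * L)"
  unfolding ulim_def
proof (intro allI impI)
  fix e :: real assume s: "\<forall>e>0. \<exists>k. \<forall>n\<ge>k. N (s n - L) < e" and "e > 0"
  then have "e / (N c + 1) > 0" by (simp add: add_nonneg_pos)
  then obtain k where k: "\<forall>n\<ge>k. N (s n - L) < e / (N c + 1)" using s by blast
  have "N (c * s n - c * L) < e" if "n \<ge> k" for n
  proof -
    have "N (c * s n - c * L) = N c * N (s n - L)" by (simp add: N_mult flip: right_diff_distrib)
    also have "\<dots> \<le> (N c + 1) * N (s n - L)" by (simp add: mult_right_mono)
    also have "\<dots> < e" using k that N_nonneg[of c] by (simp add: pos_less_divide_eq mult.commute add_nonneg_pos)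
    finally show ?thesis .
  qed
  then show "\<exists>k. \<forall>n\<ge>k. N (c * s n - c * L) < e" by blast
qed

lemma ulim_diff: "ulim s L \<Longrightarrow> ulim t M \<Longrightarrow> ulim (\<lambda>n. s n - t n) (L - M)"
  using ulim_add[of s L "\<lambda>n. (- 1) * t n" "(- 1) * M"] ulim_mult_const[of t M "- 1"] by simp

lemma ulim_mult:
  assumes "ulim s L" "ulim t M" shows "ulim (\<lambda>n. s n * t n) (L * M)"
proof -
  have "ulim (\<lambda>n. (s n - L) * (t n - M)) 0"
    unfolding ulim_def
  proof (intro allI impI)
    fix e :: real assume "e > 0"
    then obtain j k where jk: "\<forall>n\<ge>j. N (s n - L) < e" "\<forall>n\<ge>k. N (t n - M) < 1"
      using assms unfolding ulim_def by (metis zero_less_one)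
    have "N (s n - L) * N (t n - M) < e * 1" if "n \<ge> max j k" for n
      using jk that by (intro mult_strict_mono') auto
    then show "\<exists>k. \<forall>n\<ge>k. N ((s n - L) * (t n - M) - 0) < e"
      by (intro exI[of _ "max j k"]) (simp add: N_mult)
  qed
  from ulim_add[OF this ulim_diff[OF ulim_add[OF ulim_mult_const[OF assms(1), of M]
        ulim_mult_const[OF assms(2), of L]] ulim_const[of "L * M"]]]
  show ?thesis by (simp add: algebra_simps)
qed

lemma ulim_power: "ulim s L \<Longrightarrow> ulim (\<lambda>n. s n ^ m) (L ^ m)"
  by (induction m) (auto intro: ulim_const ulim_mult)

lemma ulim_sum: "(\<And>i. i \<in> I \<Longrightarrow> ulim (s i) (L i)) \<Longrightarrow> ulim (\<lambda>n. \<Sum>i\<in>I. s i n) (\<Sum>i\<in>I. L i)"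
  by (induction I rule: infinite_finite_induct) (auto intro: ulim_const ulim_add)

lemma ulim_imp_ucauchy:
  assumes "ulim s L" shows "ucauchy s"
  unfolding ucauchy_def
proof (intro allI impI)
  fix e :: real assume "e > 0"
  then obtain k where k: "\<forall>n\<ge>k. N (s n - L) < e" using assms unfolding ulim_def by blast
  have "N (s m - s n) < e" if "m \<ge> k" "n \<ge> k" for m n
    using N_diff_triangle[of "s m" "s n" L] N_diff_commute[of L "s n"] k that
    by (smt (verit, best))
  then show "\<exists>k. \<forall>m\<ge>k. \<forall>n\<ge>k. N (s m - s n) < e" by blast
qed

lemma ucauchy_bounded_by:
  assumes "ucauchy s" "\<And>m n. N (t m - t n) \<le> C * N (s m - s n)"
  shows "ucauchy t"
  unfolding ucauchy_def
proof (intro allI impI)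
  fix e :: real assume "e > 0"
  then have "e / (\<bar>C\<bar> + 1) > 0" by simp
  then obtain k where k: "\<forall>m\<ge>k. \<forall>n\<ge>k. N (s m - s n) < e / (\<bar>C\<bar> + 1)"
    using assms(1) unfolding ucauchy_def by blast
  have "N (t m - t n) < e" if "m \<ge> k" "n \<ge> k" for m n
  proof -
    have "N (t m - t n) \<le> (\<bar>C\<bar> + 1) * N (s m - s n)"
      by (rule order_trans[OF assms(2) mult_right_mono]) auto
    also have "\<dots> < e" using k that by (simp add: pos_less_divide_eq mult.commute)
    finally show ?thesis .
  qed
  then show "\<exists>k. \<forall>m\<ge>k. \<forall>n\<ge>k. N (t m - t n) < e" by blast
qed

lemma ucauchy_diff:
  assumes "ucauchy s" "ucauchy t" shows "ucauchy (\<lambda>n. s n - t n)"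
  unfolding ucauchy_def
proof (intro allI impI)
  fix e :: real assume "e > 0"
  then obtain j k where jk: "\<forall>m\<ge>j. \<forall>n\<ge>j. N (s m - s n) < e" "\<forall>m\<ge>k. \<forall>n\<ge>k. N (t m - t n) < e"
    using assms unfolding ucauchy_def by meson
  have "N ((s m - t m) - (s n - t n)) < e" if "m \<ge> max j k" "n \<ge> max j k" for m n
    using N_diff[of "s m - s n" "t m - t n"] jk that by (simp add: algebra_simps) (smt (verit, best))
  then show "\<exists>k. \<forall>m\<ge>k. \<forall>n\<ge>k. N ((s m - t m) - (s n - t n)) < e" by blast
qed

text \<open>By the ultrametric inequality a tail of the series is as small as its largest term.\<close>

lemma ucauchy_partial_sums:
  assumes "\<And>e. e > 0 \<Longrightarrow> \<exists>k. \<forall>n\<ge>k. N (f n) < e"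
  shows "ucauchy (\<lambda>n. \<Sum>i<n. f i)"
  unfolding ucauchy_def
proof (intro allI impI)
  fix e :: real assume e: "e > 0"
  then obtain k where k: "\<forall>n\<ge>k. N (f n) < e" using assms by blast
  have *: "N ((\<Sum>i<m. f i) - (\<Sum>i<n. f i)) < e" if "k \<le> n" "n \<le> m" for m n
  proof -
    have "(\<Sum>i<m. f i) - (\<Sum>i<n. f i) = (\<Sum>i\<in>{n..<m}. f i)"
      using that(2) by (rule sum_lessThan_diff)
    then show ?thesis using e k that(1) by (auto intro: N_sum_less)
  qed
  have "N ((\<Sum>i<m. f i) - (\<Sum>i<n. f i)) < e" if "k \<le> m" "k \<le> n" for m n
    using *[of n m] *[of m n] that N_diff_commute by (metis nle_le)
  then show "\<exists>k. \<forall>m\<ge>k. \<forall>n\<ge>k. N ((\<Sum>i<m. f i) - (\<Sum>i<n. f i)) < e" by blast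
qed

end

section \<open>Uniqueness of the extension of a complete absolute value\<close>

interpretation ac: vector_space "\<lambda>(c::'k::field) (x::'k alg_closure). to_ac c * x"
  by unfold_locales (auto simp: algebra_simps)

lemma map_poly_to_ac_mult: "map_poly to_ac (f * g) = map_poly to_ac f * map_poly to_ac g"
  by (rule poly_eqI) (simp add: coeff_map_poly coeff_mult to_ac_sum)

lemma map_poly_to_ac_add: "map_poly to_ac (f + g) = map_poly to_ac f + map_poly to_ac g"
  by (rule poly_eqI) (simp add: coeff_map_poly)

text \<open>
  The ring \<open>K[x]\<close>.
\<close>

definition simple_extension :: "'k::field alg_closure \<Rightarrow> 'k alg_closure set" where
  "simple_extension x = range (\<lambda>q. poly (map_poly to_ac q) x)"

lemma simple_extension_const: "to_ac c \<in> simple_extension x"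
proof -
  have "to_ac c = poly (map_poly to_ac [:c:]) x" by (simp add: map_poly_pCons)
  then show ?thesis unfolding simple_extension_def by blast
qed

lemma simple_extension_gen: "x \<in> simple_extension x"
proof -
  have "x = poly (map_poly to_ac [:0, 1:]) x" by (simp add: map_poly_pCons)
  then show ?thesis unfolding simple_extension_def by blast
qed

lemma simple_extension_add: "y \<in> simple_extension x \<Longrightarrow> z \<in> simple_extension x \<Longrightarrow> y + z \<in> simple_extension x"
  and simple_extension_mult: "y \<in> simple_extension x \<Longrightarrow> z \<in> simple_extension x \<Longrightarrow> y * z \<in> simple_extension x"
  by (auto simp: simple_extension_def simp flip: poly_add poly_mult map_poly_to_ac_add map_poly_to_ac_mult)

lemma simple_extension_diff: "y \<in> simple_extension x \<Longrightarrow> z \<in> simple_extension x \<Longrightarrow> y - z \<in> simple_extension x"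
  using simple_extension_add[OF _ simple_extension_mult[OF simple_extension_const[of "- 1"]], of y x z] by simp

lemma simple_extension_power: "y \<in> simple_extension x \<Longrightarrow> y ^ n \<in> simple_extension x"
  using simple_extension_const[of 1 x] by (induction n) (auto intro: simple_extension_mult)

lemma simple_extension_sum: "(\<And>i. i \<in> I \<Longrightarrow> f i \<in> simple_extension x) \<Longrightarrow> sum f I \<in> simple_extension x"
  using simple_extension_const[of 0 x] by (induction I rule: infinite_finite_induct) (auto intro: simple_extension_add)

lemma simple_extension_finite:
  fixes x :: "'k::field alg_closure"
  obtains B where "finite B" "simple_extension x = ac.span B"
proof -
  obtain f :: "'k poly" where f: "f \<noteq> 0" "poly (map_poly to_ac f) x = 0"
    using alg_closure_algebraic by blast
  let ?B = "(\<lambda>i. x ^ i) ` {..<degree f}"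
  have "poly (map_poly to_ac q) x \<in> ac.span ?B" for q
  proof -
    define r where "r = q mod f"
    have "q = q div f * f + r" by (simp add: r_def)
    then have "poly (map_poly to_ac q) x = poly (map_poly to_ac r) x"
      using f(2) by (metis map_poly_to_ac_mult map_poly_to_ac_add poly_add poly_mult mult_zero_right add_0)
    also have "\<dots> = (\<Sum>i\<le>degree (map_poly to_ac r). to_ac (Polynomial.coeff r i) * x ^ i)"
      by (simp add: poly_altdef coeff_map_poly)
    also have "\<dots> \<in> ac.span ?B"
    proof (rule ac.span_sum)
      fix i
      have "Polynomial.coeff r i = 0" if "\<not> i < degree f"
        using degree_mod_less[OF f(1), of q] that by (auto simp: r_def intro: coeff_eq_0)
      then show "to_ac (Polynomial.coeff r i) * x ^ i \<in> ac.span ?B"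
        by (cases "i < degree f") (auto intro: ac.span_scale ac.span_base ac.span_zero)
    qed
    finally show ?thesis .
  qed
  then have "simple_extension x \<subseteq> ac.span ?B" by (auto simp: simple_extension_def)
  moreover have "ac.span ?B \<subseteq> simple_extension x"
  proof (rule ac.span_minimal)
    show "?B \<subseteq> simple_extension x" by (auto intro: simple_extension_power simple_extension_gen)
    show "ac.subspace (simple_extension x)"
      unfolding ac.subspace_def using simple_extension_const[of 0 x]
      by (auto intro: simple_extension_add simple_extension_mult simple_extension_const)
  qed
  ultimately show ?thesis using that[of ?B] by blast
qed

locale complete_base = ultranorm N for N :: "'k::field alg_closure \<Rightarrow> real" +
  assumes base_complete: "ucomplete (range to_ac)"
begin

text \<open>
  A complete subspace is closed, and \<open>b\<close> lies outside it.
\<close>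

lemma positive_distance:
  assumes W: "ucomplete (ac.span B)" and b: "b \<notin> ac.span B"
  obtains d where "d > 0" "\<And>y. y \<in> ac.span B \<Longrightarrow> d \<le> N (b + y)"
proof -
  have "\<exists>d>0. \<forall>y\<in>ac.span B. d \<le> N (b + y)"
  proof (rule ccontr)
    assume "\<not> ?thesis"
    then have "\<forall>n. \<exists>y\<in>ac.span B. N (b + y) < 1 / real (Suc n)"
      by (meson not_le of_nat_0_less_iff zero_less_Suc zero_less_divide_1_iff)
    then obtain y where y: "\<And>n. y n \<in> ac.span B" "\<And>n. N (b + y n) < 1 / real (Suc n)" by metis
    have lim: "ulim y (- b)"
      unfolding ulim_def
    proof (intro allI impI)
      fix e :: real assume "e > 0"
      then obtain k where k: "inverse (real (Suc k)) < e" using reals_Archimedean by blast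
      have "N (y n - - b) < e" if "n \<ge> k" for n
      proof -
        have "N (y n - - b) < 1 / real (Suc n)" using y(2)[of n] by (simp add: add.commute)
        also have "\<dots> \<le> inverse (real (Suc k))" using that by (simp add: field_simps)
        finally show ?thesis using k by simp
      qed
      then show "\<exists>k. \<forall>n\<ge>k. N (y n - - b) < e" by blast
    qed
    then obtain L where "L \<in> ac.span B" "ulim y L"
      using W y(1) ulim_imp_ucauchy unfolding ucomplete_def by meson
    then have "- b \<in> ac.span B" using lim ulim_unique by blast
    then show False using b ac.span_neg[of "- b" B] by simp
  qed
  then show ?thesis using that by blast
qed

lemma span_insertE:
  assumes "z \<in> ac.span (insert b B)"
  obtains c y where "z = to_ac c * b + y" "y \<in> ac.span B"
  using assms that by (metis ac.span_breakdown_eq diff_add_cancel add.commute)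

lemma distance_scale:
  assumes d: "\<And>y. y \<in> ac.span B \<Longrightarrow> d \<le> N (b + y)" and y: "y \<in> ac.span B"
  shows "N (to_ac c) * d \<le> N (to_ac c * b + y)"
proof (cases "c = 0")
  case False
  have "to_ac (inverse c) * y \<in> ac.span B" using y by (rule ac.span_scale)
  then have "N (to_ac c) * d \<le> N (to_ac c) * N (b + to_ac (inverse c) * y)"
    by (intro mult_left_mono d) auto
  also have "\<dots> = N (to_ac c * b + y)" using False by (simp add: algebra_simps flip: N_mult)
  finally show ?thesis .
qed simp

text \<open>
  Adjoin one basis vector \<open>b\<close> at a time. Its positive distance from the span of the others
  bounds its coefficient by the norm of the whole vector, so the coefficients of a Cauchy sequence
  form a Cauchy sequence in \<open>K\<close>, and the remaining part is Cauchy in a complete space.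
\<close>

lemma finite_span_complete: "finite B \<Longrightarrow> ucomplete (ac.span B)"
proof (induction B rule: finite_induct)
  case empty
  then show ?case by (auto simp: ucomplete_def ulim_def)
next
  case (insert b B)
  show ?case
  proof (cases "b \<in> ac.span B")
    case True
    then show ?thesis using insert.IH by (simp add: ac.span_redundant)
  next
    case False
    obtain d where d: "d > 0" "\<And>y. y \<in> ac.span B \<Longrightarrow> d \<le> N (b + y)"
      using positive_distance[OF insert.IH False] by metis
    show ?thesis
      unfolding ucomplete_def
    proof (intro allI impI)
      fix s assume s: "\<forall>n. s n \<in> ac.span (insert b B)" and "ucauchy s"
      have "\<exists>c y. s n = to_ac c * b + y \<and> y \<in> ac.span B" for n
        using span_insertE[of "s n" b B] s by metis
      then obtain c y where cy: "\<And>n. s n = to_ac (c n) * b + y n" "\<And>n. y n \<in> ac.span B" by metis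
      have "ucauchy (\<lambda>n. to_ac (c n))"
      proof (rule ucauchy_bounded_by[OF \<open>ucauchy s\<close>])
        fix m n
        have "N (to_ac (c m - c n)) * d \<le> N (to_ac (c m - c n) * b + (y m - y n))"
          using cy(2) by (intro distance_scale d ac.span_diff)
        also have "\<dots> = N (s m - s n)" by (simp add: cy(1) algebra_simps)
        finally show "N (to_ac (c m) - to_ac (c n)) \<le> (1 / d) * N (s m - s n)"
          using d(1) by (simp add: field_simps)
      qed
      then obtain L where L: "L \<in> range to_ac" "ulim (\<lambda>n. to_ac (c n)) L"
        using ucompleteD[OF base_complete, of "\<lambda>n. to_ac (c n)"] by blast
      then obtain c0 where c0: "ulim (\<lambda>n. to_ac (c n)) (to_ac c0)" by blast
      have cb: "ulim (\<lambda>n. to_ac (c n) * b) (to_ac c0 * b)"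
        using ulim_mult_const[OF c0, of b] by (simp add: mult.commute)
      then have "ucauchy (\<lambda>n. s n - to_ac (c n) * b)"
        by (intro ucauchy_diff[OF \<open>ucauchy s\<close> ulim_imp_ucauchy])
      then have "ucauchy y" by (simp add: cy(1))
      then obtain y0 where y0: "y0 \<in> ac.span B" "ulim y y0"
        using ucompleteD[OF insert.IH, of y] cy(2) by blast
      have "ulim s (to_ac c0 * b + y0)"
        using ulim_add[OF cb y0(2)] by (simp flip: cy(1))
      moreover have "to_ac c0 * b + y0 \<in> ac.span (insert b B)"
        using subsetD[OF ac.span_mono[OF subset_insertI] y0(1)]
        by (intro ac.span_add ac.span_scale[OF ac.span_base]) auto
      ultimately show "\<exists>L\<in>ac.span (insert b B). ulim s L" by blast
    qed
  qed
qed

lemma simple_extension_complete: "ucomplete (simple_extension x)"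
  using simple_extension_finite[of x] finite_span_complete by metis

text \<open>
  One half of the equivalence of norms on a finite-dimensional space over a complete field. Only
  \<open>N\<close> needs completeness: the coefficient of a new basis vector \<open>b\<close> is controlled by \<open>N\<close> through
  the distance of \<open>b\<close> from the span of the others, and \<open>N'\<close> is controlled by the coefficients.
\<close>

lemma norm_comparison:
  assumes "ultranorm N'" and agree: "\<And>c. N' (to_ac c) = N (to_ac c)" and "finite B"
  obtains C where "C \<ge> 0" "\<And>y. y \<in> ac.span B \<Longrightarrow> N' y \<le> C * N y"
proof -
  interpret N': ultranorm N' by fact
  from \<open>finite B\<close> have "\<exists>C\<ge>0. \<forall>y\<in>ac.span B. N' y \<le> C * N y"
  proof (induction B rule: finite_induct)
    case (insert b B)
    then obtain C where C: "C \<ge> 0" "\<And>y. y \<in> ac.span B \<Longrightarrow> N' y \<le> C * N y" by blast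
    show ?case
    proof (cases "b \<in> ac.span B")
      case True
      then show ?thesis using C by (auto simp: ac.span_redundant)
    next
      case False
      obtain d where d: "d > 0" "\<And>y. y \<in> ac.span B \<Longrightarrow> d \<le> N (b + y)"
        using positive_distance[OF finite_span_complete[OF insert.hyps(1)] False] by metis
      let ?C = "N' b / d + C + C * N b / d"
      have C_le: "C \<le> ?C" using C(1) d(1) by simp
      have "N' z \<le> ?C * N z" if z: "z \<in> ac.span (insert b B)" for z
      proof -
        obtain c y where cy: "z = to_ac c * b + y" "y \<in> ac.span B" using span_insertE[OF z] .
        have "N (to_ac c) \<le> N z / d"
          using distance_scale[OF d(2) cy(2), of c] d(1) by (simp add: cy(1) field_simps)
        then have cN: "N (to_ac c) * t \<le> N z / d * t" if "t \<ge> 0" for t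
          using that by (rule mult_right_mono)
        have "N y \<le> max (N z) (N (to_ac c) * N b)"
          using N_diff[of z "to_ac c * b"] by (simp add: cy(1) N_mult)
        also have "\<dots> \<le> N z + N z / d * N b" using cN[of "N b"] d(1) by (auto simp: add_increasing add_increasing2)
        finally have "C * N y \<le> C * (N z + N z / d * N b)" using C(1) by (rule mult_left_mono)
        moreover have "N' z \<le> max (N (to_ac c) * N' b) (N' y)"
          using N'.N_add[of "to_ac c * b" y] by (simp add: cy(1) N'.N_mult agree)
        moreover have "N' y \<le> C * N y" using C(2) cy(2) .
        moreover have "N (to_ac c) * N' b \<le> N z / d * N' b" by (rule cN) simp
        ultimately have "N' z \<le> max (N z / d * N' b) (C * (N z + N z / d * N b))" by linarith
        also have "\<dots> \<le> N z / d * N' b + C * (N z + N z / d * N b)"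
          using C(1) d(1) by (simp add: add_increasing add_increasing2)
        also have "\<dots> = ?C * N z" by (simp add: field_simps)
        finally show ?thesis .
      qed
      then show ?thesis using C C_le order_trans by blast
    qed
  qed auto
  then show ?thesis using that by blast
qed

text \<open>
  Comparison on \<open>K[x]\<close> applied to all powers of \<open>x\<close>: a constant factor cannot survive taking
  \<open>n\<close>-th roots.
\<close>

lemma extension_le:
  assumes N': "ultranorm N'" and agree: "\<And>c. N' (to_ac c) = N (to_ac c)"
  shows "N' x \<le> N x"
proof (cases "x = 0")
  case True
  then show ?thesis using ultranorm.N_0[OF N'] by simp
next
  case False
  interpret N': ultranorm N' by fact
  obtain B where B: "finite B" "simple_extension x = ac.span B"
    using simple_extension_finite .
  obtain C where C: "\<And>y. y \<in> ac.span B \<Longrightarrow> N' y \<le> C * N y"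
    using norm_comparison[OF N' agree B(1)] by blast
  have pow: "N' x ^ n \<le> C * N x ^ n" for n
  proof -
    have "x ^ n \<in> ac.span B"
      unfolding B(2)[symmetric] by (intro simple_extension_power simple_extension_gen)
    then show ?thesis using C[of "x ^ n"] by (simp add: N_power N'.N_power)
  qed
  show ?thesis
  proof (rule ccontr)
    assume "\<not> ?thesis"
    then have "1 < N' x / N x" using False by (simp add: field_simps)
    then obtain n where "C < (N' x / N x) ^ n" using real_arch_pow by blast
    then show False using pow[of n] False by (simp add: field_simps power_divide)
  qed
qed

text \<open>
  The reverse inequality comes from the inverse of \<open>x\<close>.
\<close>

lemma extension_unique:
  assumes N': "ultranorm N'" and agree: "\<And>c. N' (to_ac c) = N (to_ac c)"
  shows "N' x = N x"
proof (cases "x = 0")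
  case True
  then show ?thesis using ultranorm.N_0[OF N'] by simp
next
  case False
  interpret N': ultranorm N' by fact
  have "N' (inverse x) \<le> N (inverse x)" by (rule extension_le[OF assms])
  then have "N x \<le> N' x" using False by (simp add: N_inverse N'.N_inverse)
  then show ?thesis using extension_le[OF assms, of x] by simp
qed

text \<open>
  Composing \<open>N\<close> with the automorphism gives another extension of the absolute value of \<open>K\<close>.
\<close>

lemma automorphism_isometric:
  assumes "\<sigma> \<in> ring_iso (ring_on UNIV) (ring_on UNIV)" "\<And>c. \<sigma> (to_ac c) = to_ac c"
  shows "N (\<sigma> x) = N x"
proof -
  have h: "\<sigma> (x + y) = \<sigma> x + \<sigma> y" "\<sigma> (x * y) = \<sigma> x * \<sigma> y" and inj: "inj \<sigma>" for x y
    using assms(1) by (auto simp: ring_iso_def ring_hom_def ring_of_type_algebra_def bij_betw_def)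
  have "\<sigma> x = 0 \<longleftrightarrow> x = 0" for x using inj assms(2)[of 0] by (metis injD to_ac_0)
  then have "ultranorm (\<lambda>x. N (\<sigma> x))"
    by unfold_locales (auto simp: h N_mult N_add)
  then show ?thesis by (rule extension_unique) (simp add: assms(2))
qed

end

section \<open>The absolute value of an algebraically closed field over a local field\<close>

locale local_closure =
  fixes p :: nat and v :: "'k::field \<Rightarrow> int" and w :: "'k alg_closure \<Rightarrow> real"
  assumes local: "local_field p v" and extension: "valuation_extension v w"
begin

text \<open>
  Multiplicative notation absorbs the undefined value of \<open>w\<close> at zero. The base 2 makes 2 the
  smallest value above 1 on the discretely valued field \<open>K\<close>.
\<close>

definition N :: "'k alg_closure \<Rightarrow> real" where
  "N x = (if x = 0 then 0 else 2 powr (- w x))"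

lemma prime_p: "prime p" and CHAR_base: "CHAR('k) = p"
  using local by (auto simp: local_field_def)

lemma p_ge_2: "p \<ge> 2"
  using prime_p by (rule prime_ge_2_nat)

lemma w_mult: "x \<noteq> 0 \<Longrightarrow> y \<noteq> 0 \<Longrightarrow> w (x * y) = w x + w y"
  and w_add: "x \<noteq> 0 \<Longrightarrow> y \<noteq> 0 \<Longrightarrow> x + y \<noteq> 0 \<Longrightarrow> min (w x) (w y) \<le> w (x + y)"
  and w_base: "c \<noteq> 0 \<Longrightarrow> w (to_ac c) = real_of_int (v c)"
  using extension by (auto simp: valuation_extension_def valuation_def)

sublocale ultranorm N
proof
  show "N x = 0 \<longleftrightarrow> x = 0" "0 \<le> N x" for x by (auto simp: N_def)
  show "N (x * y) = N x * N y" for x y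
    by (auto simp: N_def w_mult simp flip: powr_add)
  show "N (x + y) \<le> max (N x) (N y)" for x y
  proof (cases "x = 0 \<or> y = 0 \<or> x + y = 0")
    case True
    then show ?thesis by (auto simp: N_def le_max_iff_disj)
  next
    case False
    then show ?thesis using w_add[of x y] by (auto simp: N_def min_def max_def split: if_splits)
  qed
qed

lemma N_less_iff: "N x < 2 powr (- C) \<longleftrightarrow> x = 0 \<or> C < w x"
  by (simp add: N_def)

lemma N_base_less_iff: "N (to_ac c) < 2 powr (- real_of_int C) \<longleftrightarrow> c = 0 \<or> C < v c"
  by (simp add: N_def w_base)

lemma val_ring_iff: "x \<in> val_ring w \<longleftrightarrow> N x \<le> 1"
  using powr_le_cancel_iff[of 2 "- w x" 0] by (auto simp: val_ring_def N_def)

lemma max_ideal_iff: "x \<in> max_ideal w \<longleftrightarrow> N x < 1"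
  using N_less_iff[of x 0] by (auto simp: max_ideal_def)

lemma val_ring_base_iff: "c \<in> val_ring v \<longleftrightarrow> N (to_ac c) \<le> 1"
  using powr_le_cancel_iff[of 2 "- real_of_int (v c)" 0] by (auto simp: val_ring_def N_def w_base)

lemma max_ideal_base_iff: "c \<in> max_ideal v \<longleftrightarrow> N (to_ac c) < 1"
  using N_base_less_iff[of c 0] by (auto simp: max_ideal_def)

lemma val_lim_iff: "val_lim w s L \<longleftrightarrow> ulim s L"
proof
  assume s: "val_lim w s L"
  show "ulim s L"
    unfolding ulim_def
  proof (intro allI impI)
    fix e :: real assume "e > 0"
    then have e: "e = 2 powr (- (- log 2 e))" by simp
    obtain k where "\<forall>n\<ge>k. s n = L \<or> - log 2 e < w (s n - L)"
      using s unfolding val_lim_def by blast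
    then show "\<exists>k. \<forall>n\<ge>k. N (s n - L) < e" by (subst e) (auto simp only: N_less_iff right_minus_eq)
  qed
next
  assume s: "ulim s L"
  show "val_lim w s L"
    unfolding val_lim_def
  proof
    fix C
    obtain k where "\<forall>n\<ge>k. N (s n - L) < 2 powr (- C)"
      using s unfolding ulim_def by (metis powr_gt_zero zero_neq_numeral)
    then show "\<exists>k. \<forall>n\<ge>k. s n = L \<or> C < w (s n - L)" by (auto simp: N_less_iff)
  qed
qed

lemma base_complete: "ucomplete (range to_ac)"
  unfolding ucomplete_def
proof (intro allI impI)
  fix s assume "\<forall>n. s n \<in> range to_ac" and cauchy: "ucauchy s"
  then have "\<forall>n. \<exists>c. s n = to_ac c" by blast
  then obtain c where s: "\<And>n. s n = to_ac (c n)" by metis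
  have "\<forall>C. \<exists>k. \<forall>m\<ge>k. \<forall>n\<ge>k. c m = c n \<or> C < v (c m - c n)"
  proof
    fix C :: int
    have "(2::real) powr (- real_of_int C) > 0" by simp
    then obtain k where "\<forall>m\<ge>k. \<forall>n\<ge>k. N (s m - s n) < 2 powr (- real_of_int C)"
      using cauchy unfolding ucauchy_def by blast
    then have "\<forall>m\<ge>k. \<forall>n\<ge>k. N (to_ac (c m - c n)) < 2 powr (- real_of_int C)" by (simp add: s)
    then show "\<exists>k. \<forall>m\<ge>k. \<forall>n\<ge>k. c m = c n \<or> C < v (c m - c n)" unfolding N_base_less_iff by auto
  qed
  moreover have "val_complete v" using local by (simp add: local_field_def)
  ultimately have "\<exists>L. val_lim v c L" unfolding val_complete_def by (elim allE[of _ c]) (rule mp)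
  then obtain L where L: "val_lim v c L" ..
  have "ulim s (to_ac L)"
    unfolding ulim_def
  proof (intro allI impI)
    fix e :: real assume e: "e > 0"
    define C where "C = \<lceil>- log 2 e\<rceil>"
    have "2 powr (- real_of_int C) \<le> 2 powr (log 2 e)" by (simp add: C_def) linarith
    then have C: "2 powr (- real_of_int C) \<le> e" using e by simp
    obtain k where k: "\<forall>n\<ge>k. c n = L \<or> C < v (c n - L)" using L unfolding val_lim_def by blast
    have "N (s n - to_ac L) < e" if "n \<ge> k" for n
    proof -
      have "N (to_ac (c n - L)) < 2 powr (- real_of_int C)"
        using k that unfolding N_base_less_iff by auto
      then show ?thesis using C by (simp add: s)
    qed
    then show "\<exists>k. \<forall>n\<ge>k. N (s n - to_ac L) < e" by blast
  qed
  then show "\<exists>L\<in>range to_ac. ulim s L" by blast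
qed

sublocale complete_base N
  by unfold_locales (rule base_complete)

lemma N_mult_less: "N x < 1 \<Longrightarrow> N y \<le> 1 \<Longrightarrow> N (x * y) < 1"
  using mult_left_mono[of "N y" 1 "N x"] by (simp add: N_mult)

lemma N_add_less: "N x < e \<Longrightarrow> N y < e \<Longrightarrow> N (x + y) < e"
  using N_add[of x y] by simp

lemma base_discrete: "1 < N (to_ac c) \<Longrightarrow> 2 \<le> N (to_ac c)"
proof -
  assume "1 < N (to_ac c)"
  then have "c \<noteq> 0" "v c < 0"
    using powr_less_cancel_iff[of 2 0 "- real_of_int (v c)"] by (auto simp: N_def w_base split: if_splits)
  then have "(2::real) powr 1 \<le> 2 powr (- v c)" by (intro powr_mono) auto
  then show ?thesis using \<open>c \<noteq> 0\<close> by (simp add: N_def w_base)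
qed

lemma residue_representatives:
  obtains R where "finite R" "\<And>r. r \<in> R \<Longrightarrow> N (to_ac r) \<le> 1"
    "\<And>c. N (to_ac c) \<le> 1 \<Longrightarrow> \<exists>r\<in>R. N (to_ac (c - r)) < 1"
proof -
  have "finite ((\<lambda>x. x +o max_ideal v) ` val_ring v)" using local by (simp add: local_field_def)
  then obtain R where R: "R \<subseteq> val_ring v" "finite R"
    "(\<lambda>x. x +o max_ideal v) ` val_ring v = (\<lambda>x. x +o max_ideal v) ` R"
    using finite_subset_image[OF _ subset_refl] by metis
  have "\<exists>r\<in>R. N (to_ac (c - r)) < 1" if c: "N (to_ac c) \<le> 1" for c
  proof -
    have "c +o max_ideal v \<in> (\<lambda>x. x +o max_ideal v) ` R" unfolding R(3)[symmetric] using c by (intro imageI) (simp add: val_ring_base_iff)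
    then obtain r where r: "r \<in> R" "c +o max_ideal v = r +o max_ideal v" by blast
    have "c \<in> c +o max_ideal v" by (force simp: elt_set_plus_def max_ideal_def)
    then have "c - r \<in> max_ideal v" unfolding r(2) by (auto simp: elt_set_plus_def)
    then show ?thesis using r(1) max_ideal_base_iff by blast
  qed
  then show ?thesis using that R(1,2) val_ring_base_iff by blast
qed

section \<open>The maximal unramified extension\<close>

lemma one_less_p_power: "n > 0 \<Longrightarrow> 1 < p ^ n"
  by (rule one_less_power) (use p_ge_2 in auto)

lemma frobenius_add: "(x + y :: 'k alg_closure) ^ (p ^ n) = x ^ (p ^ n) + y ^ (p ^ n)"
  by (rule freshmans_dream') (auto simp: CHAR_base prime_p)

lemma frobenius_diff: "(x - y :: 'k alg_closure) ^ (p ^ n) = x ^ (p ^ n) - y ^ (p ^ n)"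
  using frobenius_add[of "x - y" y n] by simp

lemma frobenius_sum: "(sum f I :: 'k alg_closure) ^ (p ^ n) = (\<Sum>i\<in>I. f i ^ (p ^ n))"
  by (rule freshmans_dream_sum') (auto simp: CHAR_base prime_p)

text \<open>
  Scale an algebraic equation of \<open>x\<close> so that its largest coefficient is a unit, and solve for
  the highest power of \<open>x\<close> whose coefficient is a unit; modulo the maximal ideal the terms above
  it disappear.
\<close>

lemma integral_power_relation:
  assumes x: "N x \<le> 1"
  obtains j a where "\<And>i. N (to_ac (a i)) \<le> 1" "N (x ^ j - (\<Sum>i<j. to_ac (a i) * x ^ i)) < 1"
proof -
  obtain f :: "'k poly" where f: "f \<noteq> 0" "poly (map_poly to_ac f) x = 0"
    using alg_closure_algebraic by blast
  let ?c = "\<lambda>i. N (to_ac (Polynomial.coeff f i))"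
  let ?m = "Max (?c ` {..degree f})"
  have "?m \<in> ?c ` {..degree f}" by (intro Max_in) auto
  then obtain k where k: "k \<le> degree f" "?m = ?c k" by blast
  have max: "?c i \<le> ?c k" for i
  proof (cases "i \<le> degree f")
    case True
    then show ?thesis unfolding k(2)[symmetric] by (intro Max_ge) auto
  qed (simp add: coeff_eq_0)
  have "?c (degree f) > 0" using f(1) by simp
  then have ck: "?c k > 0" using max[of "degree f"] by linarith
  define u where "u i = Polynomial.coeff f i / Polynomial.coeff f k" for i
  have u_le: "N (to_ac (u i)) \<le> 1" for i using max[of i] ck by (simp add: u_def N_divide)
  have u_k: "u k = 1" using ck by (simp add: u_def)
  have "(\<Sum>i\<le>degree f. to_ac (u i) * x ^ i) = inverse (to_ac (Polynomial.coeff f k)) * poly (map_poly to_ac f) x"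
    by (simp add: poly_altdef coeff_map_poly degree_map_poly u_def sum_distrib_left field_simps)
  then have sum0: "(\<Sum>i\<le>degree f. to_ac (u i) * x ^ i) = 0" using f(2) by simp
  define J where "J = {i. i \<le> degree f \<and> N (to_ac (u i)) = 1}"
  define j where "j = Max J"
  have J: "finite J" "k \<in> J" using k(1) u_k by (auto simp: J_def)
  then have j: "j \<in> J" unfolding j_def by (intro Max_in) auto
  have above: "N (to_ac (u i)) < 1" if "j < i" "i \<le> degree f" for i
  proof (rule ccontr)
    assume "\<not> ?thesis"
    then have "i \<in> J" using u_le[of i] that(2) by (simp add: J_def)
    then show False using Max_ge[OF J(1), of i] that(1) by (simp add: j_def)
  qed
  have uj: "N (to_ac (u j)) = 1" "j \<le> degree f" using j by (auto simp: J_def)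
  let ?A = "\<Sum>i<j. to_ac (u i) * x ^ i" and ?B = "to_ac (u j) * x ^ j"
    and ?C = "\<Sum>i\<in>{j<..degree f}. to_ac (u i) * x ^ i"
  have "{..degree f} = {..j} \<union> {j<..degree f}" using uj(2) by auto
  then have "(\<Sum>i\<le>degree f. to_ac (u i) * x ^ i) = (\<Sum>i\<le>j. to_ac (u i) * x ^ i) + ?C"
    by (simp only:) (rule sum.union_disjoint, auto)
  also have "(\<Sum>i\<le>j. to_ac (u i) * x ^ i) = ?A + ?B"
    by (simp flip: lessThan_Suc_atMost)
  finally have "?A + ?B + ?C = 0" by (simp only: sum0)
  then have sum3: "?B + ?A = - ?C" by (simp only: eq_neg_iff_add_eq_0 add.commute[of ?B ?A])
  have "to_ac (u j) \<noteq> 0" using uj(1) N_0 by force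
  then have "to_ac (u j) * (\<Sum>i<j. to_ac (- u i / u j) * x ^ i) = - ?A"
    by (simp add: sum_distrib_left sum_negf)
  then have "to_ac (u j) * (x ^ j - (\<Sum>i<j. to_ac (- u i / u j) * x ^ i)) = - ?C"
    by (simp only: right_diff_distrib sum3[symmetric] diff_minus_eq_add)
  then have "N (to_ac (u j)) * N (x ^ j - (\<Sum>i<j. to_ac (- u i / u j) * x ^ i)) =
      N (\<Sum>i\<in>{j<..degree f}. to_ac (u i) * x ^ i)"
    by (metis N_minus N_mult)
  also have "\<dots> < 1"
  proof (rule N_sum_less)
    fix i assume "i \<in> {j<..degree f}"
    then have "N (to_ac (u i)) < 1" using above by simp
    moreover have "N x ^ i \<le> 1" using x by (simp add: power_le_one)
    ultimately show "N (to_ac (u i) * x ^ i) < 1"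
      by (intro N_mult_less) (simp_all add: N_power)
  qed simp
  finally have "N (x ^ j - (\<Sum>i<j. to_ac (- u i / u j) * x ^ i)) < 1" using uj(1) by simp
  moreover have "N (to_ac (- u i / u j)) \<le> 1" for i using u_le[of i] uj(1) by (simp add: N_divide)
  ultimately show ?thesis using that[of "\<lambda>i. - u i / u j" j] by blast
qed

text \<open>
  Modulo the maximal ideal all powers of \<open>x\<close> are combinations of finitely many of them with
  coefficients from finitely many classes. So two of the powers \<open>x ^ (p ^ n)\<close> agree, and a power of
  Frobenius, which is injective on the residue field, can be cancelled.
\<close>

lemma residue_field_algebraic:
  assumes x: "N x \<le> 1"
  obtains n where "n > 0" "N (x ^ (p ^ n) - x) < 1"
proof -
  obtain j a where a: "\<And>i. N (to_ac (a i)) \<le> 1" "N (x ^ j - (\<Sum>i<j. to_ac (a i) * x ^ i)) < 1"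
    using integral_power_relation[OF x] by metis
  have j: "j > 0" using a(2) by (cases j) auto
  obtain R where R: "finite R" "\<And>c. N (to_ac c) \<le> 1 \<Longrightarrow> \<exists>r\<in>R. N (to_ac (c - r)) < 1"
    using residue_representatives by metis
  have xpow: "N (x ^ i) \<le> 1" for i using x by (simp add: N_power power_le_one)
  have combination: "\<exists>c. (\<forall>i. N (to_ac (c i)) \<le> 1) \<and> N (x ^ n - (\<Sum>i<j. to_ac (c i) * x ^ i)) < 1" for n
  proof (induction n)
    case 0
    have "(\<Sum>i<j. to_ac (if i = 0 then 1 else 0) * x ^ i) = (1::'k alg_closure)"
      using j by (subst sum.remove[of _ 0]) auto
    then show ?case by (intro exI[of _ "\<lambda>i. if i = 0 then 1 else 0"]) auto
  next
    case (Suc n)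
    then obtain c where c: "\<And>i. N (to_ac (c i)) \<le> 1" "N (x ^ n - (\<Sum>i<j. to_ac (c i) * x ^ i)) < 1"
      by blast
    define d where "d i = c (j - 1) * a i + (if i = 0 then 0 else c (i - 1))" for i
    have d_le: "N (to_ac (d i)) \<le> 1" for i
    proof -
      have "N (to_ac (c (j - 1)) * to_ac (a i)) \<le> 1"
        unfolding N_mult using a(1) c(1) by (simp add: mult_le_one)
      then show ?thesis
        using N_add[of "to_ac (c (j - 1)) * to_ac (a i)" "to_ac (if i = 0 then 0 else c (i - 1))"] c(1)[of "i - 1"]
        by (auto simp: d_def split: if_splits)
    qed
    have "x ^ Suc n - (\<Sum>i<j. to_ac (d i) * x ^ i) =
        x * (x ^ n - (\<Sum>i<j. to_ac (c i) * x ^ i)) +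
        to_ac (c (j - 1)) * (x ^ j - (\<Sum>i<j. to_ac (a i) * x ^ i))"
    proof -
      obtain j' where j': "j = Suc j'" using j by (cases j) auto
      have "(\<Sum>i<j. to_ac (if i = 0 then 0 else c (i - 1)) * x ^ i) = (\<Sum>i<j'. to_ac (c i) * x ^ Suc i)"
        unfolding j' sum.lessThan_Suc_shift by simp
      moreover have "x * (\<Sum>i<j. to_ac (c i) * x ^ i) = (\<Sum>i<j'. to_ac (c i) * x ^ Suc i) + to_ac (c j') * x ^ j"
        unfolding j' by (simp add: sum_distrib_left algebra_simps)
      moreover have "(\<Sum>i<j. to_ac (d i) * x ^ i) = to_ac (c j') * (\<Sum>i<j. to_ac (a i) * x ^ i) +
          (\<Sum>i<j. to_ac (if i = 0 then 0 else c (i - 1)) * x ^ i)"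
        by (simp only: d_def j' diff_Suc_1 to_ac_add to_ac_mult distrib_right sum.distrib sum_distrib_left mult.assoc)
      ultimately show ?thesis
        by (simp only: j' diff_Suc_1 power_Suc[of x n] right_diff_distrib) simp
    qed
    moreover have "N (x * (x ^ n - (\<Sum>i<j. to_ac (c i) * x ^ i))) < 1"
      using N_mult_less[OF c(2) x] by (simp add: mult.commute)
    moreover have "N (to_ac (c (j - 1)) * (x ^ j - (\<Sum>i<j. to_ac (a i) * x ^ i))) < 1"
      using N_mult_less[OF a(2) c(1)[of "j - 1"]] by (simp add: mult.commute)
    ultimately have "N (x ^ Suc n - (\<Sum>i<j. to_ac (d i) * x ^ i)) < 1"
      using N_add_less by simp
    then show ?case using d_le by blast
  qed
  define F where "F = (\<lambda>g. \<Sum>i<j. to_ac (g i) * x ^ i) ` (PiE {..<j} (\<lambda>_. R))"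
  have "finite F" unfolding F_def using R(1) by (intro finite_imageI finite_PiE) auto
  have "\<exists>z\<in>F. N (x ^ n - z) < 1" for n
  proof -
    obtain c where c: "\<And>i. N (to_ac (c i)) \<le> 1" "N (x ^ n - (\<Sum>i<j. to_ac (c i) * x ^ i)) < 1"
      using combination by blast
    obtain r where r: "\<And>i. r i \<in> R" "\<And>i. N (to_ac (c i - r i)) < 1" using R(2)[OF c(1)] by metis
    let ?z = "\<Sum>i<j. to_ac (r i) * x ^ i"
    have "?z = (\<Sum>i<j. to_ac (restrict r {..<j} i) * x ^ i)" by (intro sum.cong) auto
    then have "?z \<in> F" unfolding F_def using r(1) by (intro image_eqI[of _ _ "restrict r {..<j}"]) auto
    have "N (\<Sum>i<j. to_ac (c i - r i) * x ^ i) < 1"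
    proof (rule N_sum_less)
      show "N (to_ac (c i - r i) * x ^ i) < 1" for i
        by (rule N_mult_less[OF r(2) xpow])
    qed simp
    then have "N ((\<Sum>i<j. to_ac (c i) * x ^ i) - ?z) < 1"
      by (simp add: algebra_simps sum_subtractf)
    then have "N (x ^ n - ?z) < 1"
      using N_add_less[OF c(2), of "(\<Sum>i<j. to_ac (c i) * x ^ i) - ?z"] by simp
    then show ?thesis using \<open>?z \<in> F\<close> by blast
  qed
  then obtain h where h: "\<And>n. h n \<in> F" "\<And>n. N (x ^ n - h n) < 1" by metis
  have "\<not> inj (\<lambda>n. h (p ^ n))"
  proof
    assume "inj (\<lambda>n. h (p ^ n))"
    then have "infinite (range (\<lambda>n. h (p ^ n)))" by (rule range_inj_infinite)
    moreover have "range (\<lambda>n. h (p ^ n)) \<subseteq> F" using h(1) by (intro image_subsetI)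
    ultimately show False using finite_subset \<open>finite F\<close> by metis
  qed
  then obtain b0 c0 where bc0: "h (p ^ b0) = h (p ^ c0)" "b0 \<noteq> c0" unfolding inj_def by blast
  define b c where "b = min b0 c0" and "c = max b0 c0"
  have bc: "b < c" "h (p ^ b) = h (p ^ c)" using bc0 by (auto simp: b_def c_def min_def max_def)
  have "N (x ^ (p ^ c) - x ^ (p ^ b)) < 1"
    using N_diff_triangle[of "x ^ (p ^ c)" "x ^ (p ^ b)" "h (p ^ b)"] h(2)[of "p ^ b"] h(2)[of "p ^ c"] bc(2)
      N_diff_commute[of "h (p ^ b)"] by auto
  moreover have "x ^ (p ^ c) - x ^ (p ^ b) = (x ^ (p ^ (c - b)) - x) ^ (p ^ b)"
    using bc(1) by (simp add: frobenius_diff flip: power_mult power_add)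
  ultimately have "N (x ^ (p ^ (c - b)) - x) ^ (p ^ b) < 1" by (simp add: N_power)
  then have "N (x ^ (p ^ (c - b)) - x) < 1"
    by (meson not_le one_le_power)
  then show ?thesis using that[of "c - b"] bc(1) by simp
qed

text \<open>
  The algebraic closure of the prime field inside \<open>K\<^sup>a\<^sup>l\<^sup>g\<close>. In equal characteristic these are the
  Teichmueller representatives, and they form a field isomorphic to the residue field.
\<close>

definition teichmueller :: "'k alg_closure set" where
  "teichmueller = {t. \<exists>n>0. t ^ (p ^ n) = t}"

lemma iterate_frobenius: "(t :: 'k alg_closure) ^ (p ^ n) = t \<Longrightarrow> t ^ (p ^ (n * k)) = t"
  by (induction k) (simp_all add: power_add power_mult)

lemma teichmueller_common:
  assumes "s \<in> teichmueller" "t \<in> teichmueller"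
  obtains n where "n > 0" "s ^ (p ^ n) = s" "t ^ (p ^ n) = t"
proof -
  obtain m n where mn: "m > 0" "s ^ (p ^ m) = s" "n > 0" "t ^ (p ^ n) = t"
    using assms by (auto simp: teichmueller_def)
  then show ?thesis
    using that[of "m * n"] iterate_frobenius[OF mn(2), of n] iterate_frobenius[OF mn(4), of m]
    by (simp add: mult.commute)
qed

lemma
  assumes st: "s \<in> teichmueller" "t \<in> teichmueller"
  shows teichmueller_add: "s + t \<in> teichmueller" and teichmueller_mult: "s * t \<in> teichmueller"
proof -
  from st obtain n where n: "n > 0" "s ^ (p ^ n) = s" "t ^ (p ^ n) = t" using teichmueller_common by metis
  then have "(s + t) ^ (p ^ n) = s + t" "(s * t) ^ (p ^ n) = s * t"
    by (simp_all add: frobenius_add power_mult_distrib)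
  then show "s + t \<in> teichmueller" "s * t \<in> teichmueller" using n(1) unfolding teichmueller_def by blast+
qed

lemma teichmueller_0: "0 \<in> teichmueller" and teichmueller_1: "1 \<in> teichmueller"
  using p_ge_2 by (auto simp: teichmueller_def intro!: exI[of _ 1])

lemma teichmueller_sum: "(\<And>i. i \<in> I \<Longrightarrow> f i \<in> teichmueller) \<Longrightarrow> sum f I \<in> teichmueller"
  by (induction I rule: infinite_finite_induct) (auto intro: teichmueller_0 teichmueller_add)

lemma N_teichmueller: "t \<in> teichmueller \<Longrightarrow> t \<noteq> 0 \<Longrightarrow> N t = 1"
proof -
  assume "t \<in> teichmueller" "t \<noteq> 0"
  then obtain n where n: "n > 0" "t ^ (p ^ n) = t" by (auto simp: teichmueller_def)
  obtain m where m: "p ^ n = Suc m" "m > 0" using one_less_p_power[OF n(1)] by (metis One_nat_def Suc_lessE)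
  have "N t * N t ^ m = N t * 1" using arg_cong[OF n(2), of N] unfolding m(1) N_power by simp
  then have "N t ^ m = 1 ^ m" using \<open>t \<noteq> 0\<close> by simp
  then show ?thesis using m(2) by (subst (asm) power_eq_iff_eq_base) auto
qed

text \<open>
  The product of \<open>x - t\<close> over all \<open>t\<close> with \<open>t ^ q = t\<close> is \<open>x ^ q - x\<close>. For a suitable \<open>q\<close> it is
  small, so one factor is small.
\<close>

lemma teichmueller_approximation:
  assumes x: "N x \<le> 1"
  obtains t where "t \<in> teichmueller" "N (x - t) < 1"
proof -
  obtain n where n: "n > 0" "N (x ^ (p ^ n) - x) < 1" using residue_field_algebraic[OF x] by metis
  have q: "p ^ n > 1" using n(1) by (rule one_less_p_power)
  let ?f = "Polynomial.monom 1 (p ^ n) - Polynomial.monom 1 1 :: 'k alg_closure poly"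
  have top: "Polynomial.coeff ?f (p ^ n) = 1" using q by simp
  have "degree ?f \<le> p ^ n" using q by (intro degree_diff_le order_trans[OF degree_monom_le]) auto
  then have "degree ?f = p ^ n" using le_degree[of ?f "p ^ n"] top by simp
  then have "lead_coeff ?f = 1" using top by simp
  then obtain R where R: "?f = (\<Prod>r\<in>#R. [:- r, 1:])"
    using alg_closed_imp_factorization[of ?f] by (metis leading_coeff_0_iff smult_1_left zero_neq_one)
  have root: "r ^ (p ^ n) = r" if "r \<in># R" for r
  proof -
    have "poly ?f r = 0" unfolding R using that by (auto simp: poly_prod_mset)
    then show ?thesis by (simp add: poly_monom)
  qed
  have prod: "1 \<le> N (poly (\<Prod>r\<in>#Q. [:- r, 1:]) x)" if "\<And>r. r \<in># Q \<Longrightarrow> 1 \<le> N (x - r)" for Q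
    using that
  proof (induction Q)
    case (add r Q)
    have "1 * 1 \<le> N (x - r) * N (poly (\<Prod>r\<in>#Q. [:- r, 1:]) x)"
      using add by (intro mult_mono) auto
    also have "\<dots> = N (poly (\<Prod>r\<in>#add_mset r Q. [:- r, 1:]) x)" 
      by (simp flip: N_mult) (simp add: algebra_simps)
    finally show ?case by simp
  qed simp
  have "N (poly ?f x) < 1" using n(2) by (simp add: poly_monom)
  then obtain r where "r \<in># R" "N (x - r) < 1" unfolding R using prod[of R] by force
  then show ?thesis using that[of r] root n(1) by (auto simp: teichmueller_def)
qed

text \<open>
  The representative of an element of \<open>K\<close> is the limit of its iterated Frobenius powers, hence
  lies in \<open>K\<close> by completeness.
\<close>

lemma teichmueller_approximation_base:
  assumes c: "N (to_ac c) \<le> 1"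
  obtains d where "to_ac d \<in> teichmueller" "N (to_ac (c - d)) < 1"
proof -
  obtain t where t: "t \<in> teichmueller" "N (to_ac c - t) < 1" using teichmueller_approximation[OF c] by metis
  obtain n where n: "n > 0" "t ^ (p ^ n) = t" using t(1) by (auto simp: teichmueller_def)
  let ?s = "\<lambda>k. to_ac c ^ (p ^ (n * k))"
  have "ulim ?s t"
    unfolding ulim_def
  proof (intro allI impI)
    fix e :: real assume "e > 0"
    then obtain k where k: "N (to_ac c - t) ^ k < e" using real_arch_pow_inv t(2) by blast
    have "N (?s m - t) < e" if "m \<ge> k" for m
    proof -
      have "?s m - t = (to_ac c - t) ^ (p ^ (n * m))"
        by (simp only: frobenius_diff iterate_frobenius[OF n(2)])
      then have "N (?s m - t) = N (to_ac c - t) ^ (p ^ (n * m))" by (simp only: N_power)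
      also have "\<dots> \<le> N (to_ac c - t) ^ k"
      proof (rule power_decreasing)
        have "n * m < p ^ (n * m)" using p_ge_2 by (intro less_exp[THEN less_le_trans] power_mono) auto
        moreover have "k \<le> n * m" using that n(1) by (metis le_trans mult_le_mono1 mult_1 Suc_leI One_nat_def)
        ultimately show "k \<le> p ^ (n * m)" by linarith
      qed (use t(2) in auto)
      finally show ?thesis using k by simp
    qed
    then show "\<exists>k. \<forall>m\<ge>k. N (?s m - t) < e" by blast
  qed
  moreover have "?s k \<in> range to_ac" for k by (metis rangeI to_ac_power)
  ultimately have "t \<in> range to_ac"
    using ucompleteD[OF base_complete, of ?s] ulim_imp_ucauchy ulim_unique by blast
  then show ?thesis using that t by (metis imageE to_ac_diff)
qed

text \<open>
  The maximal unramified extension of \<open>K\<close>: every residue has a representative in it, and by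
  \<open>unramified_values\<close> it has the value group of \<open>K\<close>.
\<close>

definition unramified :: "'k alg_closure set" where
  "unramified = ac.span teichmueller"

lemma base_unramified: "to_ac c \<in> unramified"
  using ac.span_scale[OF ac.span_base[OF teichmueller_1], of c] by (simp add: unramified_def)

lemma teichmueller_unramified: "t \<in> teichmueller \<Longrightarrow> t \<in> unramified"
  by (simp add: unramified_def ac.span_base)

lemma unramified_add: "x \<in> unramified \<Longrightarrow> y \<in> unramified \<Longrightarrow> x + y \<in> unramified"
  and unramified_diff: "x \<in> unramified \<Longrightarrow> y \<in> unramified \<Longrightarrow> x - y \<in> unramified"
  by (simp_all add: unramified_def ac.span_add ac.span_diff)

lemma unramified_mult:
  assumes "x \<in> unramified" "y \<in> unramified" shows "x * y \<in> unramified"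
proof -
  have *: "t * y \<in> ac.span teichmueller" if "t \<in> teichmueller" "y \<in> ac.span teichmueller" for t y
    using that(2)
  proof (induction rule: ac.span_induct_alt)
    case (step c s y)
    have "t * (to_ac c * s + y) = to_ac c * (t * s) + t * y" by (simp add: algebra_simps)
    then show ?case
      using ac.span_add[OF ac.span_scale[OF ac.span_base[OF teichmueller_mult[OF that(1) step(1)]]] step(2)] by simp
  qed (simp add: ac.span_zero)
  from assms(1) have "x * y \<in> ac.span teichmueller"
    unfolding unramified_def
  proof (induction rule: ac.span_induct_alt)
    case (step c t x)
    have "(to_ac c * t + x) * y = to_ac c * (t * y) + x * y" by (simp add: algebra_simps)
    then show ?case using step * assms(2) by (auto simp: unramified_def intro!: ac.span_add ac.span_scale)
  qed (simp add: ac.span_zero)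
  then show ?thesis by (simp add: unramified_def)
qed

text \<open>
  After division by a coefficient of largest absolute value, replace every coefficient by its
  representative. The result is a representative \<open>z\<close> close to the original element. If \<open>z\<close> is not
  zero it has absolute value 1. If \<open>z = 0\<close>, this is a linear relation over \<open>K\<close> that
  eliminates one of the generators.
\<close>

lemma span_teichmueller_values:
  assumes "finite S" "S \<subseteq> teichmueller" "y \<in> ac.span S"
  shows "\<exists>c. N y = N (to_ac c)"
  using assms
proof (induction S rule: finite_psubset_induct)
  case (psubset S)
  obtain r where y: "y = (\<Sum>t\<in>S. to_ac (r t) * t)"
    using psubset.prems(2) ac.span_finite[OF psubset.hyps(1)] by auto
  show ?case
  proof (cases "\<forall>t\<in>S. r t = 0")
    case True
    then show ?thesis by (intro exI[of _ 0]) (simp add: y)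
  next
    case False
    let ?m = "Max ((\<lambda>t. N (to_ac (r t))) ` S)"
    have "?m \<in> (\<lambda>t. N (to_ac (r t))) ` S" using False psubset.hyps(1) by (intro Max_in) auto
    then obtain t1 where t1: "t1 \<in> S" "?m = N (to_ac (r t1))" by blast
    have max: "N (to_ac (r t)) \<le> N (to_ac (r t1))" if "t \<in> S" for t
      unfolding t1(2)[symmetric] using that psubset.hyps(1) by (intro Max_ge) auto
    then have r1: "r t1 \<noteq> 0" using False by (metis N_0 N_pos_iff not_le to_ac_0 to_ac_eq_0_iff)
    define u where "u t = r t / r t1" for t
    have u: "N (to_ac (u t)) \<le> 1" if "t \<in> S" for t using max[OF that] r1 by (simp add: u_def N_divide)
    have "\<forall>t\<in>S. \<exists>d. to_ac d \<in> teichmueller \<and> N (to_ac (u t - d)) < 1"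
      using teichmueller_approximation_base[OF u] by metis
    then obtain d0 where d0: "\<And>t. t \<in> S \<Longrightarrow> to_ac (d0 t) \<in> teichmueller \<and> N (to_ac (u t - d0 t)) < 1" by metis
    \<comment> \<open>the largest coefficient becomes exactly 1, so that a vanishing \<open>z\<close> can be solved for \<open>t1\<close>\<close>
    define d where "d t = (if t = t1 then 1 else d0 t)" for t
    have d: "to_ac (d t) \<in> teichmueller" "N (to_ac (u t - d t)) < 1" if "t \<in> S" for t
      using d0[OF that] r1 by (auto simp: d_def u_def teichmueller_1)
    let ?z = "\<Sum>t\<in>S. to_ac (d t) * t"
    have z: "?z \<in> teichmueller" using d(1) psubset.prems(1) by (intro teichmueller_sum teichmueller_mult) auto
    have quot: "y = to_ac (r t1) * (\<Sum>t\<in>S. to_ac (u t) * t)"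
      using r1 by (simp add: y u_def sum_distrib_left)
    have "N ((\<Sum>t\<in>S. to_ac (u t) * t) - ?z) = N (\<Sum>t\<in>S. to_ac (u t - d t) * t)"
      by (simp add: algebra_simps sum_subtractf)
    also have "\<dots> < 1"
    proof (rule N_sum_less)
      fix t assume t: "t \<in> S"
      then have "N t \<le> 1" using N_teichmueller[of t] psubset.prems(1) by (cases "t = 0") auto
      then show "N (to_ac (u t - d t) * t) < 1"
        by (rule N_mult_less[OF d(2)[OF t]])
    qed simp
    finally have close: "N ((\<Sum>t\<in>S. to_ac (u t) * t) - ?z) < 1" .
    show ?thesis
    proof (cases "?z = 0")
      case False
      then have "N ?z = 1" using N_teichmueller z by blast
      then have "N (\<Sum>t\<in>S. to_ac (u t) * t) = 1" using N_add_dominant[of "(\<Sum>t\<in>S. to_ac (u t) * t) - ?z" ?z] close by simp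
      then have "N y = N (to_ac (r t1))" by (simp add: quot N_mult)
      then show ?thesis by blast
    next
      case True
      have "?z = t1 + (\<Sum>t\<in>S - {t1}. to_ac (d t) * t)"
        using t1(1) psubset.hyps(1) by (simp add: sum.remove d_def)
      then have "t1 = - (\<Sum>t\<in>S - {t1}. to_ac (d t) * t)" using True by (simp add: eq_neg_iff_add_eq_0)
      moreover have "- (\<Sum>t\<in>S - {t1}. to_ac (d t) * t) \<in> ac.span (S - {t1})"
        by (intro ac.span_neg ac.span_sum ac.span_scale ac.span_base)
      ultimately have "t1 \<in> ac.span (S - {t1})" by simp
      then have "y \<in> ac.span (S - {t1})"
        using psubset.prems(2) t1(1) by (metis ac.span_redundant insert_Diff)
      then show ?thesis using psubset.IH[of "S - {t1}"] psubset.prems(1) t1(1) by blast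
    qed
  qed
qed

lemma unramified_values: "y \<in> unramified \<Longrightarrow> \<exists>c. N y = N (to_ac c)"
proof -
  assume "y \<in> unramified"
  then obtain S r where S: "finite S" "S \<subseteq> teichmueller" "y = (\<Sum>t\<in>S. to_ac (r t) * t)"
    unfolding unramified_def ac.span_explicit by blast
  have "y \<in> ac.span S" unfolding S(3) by (intro ac.span_sum ac.span_scale ac.span_base)
  then show ?thesis using span_teichmueller_values S by blast
qed

lemma unramified_discrete: "y \<in> unramified \<Longrightarrow> 1 < N y \<Longrightarrow> 2 \<le> N y"
  using unramified_values base_discrete by metis

section \<open>Elements fixed by inertia\<close>

lemma inertiaD:
  assumes "\<sigma> \<in> inertia_group w"
  shows "\<sigma> (x + y) = \<sigma> x + \<sigma> y" "\<sigma> (x * y) = \<sigma> x * \<sigma> y" "\<sigma> (to_ac c) = to_ac c"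
    "N (\<sigma> x) = N x" "N x \<le> 1 \<Longrightarrow> N (\<sigma> x - x) < 1"
proof -
  have iso: "\<sigma> \<in> ring_iso (ring_on UNIV) (ring_on UNIV)" "\<And>c. \<sigma> (to_ac c) = to_ac c"
    using assms by (auto simp: inertia_group_def)
  then show "N (\<sigma> x) = N x" "\<sigma> (to_ac c) = to_ac c" using automorphism_isometric by blast+
  show "\<sigma> (x + y) = \<sigma> x + \<sigma> y" "\<sigma> (x * y) = \<sigma> x * \<sigma> y"
    using iso(1) by (auto simp: ring_iso_def ring_hom_def ring_of_type_algebra_def)
  show "N (\<sigma> x - x) < 1" if "N x \<le> 1"
    using assms that unfolding inertia_group_def val_ring_iff[symmetric] max_ideal_iff[symmetric] by blast
qed

lemma inertia_power: "\<sigma> \<in> inertia_group w \<Longrightarrow> \<sigma> (x ^ n) = \<sigma> x ^ n"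
  using inertiaD(3)[of \<sigma> 1] by (induction n) (auto simp: inertiaD(2))

lemma inertia_diff: "\<sigma> \<in> inertia_group w \<Longrightarrow> \<sigma> (x - y) = \<sigma> x - \<sigma> y"
  using inertiaD(1)[of \<sigma> "x - y" y] by simp

lemma inertia_sum: "\<sigma> \<in> inertia_group w \<Longrightarrow> \<sigma> (sum f I) = (\<Sum>i\<in>I. \<sigma> (f i))"
  using inertiaD(3)[of \<sigma> 0] by (induction I rule: infinite_finite_induct) (auto simp: inertiaD(1))

text \<open>
  Every integral element is congruent to a Teichmueller representative, which the automorphism
  fixes, and the error stays small because automorphisms are isometries.
\<close>

lemma automorphism_over_unramified_inertia:
  assumes iso: "\<sigma> \<in> ring_iso (ring_on UNIV) (ring_on UNIV)" and fixes_unramified: "\<And>y. y \<in> unramified \<Longrightarrow> \<sigma> y = y"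
  shows "\<sigma> \<in> inertia_group w"
proof -
  have base: "\<sigma> (to_ac c) = to_ac c" for c by (intro fixes_unramified base_unramified)
  have add: "\<sigma> (x + y) = \<sigma> x + \<sigma> y" for x y
    using iso by (auto simp: ring_iso_def ring_hom_def ring_of_type_algebra_def)
  have "N (\<sigma> x - x) < 1" if x: "N x \<le> 1" for x
  proof -
    obtain t where t: "t \<in> teichmueller" "N (x - t) < 1" using teichmueller_approximation[OF x] by metis
    have "\<sigma> x = \<sigma> (x - t) + t" using add[of "x - t" t] fixes_unramified[OF teichmueller_unramified[OF t(1)]] by simp
    then have "N (\<sigma> x - x) = N (\<sigma> (x - t) - (x - t))" by (metis diff_diff_eq2)
    also have "\<dots> \<le> max (N (\<sigma> (x - t))) (N (x - t))" by (rule N_diff)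
    also have "\<dots> < 1" using automorphism_isometric[OF iso base] t(2) by simp
    finally show ?thesis .
  qed
  then show ?thesis using iso base by (auto simp: inertia_group_def val_ring_iff max_ideal_iff)
qed

lemma inertia_fixed_unramified:
  assumes fixed: "\<And>\<sigma>. \<sigma> \<in> inertia_group w \<Longrightarrow> \<sigma> x = x"
    and f: "\<And>i. Polynomial.coeff f i \<in> range to_ac" "poly f x = 0" "poly (pderiv f) x \<noteq> 0"
  shows "x \<in> unramified"
proof (rule ccontr)
  assume x: "x \<notin> unramified"
  show False
  proof (rule separable_conjugate[of unramified x f])
    show "range to_ac \<subseteq> unramified" using base_unramified by blast
    show "Polynomial.coeff f i \<in> unramified" for i
      using subsetD[OF \<open>range to_ac \<subseteq> unramified\<close> f(1)] .
    fix \<sigma> :: "'k alg_closure \<Rightarrow> 'k alg_closure"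
    assume "\<sigma> \<in> ring_iso (ring_on UNIV) (ring_on UNIV)" "\<And>y. y \<in> unramified \<Longrightarrow> \<sigma> y = y" "\<sigma> x \<noteq> x"
    then show False using automorphism_over_unramified_inertia fixed by blast
  qed (use f(2,3) x in \<open>auto intro: unramified_add unramified_mult\<close>)
qed

end

section \<open>Evaluation of twisted polynomials\<close>

context local_closure
begin

lemma tau_eval_altdef: "degree f \<le> n \<Longrightarrow> tau_eval p f x = (\<Sum>i\<le>n. to_ac (Polynomial.coeff f i) * x ^ (p ^ i))"
  unfolding tau_eval_def by (rule sum.mono_neutral_left) (auto simp: coeff_eq_0)

lemma tau_eval_add: "tau_eval p (f :: 'k poly) (x + y) = tau_eval p f x + tau_eval p f y"
  by (simp add: tau_eval_def frobenius_add distrib_left sum.distrib)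

lemma tau_eval_0 [simp]: "tau_eval p (f :: 'k poly) 0 = 0"
  using tau_eval_add[of f 0 0] by (metis add_0 add_cancel_right_right)

lemma tau_eval_diff: "tau_eval p (f :: 'k poly) (x - y) = tau_eval p f x - tau_eval p f y"
  using tau_eval_add[of f "x - y" y] by simp

lemma tau_eval_add_left: "tau_eval p (f + g) x = tau_eval p f x + tau_eval p g x"
proof -
  let ?n = "max (degree f) (degree g)"
  have "degree (f + g) \<le> ?n" by (rule degree_add_le) auto
  then show ?thesis
    by (simp add: tau_eval_altdef[of _ ?n] distrib_right sum.distrib)
qed

lemma tau_eval_0_left [simp]: "tau_eval p 0 x = 0"
  by (simp add: tau_eval_def)

lemma tau_eval_sum_left: "tau_eval p (sum g I) x = (\<Sum>i\<in>I. tau_eval p (g i) x)"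
  by (induction I rule: infinite_finite_induct) (auto simp: tau_eval_add_left)

lemma tau_eval_monom: "tau_eval p (Polynomial.monom c n) x = to_ac c * x ^ (p ^ n)"
proof -
  have "(\<Sum>i\<le>n. to_ac (Polynomial.coeff (Polynomial.monom c n) i) * x ^ (p ^ i)) =
        (\<Sum>i\<le>n. if i = n then to_ac c * x ^ (p ^ n) else 0)"
    by (intro sum.cong) auto
  also have "\<dots> = to_ac c * x ^ (p ^ n)" by simp
  finally show ?thesis by (simp add: tau_eval_altdef[OF degree_monom_le])
qed

lemma tau_eval_1 [simp]: "tau_eval p 1 x = x"
  using tau_eval_monom[of 1 0 x] by simp

text \<open>
  The twisted product is made for this: \<open>\<tau>\<close> acts as the Frobenius, which is additive.
\<close>

lemma tau_eval_mult: "tau_eval p (tau_mult p f (g :: 'k poly)) x = tau_eval p f (tau_eval p g x)"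
proof -
  have "tau_eval p (tau_mult p f g) x = (\<Sum>i\<le>degree f. \<Sum>j\<le>degree g.
      to_ac (Polynomial.coeff f i) * (to_ac (Polynomial.coeff g j) * x ^ (p ^ j)) ^ (p ^ i))"
    by (simp add: tau_mult_def tau_eval_sum_left tau_eval_monom power_mult_distrib power_add mult.assoc
        mult.commute[of "p ^ _" "p ^ _"] flip: power_mult)
  also have "\<dots> = (\<Sum>i\<le>degree f. to_ac (Polynomial.coeff f i) * tau_eval p g x ^ (p ^ i))"
    unfolding tau_eval_def[of p g] by (simp only: frobenius_sum sum_distrib_left)
  finally show ?thesis unfolding tau_eval_def[of p f] .
qed

lemma inertia_tau_eval: "\<sigma> \<in> inertia_group w \<Longrightarrow> \<sigma> (tau_eval p f x) = tau_eval p f (\<sigma> x)"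
  by (simp add: tau_eval_def inertia_sum inertia_power inertiaD(2,3))

text \<open>
  The ordinary polynomial with the same values as the twisted one.
\<close>

definition tau_poly :: "'k poly \<Rightarrow> 'k alg_closure poly" where
  "tau_poly f = (\<Sum>i\<le>degree f. Polynomial.monom (to_ac (Polynomial.coeff f i)) (p ^ i))"

lemma poly_tau_poly: "poly (tau_poly f) x = tau_eval p f x"
  by (simp add: tau_poly_def tau_eval_def poly_sum poly_monom)

lemma coeff_tau_poly_base: "Polynomial.coeff (tau_poly f) i \<in> range to_ac"
proof -
  have "Polynomial.coeff (tau_poly f) i = (\<Sum>j\<le>degree f. to_ac (if p ^ j = i then Polynomial.coeff f j else 0))"
    unfolding tau_poly_def coeff_sum by (intro sum.cong) auto
  also have "\<dots> \<in> range to_ac" by (simp flip: to_ac_sum)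
  finally show ?thesis .
qed

text \<open>
  All exponents except \<open>p ^ 0\<close> are divisible by the characteristic.
\<close>

lemma pderiv_tau_poly: "pderiv (tau_poly f) = [:to_ac (Polynomial.coeff f 0):]"
proof -
  have pz: "(of_nat (p ^ i) :: 'k alg_closure) = (if i = 0 then 1 else 0)" for i
    using CHAR_base of_nat_CHAR[where ?'a = "'k alg_closure"] by (cases i) simp_all
  have "pderiv (tau_poly f) = (\<Sum>i\<le>degree f. if i = 0 then [:to_ac (Polynomial.coeff f 0):] else 0)"
    unfolding tau_poly_def higher_pderiv_sum[of 1, simplified] pderiv_monom
    by (intro sum.cong) (auto simp del: of_nat_power simp: pz monom_0)
  then show ?thesis by simp
qed

definition integral_poly :: "'k poly \<Rightarrow> bool" where
  "integral_poly f \<longleftrightarrow> (\<forall>i. N (to_ac (Polynomial.coeff f i)) \<le> 1)"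

lemma tau_eval_integral: "integral_poly f \<Longrightarrow> N x \<le> 1 \<Longrightarrow> N (tau_eval p f x) \<le> 1"
  unfolding tau_eval_def
  by (rule N_sum_le) (auto simp: N_mult N_power integral_poly_def intro!: mult_le_one power_le_one)

text \<open>
  Outside the valuation ring the leading term strictly dominates.
\<close>

lemma N_tau_eval_large:
  assumes f: "integral_poly f" "N (to_ac (lead_coeff f)) = 1" and x: "1 < N x"
  shows "N (tau_eval p f x) = N x ^ (p ^ degree f)"
proof -
  let ?t = "\<lambda>i. to_ac (Polynomial.coeff f i) * x ^ (p ^ i)"
  have top: "N (?t (degree f)) = N x ^ (p ^ degree f)" using f(2) by (simp add: N_mult N_power)
  have "N (\<Sum>i<degree f. ?t i) < N x ^ (p ^ degree f)"
  proof (rule N_sum_less)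
    fix i assume "i \<in> {..<degree f}"
    then have "p ^ i < p ^ degree f" using p_ge_2 by (intro power_strict_increasing) auto
    then have "N x ^ (p ^ i) < N x ^ (p ^ degree f)" using x by (rule power_strict_increasing)
    moreover have "N (?t i) \<le> 1 * N x ^ (p ^ i)"
      unfolding N_mult N_power using f(1) by (intro mult_right_mono) (auto simp: integral_poly_def)
    ultimately show "N (?t i) < N x ^ (p ^ degree f)" by simp
  qed (use x in \<open>intro zero_less_power, linarith\<close>)
  then have "N ((\<Sum>i<degree f. ?t i) + ?t (degree f)) = N (?t (degree f))"
    by (intro N_add_dominant) (simp only: top)
  then show ?thesis unfolding top by (simp add: tau_eval_def flip: lessThan_Suc_atMost)
qed

text \<open>
  Inside the maximal ideal the linear term strictly dominates.
\<close>

lemma tau_eval_small_root: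
  assumes f: "integral_poly f" "N (to_ac (Polynomial.coeff f 0)) = 1"
    and x: "N x < 1" "tau_eval p f x = 0"
  shows "x = 0"
proof (rule ccontr)
  assume "x \<noteq> 0"
  let ?t = "\<lambda>i. to_ac (Polynomial.coeff f i) * x ^ (p ^ i)"
  have low: "N (?t 0) = N x" using f(2) by (simp add: N_mult)
  have "N (\<Sum>i<degree f. ?t (Suc i)) < N x"
  proof (rule N_sum_less)
    fix i
    have "1 < p ^ Suc i" by (rule one_less_p_power) simp
    then have "N x ^ (p ^ Suc i) < N x ^ 1" using x(1) \<open>x \<noteq> 0\<close> by (intro power_strict_decreasing) auto
    moreover have "N (?t (Suc i)) \<le> 1 * N x ^ (p ^ Suc i)"
      unfolding N_mult N_power using f(1) by (intro mult_right_mono) (auto simp: integral_poly_def)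
    ultimately show "N (?t (Suc i)) < N x" by simp
  qed (use \<open>x \<noteq> 0\<close> in auto)
  then have "N ((\<Sum>i<degree f. ?t (Suc i)) + ?t 0) = N (?t 0)"
    by (intro N_add_dominant) (simp only: low)
  moreover have "(\<Sum>i<degree f. ?t (Suc i)) + ?t 0 = tau_eval p f x"
    unfolding tau_eval_def lessThan_Suc_atMost[symmetric] sum.lessThan_Suc_shift by simp
  ultimately show False using low x(2) \<open>x \<noteq> 0\<close> by simp
qed

text \<open>
  If all roots are larger than \<open>B\<close>, then the ratio of the linear to the constant coefficient,
  which up to sign is the sum of the inverse roots, is smaller than \<open>1 / B\<close>.
\<close>

lemma N_coeff_linear_product:
  assumes "\<And>a. a \<in># A \<Longrightarrow> B < N a" "B > 0"
  shows "N (Polynomial.coeff (\<Prod>a\<in>#A. [:- a, 1:]) 1) * B < N (Polynomial.coeff (\<Prod>a\<in>#A. [:- a, 1:]) 0)"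
  using assms(1)
proof (induction A)
  case (add a A)
  let ?Q = "\<Prod>a\<in>#A. [:- a, 1:]"
  let ?c0 = "Polynomial.coeff ?Q 0" and ?c1 = "Polynomial.coeff ?Q 1"
  have IH: "N ?c1 * B < N ?c0" using add by simp
  have a: "B < N a" using add by simp
  have c0: "N ?c0 > 0" using IH assms(2) by (meson N_nonneg less_eq_real_def mult_nonneg_nonneg order_le_less_trans)
  have "N (?c0 - a * ?c1) * B \<le> max (N ?c0) (N a * N ?c1) * B"
    using N_diff[of ?c0 "a * ?c1"] assms(2) by (intro mult_right_mono) (simp_all add: N_mult)
  also have "\<dots> < N a * N ?c0"
  proof -
    have "N ?c0 * B < N a * N ?c0" using a c0 by simp
    moreover have "N a * (N ?c1 * B) < N a * N ?c0" using IH a assms(2) by (intro mult_strict_left_mono) auto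
    ultimately show ?thesis by (simp add: max_def mult.assoc)
  qed
  finally show ?case by (simp add: N_mult algebra_simps)
qed (use assms(2) in simp)

lemma small_root:
  fixes f :: "'k alg_closure poly"
  assumes c0: "Polynomial.coeff f 0 \<noteq> 0" and c1: "Polynomial.coeff f 1 \<noteq> 0"
  obtains r where "poly f r = 0" "N r \<le> N (Polynomial.coeff f 0) / N (Polynomial.coeff f 1)"
proof -
  have "f \<noteq> 0" using c0 by auto
  then obtain A where A: "f = smult (lead_coeff f) (\<Prod>a\<in>#A. [:- a, 1:])"
    using alg_closed_imp_factorization by blast
  let ?Q = "\<Prod>a\<in>#A. [:- a, 1:]" and ?B = "N (Polynomial.coeff f 0) / N (Polynomial.coeff f 1)"
  have "\<exists>a. a \<in># A \<and> N a \<le> ?B"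
  proof (rule ccontr)
    assume "\<not> ?thesis"
    then have "N (Polynomial.coeff ?Q 1) * ?B < N (Polynomial.coeff ?Q 0)"
      using c0 c1 by (intro N_coeff_linear_product) (auto simp: not_le)
    then have "N (lead_coeff f) * (N (Polynomial.coeff ?Q 1) * ?B) < N (lead_coeff f) * N (Polynomial.coeff ?Q 0)"
      using \<open>f \<noteq> 0\<close> by (intro mult_strict_left_mono) auto
    moreover have "Polynomial.coeff f i = lead_coeff f * Polynomial.coeff ?Q i" for i
      using arg_cong[OF A, of "\<lambda>f. Polynomial.coeff f i"] by simp
    ultimately have "N (Polynomial.coeff f 1) * ?B < N (Polynomial.coeff f 0)"
      by (metis N_mult mult.assoc)
    then show False using c1 by simp
  qed
  then obtain a where a: "a \<in># A" "N a \<le> ?B" by blast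
  have "poly f a = 0" by (subst A) (use a(1) in \<open>auto simp: poly_prod_mset\<close>)
  then show ?thesis using that a(2) by blast
qed

lemma base_discrete_small: "N (to_ac c) < 1 \<Longrightarrow> N (to_ac c) \<le> 1 / 2"
proof (cases "c = 0")
  case False
  assume "N (to_ac c) < 1"
  then have "1 < N (to_ac (inverse c))" using False by (simp add: N_inverse one_less_inverse_iff)
  then have "2 \<le> inverse (N (to_ac c))" using base_discrete[of "inverse c"] by (simp add: N_inverse)
  then show ?thesis using False by (simp add: field_simps)
qed simp

end

text \<open>
  Summation along the diagonals of an array whose rows vanish after row \<open>d\<close>: a partial sum of a
  product of a polynomial with a series becomes a sum of boundedly many partial sums.
\<close>

lemma sum_triangle_bounded:
  fixes h :: "nat \<Rightarrow> nat \<Rightarrow> 'a::comm_monoid_add"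
  assumes "\<And>i j. d < i \<Longrightarrow> h i j = 0"
  shows "(\<Sum>m<n. \<Sum>i\<le>m. h i (m - i)) = (\<Sum>i\<le>d. \<Sum>j<n - i. h i j)"
proof (induction n)
  case (Suc n)
  have "(\<Sum>i\<le>n. h i (n - i)) = (\<Sum>i\<le>n + d. if i \<le> n then h i (n - i) else 0)"
    by (rule sum.mono_neutral_cong_left) auto
  also have "\<dots> = (\<Sum>i\<le>d. if i \<le> n then h i (n - i) else 0)"
    by (rule sum.mono_neutral_cong_right) (auto simp: assms)
  finally have "(\<Sum>m<Suc n. \<Sum>i\<le>m. h i (m - i)) =
      (\<Sum>i\<le>d. (\<Sum>j<n - i. h i j) + (if i \<le> n then h i (n - i) else 0))"
    by (simp add: Suc sum.distrib)
  also have "\<dots> = (\<Sum>i\<le>d. \<Sum>j<Suc n - i. h i j)"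
    by (intro sum.cong) (auto simp: Suc_diff_le)
  finally show ?case .
qed simp

section \<open>The uniformizing exponential\<close>

locale tate_exponential = local_closure p v w
  for p :: nat and v :: "'k::field \<Rightarrow> int" and w :: "'k alg_closure \<Rightarrow> real" +
  fixes e :: "'k fps"
  assumes e_converges: "everywhere_convergent p w e"
    and e_0: "fps_nth e 0 = 1" and e_small: "\<And>i. i > 0 \<Longrightarrow> fps_nth e i \<in> max_ideal v"
begin

definition E :: "'k alg_closure \<Rightarrow> 'k alg_closure" where
  "E = fps_tau_eval p w e"

abbreviation S :: "'k alg_closure \<Rightarrow> nat \<Rightarrow> 'k alg_closure" where
  "S \<equiv> tau_partial_sums p e"

lemma E_unique: "ulim (S x) L \<Longrightarrow> E x = L"
  unfolding E_def fps_tau_eval_def val_lim_iff by (rule the_equality) (auto intro: ulim_unique)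

lemma E_lim: "ulim (S x) (E x)"
  using e_converges E_unique unfolding everywhere_convergent_def val_lim_iff by metis

lemma S_add: "S (x + y) n = S x n + S y n"
  by (simp add: tau_partial_sums_def frobenius_add distrib_left sum.distrib)

lemma E_add: "E (x + y) = E x + E y"
  by (rule E_unique) (use ulim_add[OF E_lim[of x] E_lim[of y]] in \<open>simp add: S_add[abs_def]\<close>)

lemma E_0 [simp]: "E 0 = 0"
  using E_add[of 0 0] by (metis add_0 add_cancel_right_right)

lemma E_diff: "E (x - y) = E x - E y"
  using E_add[of "x - y" y] by simp

lemma E_sum: "E (sum f I) = (\<Sum>i\<in>I. E (f i))"
  by (induction I rule: infinite_finite_induct) (auto simp: E_add)

lemma N_e_le: "N (to_ac (fps_nth e i)) \<le> (if i = 0 then 1 else 1 / 2)"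
  using e_small[of i] base_discrete_small by (auto simp: e_0 max_ideal_base_iff)

lemma N_term_le:
  assumes "N x \<le> 1" shows "N (to_ac (fps_nth e i) * x ^ (p ^ i)) \<le> (if i = 0 then 1 else 1 / 2) * N x"
proof -
  have "N x ^ (p ^ i) \<le> N x ^ 1" using assms p_ge_2 by (intro power_decreasing) auto
  then show ?thesis unfolding N_mult N_power by (intro mult_mono N_e_le) auto
qed

text \<open>
  On integral elements \<open>E\<close> is a contractive perturbation of the identity.
\<close>

lemma N_E_diff: "N x \<le> 1 \<Longrightarrow> N (E x - x) \<le> N x / 2"
proof (rule ulim_bound[OF E_lim])
  fix n :: nat assume x: "N x \<le> 1" and n: "1 \<le> n"
  then obtain m where m: "n = Suc m" by (cases n) auto
  have "S x n - x = (\<Sum>i<m. to_ac (fps_nth e (Suc i)) * x ^ (p ^ Suc i))"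
    unfolding tau_partial_sums_def m sum.lessThan_Suc_shift by (simp add: e_0)
  also have "N \<dots> \<le> N x / 2"
    using N_term_le[OF x, of "Suc _"] by (intro N_sum_le) auto
  finally show "N (S x n - x) \<le> N x / 2" .
qed

lemma N_E_le: "N x \<le> 1 \<Longrightarrow> N (E x) \<le> N x"
proof -
  assume "N x \<le> 1"
  then have "N (E x - x) \<le> N x" using N_E_diff[of x] N_nonneg[of x] by linarith
  then show ?thesis using N_add[of "E x - x" x] by simp
qed

lemma E_continuous:
  assumes "ulim s L" shows "ulim (\<lambda>n. E (s n)) (E L)"
  unfolding ulim_def
proof (intro allI impI)
  fix d :: real assume "d > 0"
  then obtain k where k: "\<forall>n\<ge>k. N (s n - L) < min d 1"
    using assms unfolding ulim_def by (metis min_less_iff_conj zero_less_one min_def)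
  then have "N (E (s n) - E L) < d" if "n \<ge> k" for n
    using N_E_le[of "s n - L"] that by (force simp: E_diff)
  then show "\<exists>k. \<forall>n\<ge>k. N (E (s n) - E L) < d" by blast
qed

text \<open>
  The partial sums stay in \<open>K[z]\<close>, which is complete although \<open>K\<^sup>a\<^sup>l\<^sup>g\<close> is not.
\<close>

lemma E_simple_extension:
  assumes "x \<in> simple_extension z" shows "E x \<in> simple_extension z"
proof -
  have "S x n \<in> simple_extension z" for n
    unfolding tau_partial_sums_def
    by (intro simple_extension_sum simple_extension_mult simple_extension_const simple_extension_power assms)
  then have "\<exists>L\<in>simple_extension z. ulim (S x) L"
    by (intro ucompleteD simple_extension_complete ulim_imp_ucauchy[OF E_lim])
  then show ?thesis using E_unique by blast
qed

text \<open>
  With \<open>h = id - E\<close> the Neumann series of all \<open>h\<^sup>k z\<close> solves \<open>E y = z\<close>. It converges because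
  \<open>h\<close> is contracting and all terms lie in the complete ring \<open>K[z]\<close>.
\<close>

lemma E_surj_integral:
  assumes z: "N z \<le> 1"
  obtains y where "N y \<le> 1" "E y = z"
proof -
  define h where "h x = x - E x" for x
  define t where "t k = (h ^^ k) z" for k
  define s where "s k = (\<Sum>j<k. t j)" for k
  have t_small: "N (t k) \<le> (1 / 2) ^ k" for k
  proof (induction k)
    case (Suc k)
    have "N (t k) \<le> 1" using Suc by (rule order_trans) (simp add: power_le_one)
    then have "N (t (Suc k)) \<le> N (t k) / 2"
      using N_E_diff[of "t k"] by (simp add: t_def h_def N_diff_commute)
    then show ?case using Suc by simp
  qed (use z in \<open>simp add: t_def\<close>)
  have t_ext: "t k \<in> simple_extension z" for k
    by (induction k) (simp_all add: t_def h_def simple_extension_gen simple_extension_diff E_simple_extension)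
  have "ucauchy s"
    unfolding s_def
  proof (rule ucauchy_partial_sums)
    fix d :: real assume "d > 0"
    then obtain k where k: "(1 / 2 :: real) ^ k < d" using real_arch_pow_inv[of d "1 / 2"] by auto
    have "N (t n) < d" if "n \<ge> k" for n
    proof -
      have "N (t n) \<le> (1 / 2) ^ n" by (rule t_small)
      also have "\<dots> \<le> (1 / 2) ^ k" using that by (intro power_decreasing) auto
      finally show ?thesis using k by simp
    qed
    then show "\<exists>k. \<forall>n\<ge>k. N (t n) < d" by blast
  qed
  moreover have "s k \<in> simple_extension z" for k unfolding s_def by (intro simple_extension_sum t_ext)
  ultimately obtain y where y: "ulim s y" using ucompleteD[OF simple_extension_complete] by blast
  have telescope: "E (s k) = z - t k" for k
    by (induction k) (simp_all add: s_def t_def h_def E_add)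
  have "ulim t 0"
    unfolding ulim_def
  proof (intro allI impI)
    fix d :: real assume "d > 0"
    then obtain k where k: "(1 / 2 :: real) ^ k < d" using real_arch_pow_inv[of d "1 / 2"] by auto
    have "N (t n) < d" if "n \<ge> k" for n
      using order_trans[OF t_small power_decreasing[OF that, of "1 / 2 :: real"]] k by simp
    then show "\<exists>k. \<forall>n\<ge>k. N (t n - 0) < d" by auto
  qed
  then have "ulim (\<lambda>k. E (s k)) (z - 0)" unfolding telescope by (intro ulim_diff ulim_const)
  then have "E y = z" using E_continuous[OF y] ulim_unique by fastforce
  moreover have "N (y - 0) \<le> 1"
  proof (rule ulim_bound[OF y])
    fix k
    have "N (t j) \<le> 1" for j using t_small[of j] by (rule order_trans) (simp add: power_le_one)
    then show "N (s k - 0) \<le> 1" unfolding s_def by (simp add: N_sum_le)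
  qed
  ultimately show ?thesis using that by simp
qed

text \<open>
  Cut the series off after the terms that are large at \<open>x\<close>. The truncated equation has linear
  coefficient 1 and constant coefficient \<open>- x\<close>, so it has a root \<open>y\<close> no larger than \<open>x\<close>. At \<open>y\<close> the
  omitted terms are integral as well, and the error is corrected by \<open>E_surj_integral\<close>.
\<close>

lemma E_surj: obtains y where "E y = x"
proof (cases "x = 0")
  case True
  then show ?thesis using that[of 0] by simp
next
  case False
  let ?t = "\<lambda>y i. to_ac (fps_nth e i) * y ^ (p ^ i)"
  obtain k where k: "\<forall>m\<ge>k. \<forall>n\<ge>k. N (S x m - S x n) < 1"
    using ulim_imp_ucauchy[OF E_lim[of x]] unfolding ucauchy_def by (metis zero_less_one)
  have tail: "N (?t x i) < 1" if "i \<ge> k" for i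
    using k[rule_format, of "Suc i" i] that by (simp add: tau_partial_sums_def)
  define n where "n = Suc k"
  define f where "f = (\<Sum>i<n. Polynomial.monom (to_ac (fps_nth e i)) (p ^ i)) - [:x:]"
  have pi: "p ^ i = Suc 0 \<longleftrightarrow> i = 0" "p ^ i \<noteq> 0" for i using p_ge_2 by auto
  have "Polynomial.coeff f 0 = - x" using p_ge_2 by (simp add: f_def coeff_sum)
  moreover have "Polynomial.coeff f 1 = 1"
  proof -
    have "(\<Sum>i<n. Polynomial.coeff (Polynomial.monom (to_ac (fps_nth e i)) (p ^ i)) (Suc 0)) =
          (\<Sum>i<n. if i = 0 then 1 else 0 :: 'k alg_closure)"
      using pi(1) e_0 by (intro sum.cong) auto
    then show ?thesis using p_ge_2 by (simp add: f_def coeff_sum n_def)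
  qed
  ultimately obtain y where y: "poly f y = 0" "N y \<le> N x" using small_root[of f] False by auto
  have Sy: "S y n = x"
    using y(1) by (simp add: f_def tau_partial_sums_def poly_sum poly_monom)
  have "N (E y - x) \<le> 1"
  proof (rule ulim_bound[OF E_lim])
    fix m assume m: "n \<le> m"
    have "S y m - S y n = (\<Sum>i\<in>{n..<m}. ?t y i)"
      unfolding tau_partial_sums_def using m by (rule sum_lessThan_diff)
    also have "N \<dots> \<le> 1"
    proof (rule N_sum_le)
      fix i assume "i \<in> {n..<m}"
      then have "N (?t x i) < 1" by (intro tail) (simp add: n_def)
      moreover have "N (?t y i) \<le> N (?t x i)"
        unfolding N_mult N_power using y(2) by (intro mult_left_mono power_mono) auto
      ultimately show "N (?t y i) \<le> 1" by simp
    qed simp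
    finally show "N (S y m - x) \<le> 1" using Sy by simp
  qed
  then have "N (x - E y) \<le> 1" by (simp add: N_diff_commute)
  then obtain u where "E u = x - E y" using E_surj_integral by metis
  then have "E (y + u) = x" by (simp add: E_add)
  then show ?thesis by (rule that)
qed

lemma ulim_shift_back: "ulim s L \<Longrightarrow> ulim (\<lambda>n. s (n - k)) L"
  unfolding ulim_def
proof (intro allI impI)
  fix d :: real assume "\<forall>e>0. \<exists>k. \<forall>n\<ge>k. N (s n - L) < e" "d > 0"
  then obtain j where j: "\<forall>n\<ge>j. N (s n - L) < d" by blast
  then show "\<exists>j. \<forall>n\<ge>j. N (s (n - k) - L) < d" by (intro exI[of _ "j + k"]) auto
qed

text \<open>
  Both sides are limits of the partial sums of the twisted product of \<open>e\<close> and \<open>f\<close>. Multiplied out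
  along the polynomial factor, these are finite combinations of partial sums of \<open>e\<close>; on the left
  additivity of \<open>E\<close> reassembles the combination.
\<close>

lemma E_intertwines:
  assumes "fps_tau_mult p e (fps_of_poly f) = fps_tau_mult p (fps_of_poly g) e"
  shows "E (tau_eval p f x) = tau_eval p g (E x)"
proof -
  let ?a = "fps_nth e" and ?f = "Polynomial.coeff f" and ?g = "Polynomial.coeff g"
  have pw: "(y ^ (p ^ j)) ^ (p ^ i) = (y :: 'k alg_closure) ^ (p ^ (i + j))" for y i j
    by (simp add: power_add mult.commute flip: power_mult)
  define s where "s n = (\<Sum>m<n. to_ac (fps_nth (fps_tau_mult p e (fps_of_poly f)) m) * x ^ (p ^ m))" for n
  have "s n = (\<Sum>j\<le>degree f. S (to_ac (?f j) * x ^ (p ^ j)) (n - j))" for n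
  proof -
    let ?h = "\<lambda>j i. to_ac (?a i) * (to_ac (?f j) * x ^ (p ^ j)) ^ (p ^ i)"
    have "to_ac (fps_nth (fps_tau_mult p e (fps_of_poly f)) m) * x ^ (p ^ m) = (\<Sum>j\<le>m. ?h j (m - j))" for m
    proof -
      have "to_ac (fps_nth (fps_tau_mult p e (fps_of_poly f)) m) * x ^ (p ^ m) =
          (\<Sum>i\<le>m. ?h (m - i) i)"
        unfolding fps_tau_mult_def fps_nth_Abs_fps to_ac_sum sum_distrib_right
        by (intro sum.cong) (simp_all add: power_mult_distrib pw mult.assoc)
      also have "\<dots> = (\<Sum>j\<le>m. ?h j (m - j))"
        by (rule sum.reindex_bij_witness[of _ "\<lambda>j. m - j" "\<lambda>j. m - j"]) auto
      finally show ?thesis .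
    qed
    then have "s n = (\<Sum>m<n. \<Sum>j\<le>m. ?h j (m - j))" by (simp add: s_def)
    also have "\<dots> = (\<Sum>j\<le>degree f. \<Sum>i<n - j. ?h j i)"
      using p_ge_2 by (intro sum_triangle_bounded) (simp add: coeff_eq_0)
    finally show ?thesis by (simp add: tau_partial_sums_def)
  qed
  then have s_eq: "s = (\<lambda>n. \<Sum>j\<le>degree f. S (to_ac (?f j) * x ^ (p ^ j)) (n - j))" ..
  have "ulim s (\<Sum>j\<le>degree f. E (to_ac (?f j) * x ^ (p ^ j)))"
    unfolding s_eq by (intro ulim_sum ulim_shift_back E_lim)
  then have 1: "ulim s (E (tau_eval p f x))" by (simp add: tau_eval_def E_sum)
  have "s n = (\<Sum>i\<le>degree g. to_ac (?g i) * S x (n - i) ^ (p ^ i))" for n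
  proof -
    let ?h = "\<lambda>i j. to_ac (?g i) * (to_ac (?a j) * x ^ (p ^ j)) ^ (p ^ i)"
    have "to_ac (fps_nth (fps_tau_mult p (fps_of_poly g) e) m) * x ^ (p ^ m) = (\<Sum>i\<le>m. ?h i (m - i))" for m
      unfolding fps_tau_mult_def fps_nth_Abs_fps to_ac_sum sum_distrib_right
      by (intro sum.cong) (simp_all add: power_mult_distrib pw mult.assoc)
    then have "s n = (\<Sum>m<n. \<Sum>i\<le>m. ?h i (m - i))" by (simp add: s_def assms)
    also have "\<dots> = (\<Sum>i\<le>degree g. \<Sum>j<n - i. ?h i j)"
      by (intro sum_triangle_bounded) (simp add: coeff_eq_0)
    finally show ?thesis by (simp add: tau_partial_sums_def frobenius_sum sum_distrib_left)
  qed
  then have s_eq: "s = (\<lambda>n. \<Sum>i\<le>degree g. to_ac (?g i) * S x (n - i) ^ (p ^ i))" ..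
  have "ulim s (\<Sum>i\<le>degree g. to_ac (?g i) * E x ^ (p ^ i))"
    unfolding s_eq by (intro ulim_sum ulim_mult_const ulim_power ulim_shift_back E_lim)
  then have 2: "ulim s (tau_eval p g (E x))" by (simp add: tau_eval_def)
  show ?thesis using ulim_unique[OF 1 2] .
qed

lemma inertia_E: "\<sigma> \<in> inertia_group w \<Longrightarrow> \<sigma> (E x) = E (\<sigma> x)"
proof -
  assume \<sigma>: "\<sigma> \<in> inertia_group w"
  have "S (\<sigma> x) n = \<sigma> (S x n)" for n
    by (simp add: tau_partial_sums_def inertia_sum[OF \<sigma>] inertia_power[OF \<sigma>] inertiaD(2,3)[OF \<sigma>])
  then have "N (S (\<sigma> x) n - \<sigma> (E x)) = N (S x n - E x)" for n
    using inertiaD(4)[OF \<sigma>, of "S x n - E x"] by (simp add: inertia_diff[OF \<sigma>])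
  then have "ulim (S (\<sigma> x)) (\<sigma> (E x))" using E_lim[of x] by (simp add: ulim_def)
  then show ?thesis using E_unique by simp
qed

end

section \<open>Discrete extensions of a lattice with an expanding endomorphism\<close>

text \<open>
  Here \<open>T\<close> stands for \<open>\<psi>\<^sub>a\<close> acting on the lattice \<open>M\<close>, and \<open>R\<close> meets every class of \<open>M / T M\<close>.
\<close>

locale expanding_lattice = ultranorm N
  for N :: "'a::field \<Rightarrow> real" +
  fixes T :: "'a \<Rightarrow> 'a" and D :: nat and M R :: "'a set"
  assumes T_add: "T (x + y) = T x + T y"
    and T_large: "1 < N x \<Longrightarrow> N (T x) = N x ^ D"
    and T_small: "N x \<le> 1 \<Longrightarrow> N (T x) \<le> 1"
    and D_ge_2: "D \<ge> 2"
    and M_0: "0 \<in> M" and M_diff: "x \<in> M \<Longrightarrow> y \<in> M \<Longrightarrow> x - y \<in> M" and M_T: "x \<in> M \<Longrightarrow> T x \<in> M"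
    and finite_bounded: "finite {m \<in> M. N m \<le> Y}"
    and finite_R: "finite R"
    and R_cosets: "m \<in> M \<Longrightarrow> \<exists>r\<in>R. \<exists>m'\<in>M. m = r + T m'"
begin

lemma T_0: "T 0 = 0"
  using T_add[of 0 0] by (metis add_0 add_cancel_right_right)

lemma T_diff: "T (x - y) = T x - T y"
  using T_add[of "x - y" y] by simp

lemma M_minus: "x \<in> M \<Longrightarrow> - x \<in> M"
  using M_diff[OF M_0, of x] by simp

lemma M_add: "x \<in> M \<Longrightarrow> y \<in> M \<Longrightarrow> x + y \<in> M"
  using M_diff[OF _ M_minus, of x y] by simp

lemma Tn_diff: "(T ^^ n) (x - y) = (T ^^ n) x - (T ^^ n) y"
  by (induction n) (auto simp: T_diff)

lemma Tn_0: "(T ^^ n) 0 = 0"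
  by (induction n) (auto simp: T_0)

lemma Tn_M: "x \<in> M \<Longrightarrow> (T ^^ n) x \<in> M"
  by (induction n) (auto simp: M_T)

lemma Tn_small: "N x \<le> 1 \<Longrightarrow> N ((T ^^ n) x) \<le> 1"
  by (induction n) (auto simp: T_small)

lemma Tn_large: "1 < N x \<Longrightarrow> N ((T ^^ n) x) = N x ^ (D ^ n)"
proof (induction n)
  case (Suc n)
  then have "1 < N ((T ^^ n) x)" using D_ge_2 by (simp add: one_less_power)
  then show ?case using Suc by (simp add: T_large mult.commute flip: power_mult)
qed simp

lemma Tn_le:
  assumes "N x \<le> C" "1 \<le> C" shows "N ((T ^^ n) x) \<le> C ^ (D ^ n)"
proof (cases "1 < N x")
  case True
  then show ?thesis using assms by (simp add: Tn_large power_mono)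
next
  case False
  then show ?thesis using Tn_small[of x n] one_le_power[OF assms(2), of "D ^ n"] by linarith
qed

lemma Tn_bound_converse:
  assumes "N ((T ^^ n) x) \<le> C ^ (D ^ n)" "1 \<le> C" shows "N x \<le> C"
proof (cases "1 < N x")
  case True
  then have "N x ^ (D ^ n) \<le> C ^ (D ^ n)" using assms(1) by (simp add: Tn_large)
  moreover have "D ^ n > 0" using D_ge_2 by simp
  ultimately show ?thesis using assms(2) by (metis N_nonneg power_mono_iff order_trans zero_le_one)
qed (use assms(2) in simp)

definition ball :: "real \<Rightarrow> 'a set" where
  "ball Y = {m \<in> M. N m \<le> Y}"

text \<open>
  Two lattice points in the same class modulo \<open>T M\<close> differ by some \<open>T m\<close>, and if they lie in the
  ball of radius \<open>Y ^ D\<close>, then \<open>m\<close> lies in the ball of radius \<open>Y\<close>. So each class contributes at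
  most one translate of the smaller ball.
\<close>

lemma card_ball_power:
  assumes Y: "1 \<le> Y" shows "card (ball (Y ^ D)) \<le> card R * card (ball Y)"
proof -
  \<comment> \<open>a point of the ball in the class of \<open>r\<close>; its value is arbitrary if there is none\<close>
  define base where "base r = (SOME b. b \<in> ball (Y ^ D) \<and> (\<exists>m\<in>M. b = r + T m))" for r
  have "ball (Y ^ D) \<subseteq> (\<lambda>(r, m). base r + T m) ` (R \<times> ball Y)"
  proof
    fix x assume x: "x \<in> ball (Y ^ D)"
    then have "x \<in> M" by (simp add: ball_def)
    from R_cosets[OF this] obtain r m where rm: "r \<in> R" "m \<in> M" "x = r + T m" by blast
    have "base r \<in> ball (Y ^ D) \<and> (\<exists>m\<in>M. base r = r + T m)"
      unfolding base_def by (rule someI[of _ x]) (use x rm in blast)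
    then obtain m' where m': "base r \<in> ball (Y ^ D)" "m' \<in> M" "base r = r + T m'" by blast
    have eq: "x = base r + T (m - m')" by (simp add: rm(3) m'(3) T_diff)
    have "N (T (m - m')) \<le> max (N x) (N (base r))"
      using N_diff[of x "base r"] eq by simp
    also have "\<dots> \<le> Y ^ D" using x m'(1) by (simp add: ball_def)
    finally have "N (m - m') \<le> Y" using Tn_bound_converse[of 1 "m - m'" Y] Y by simp
    then have "m - m' \<in> ball Y" using M_diff rm(2) m'(2) by (simp add: ball_def)
    then show "x \<in> (\<lambda>(r, m). base r + T m) ` (R \<times> ball Y)" using eq rm(1) by force
  qed
  moreover have "finite (R \<times> ball Y)" using finite_R finite_bounded by (simp add: ball_def)
  ultimately have "card (ball (Y ^ D)) \<le> card (R \<times> ball Y)" by (rule surj_card_le[rotated])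
  then show ?thesis by (simp add: card_cartesian_product)
qed

lemma card_ball_iterate: "1 \<le> Y \<Longrightarrow> card (ball (Y ^ (D ^ c))) \<le> card R ^ c * card (ball Y)"
proof (induction c)
  case (Suc c)
  have "card (ball ((Y ^ (D ^ c)) ^ D)) \<le> card R * card (ball (Y ^ (D ^ c)))"
    using Suc.prems by (intro card_ball_power one_le_power)
  also have "\<dots> \<le> card R * (card R ^ c * card (ball Y))" using Suc by simp
  finally show ?case by (simp add: mult.commute mult.left_commute flip: power_mult)
qed simp

text \<open>
  The translates of the ball of radius \<open>Y\<close> by points of \<open>Z\<close> are disjoint and fit into the larger
  ball; the size of the small ball cancels.
\<close>

lemma card_separated:
  assumes Y: "1 \<le> Y" and Z: "Z \<subseteq> ball (Y ^ (D ^ c))"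
    and sep: "\<And>x y. x \<in> Z \<Longrightarrow> y \<in> Z \<Longrightarrow> x \<noteq> y \<Longrightarrow> Y < N (x - y)"
  shows "card Z \<le> card R ^ c"
proof -
  have fin: "finite (ball Y)" for Y using finite_bounded by (simp add: ball_def)
  have "card (Z \<times> ball Y) \<le> card (ball (Y ^ (D ^ c)))"
  proof (rule card_inj_on_le[of "\<lambda>(z, m). z + m"])
    show "inj_on (\<lambda>(z, m). z + m) (Z \<times> ball Y)"
    proof (rule inj_onI, clarify)
      fix x m y n assume *: "x \<in> Z" "y \<in> Z" "m \<in> ball Y" "n \<in> ball Y" "x + m = y + n"
      then have "x - y = n - m" by (simp add: algebra_simps)
      moreover have "N (n - m) \<le> Y"
        using *(3,4) by (intro order_trans[OF N_diff max.boundedI]) (simp_all add: ball_def)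
      ultimately have "N (x - y) \<le> Y" by simp
      then have "x = y" using sep[OF *(1,2)] by force
      then show "x = y \<and> m = n" using *(5) by simp
    qed
    have "Y ^ 1 \<le> Y ^ (D ^ c)" using Y D_ge_2 by (intro power_increasing) auto
    then show "(\<lambda>(z, m). z + m) ` (Z \<times> ball Y) \<subseteq> ball (Y ^ (D ^ c))"
    proof clarify
      fix z m assume "z \<in> Z" "m \<in> ball Y"
      then have "z \<in> M" "N z \<le> Y ^ (D ^ c)" "m \<in> M" "N m \<le> Y ^ (D ^ c)"
        using Z \<open>Y ^ 1 \<le> Y ^ (D ^ c)\<close> by (auto simp: ball_def)
      then show "z + m \<in> ball (Y ^ (D ^ c))" using N_add[of z m] by (simp add: ball_def M_add)
    qed
  qed (rule fin)
  also have "\<dots> \<le> card R ^ c * card (ball Y)" by (rule card_ball_iterate[OF Y])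
  finally have "card Z * card (ball Y) \<le> card R ^ c * card (ball Y)" by (simp add: card_cartesian_product)
  moreover have "0 \<in> ball Y" using M_0 Y by (simp add: ball_def)
  then have "card (ball Y) > 0" using fin by (auto simp: card_gt_0_iff)
  ultimately show ?thesis by simp
qed

text \<open>
  The entry 1 keeps the maximum above the threshold at which \<open>T\<close> begins to expand.
\<close>

definition C :: real where "C = Max (insert 1 (N ` R))"

lemma C_ge_1: "1 \<le> C" and N_R_le: "r \<in> R \<Longrightarrow> N r \<le> C"
  unfolding C_def using finite_R by auto

text \<open>
  Expand \<open>m\<close> in base \<open>T\<close> with digits from \<open>R\<close>. The first \<open>n\<close> digits form the representative modulo
  \<open>T\<^sup>n M\<close>, and each digit is at most \<open>C\<close>.
\<close>

lemma bounded_representative: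
  assumes "m \<in> M" obtains m' where "m' \<in> M" "N (m - (T ^^ n) m') \<le> C ^ (D ^ n)"
proof -
  have "\<exists>m'\<in>M. N (m - (T ^^ n) m') \<le> C ^ (D ^ n)"
  proof (induction n)
    case 0
    then show ?case using assms C_ge_1 by (intro bexI[of _ m]) auto
  next
    case (Suc n)
    then obtain m' where m': "m' \<in> M" "N (m - (T ^^ n) m') \<le> C ^ (D ^ n)" by blast
    obtain r m'' where r: "r \<in> R" "m'' \<in> M" "m' = r + T m''" using R_cosets[OF m'(1)] by blast
    have "r = m' - T m''" using r(3) by simp
    then have "(T ^^ n) r = (T ^^ n) m' - (T ^^ Suc n) m''" by (simp add: Tn_diff funpow_swap1)
    then have eq: "m - (T ^^ Suc n) m'' = (m - (T ^^ n) m') + (T ^^ n) r" by simp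
    have "N (m - (T ^^ Suc n) m'') \<le> max (N (m - (T ^^ n) m')) (N ((T ^^ n) r))"
      unfolding eq by (rule N_add)
    also have "\<dots> \<le> C ^ (D ^ n)" using m'(2) Tn_le[OF N_R_le[OF r(1)] C_ge_1, of n] by simp
    also have "\<dots> \<le> C ^ (D ^ Suc n)" using C_ge_1 D_ge_2 by (intro power_increasing) auto
    finally show ?case using r(2) by blast
  qed
  then show ?thesis using that by blast
qed

lemma reduce_modulo_lattice:
  assumes "(T ^^ n) x \<in> M" obtains m where "m \<in> M" "N (x - m) \<le> C"
proof -
  obtain m where m: "m \<in> M" "N ((T ^^ n) x - (T ^^ n) m) \<le> C ^ (D ^ n)"
    using bounded_representative[OF assms, of n] by metis
  then have "N (x - m) \<le> C" using C_ge_1 by (subst (asm) Tn_diff[symmetric]) (rule Tn_bound_converse)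
  then show ?thesis using that m(1) by blast
qed

text \<open>
  The pigeonhole principle of the argument; that \<open>J\<close> depends neither on \<open>n\<close> nor on \<open>y\<close> is the point.
  Points \<open>y\<^sub>i\<close> that are pairwise incongruent modulo the valuation ring have images under a power
  of \<open>T\<close> to which \<open>card_separated\<close> applies.
\<close>

lemma close_pair:
  obtains J :: nat where "\<And>y n. \<forall>i\<le>J. (T ^^ n) (y i) \<in> M \<and> N (y i) \<le> C \<Longrightarrow>
     \<forall>i\<le>J. \<forall>j\<le>J. 1 < N (y i - y j) \<longrightarrow> 2 \<le> N (y i - y j) \<Longrightarrow>
     \<exists>i j. i < j \<and> j \<le> J \<and> N (y i - y j) \<le> 1"
proof -
  \<comment> \<open>measure the constant \<open>C\<close> on the scale of the iterated powers \<open>2 ^ (D ^ c)\<close>\<close>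
  obtain c0 where c0: "C < 2 ^ c0" using real_arch_pow[of 2 C] by auto
  have "c0 \<le> D ^ c0"
    using D_ge_2 by (metis less_exp less_imp_le order_trans power_mono zero_le_numeral)
  then have c: "C \<le> 2 ^ (D ^ c0)"
    using c0 power_increasing[of c0 "D ^ c0" "2::real"] by linarith
  define J where "J = card R ^ (c0 + 1)"
  have "\<exists>i j. i < j \<and> j \<le> J \<and> N (y i - y j) \<le> 1"
    if y: "\<forall>i\<le>J. (T ^^ n0) (y i) \<in> M \<and> N (y i) \<le> C"
      and disc: "\<forall>i\<le>J. \<forall>j\<le>J. 1 < N (y i - y j) \<longrightarrow> 2 \<le> N (y i - y j)" for y n0
  proof (rule ccontr)
    assume no: "\<not> ?thesis"
    define n where "n = Suc n0"
    \<comment> \<open>one application of \<open>T\<close> more than needed to reach \<open>M\<close>: the radius \<open>2 ^ (D ^ n0)\<close> is then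
      strictly below the mutual distances, which are at least \<open>2 ^ (D ^ Suc n0)\<close>\<close>
    define Y :: real where "Y = 2 ^ (D ^ n0)"
    have Y1: "1 \<le> Y" by (simp add: Y_def)
    have far: "Y < N ((T ^^ n) (y i) - (T ^^ n) (y j))" if ij: "i \<le> J" "j \<le> J" "i \<noteq> j" for i j
    proof -
      have "\<not> N (y i - y j) \<le> 1" using no ij N_diff_commute by (metis linorder_neqE_nat)
      then have *: "1 < N (y i - y j)" by simp
      have "D ^ n0 < D ^ n" using D_ge_2 by (simp add: n_def)
      then have "Y < 2 ^ (D ^ n)" by (simp add: Y_def power_strict_increasing)
      also have "\<dots> \<le> N (y i - y j) ^ (D ^ n)" using disc ij(1,2) * by (intro power_mono) auto
      also have "\<dots> = N ((T ^^ n) (y i) - (T ^^ n) (y j))" using Tn_large[OF *] by (simp add: Tn_diff)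
      finally show ?thesis .
    qed
    let ?Z = "(\<lambda>i. (T ^^ n) (y i)) ` {..J}"
    have "inj_on (\<lambda>i. (T ^^ n) (y i)) {..J}"
    proof (rule inj_onI, rule ccontr)
      fix i j assume "i \<in> {..J}" "j \<in> {..J}" "(T ^^ n) (y i) = (T ^^ n) (y j)" "i \<noteq> j"
      then show False using far[of i j] Y1 by simp
    qed
    then have "card ?Z = J + 1" by (simp add: card_image)
    moreover have "card ?Z \<le> card R ^ (c0 + 1)"
    proof (rule card_separated[OF Y1])
      have "C ^ (D ^ n) \<le> (2 ^ (D ^ c0)) ^ (D ^ n)" using c C_ge_1 by (intro power_mono) auto
      also have "\<dots> = Y ^ (D ^ (c0 + 1))" by (simp add: Y_def n_def mult_ac flip: power_mult)
      finally have "N ((T ^^ n) (y i)) \<le> Y ^ (D ^ (c0 + 1))" if "i \<le> J" for i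
        using Tn_le[OF _ C_ge_1, of "y i" n] y that by fastforce
      then show "?Z \<subseteq> ball (Y ^ (D ^ (c0 + 1)))"
        using y M_T by (auto simp: ball_def n_def)
      show "Y < N (x - x')" if "x \<in> ?Z" "x' \<in> ?Z" "x \<noteq> x'" for x x'
        using that far by auto
    qed
    ultimately show False by (simp add: J_def)
  qed
  then show ?thesis using that by blast
qed

text \<open>
  Congruence modulo the sum of \<open>M\<close> and the valuation ring.
\<close>

definition near :: "'a \<Rightarrow> 'a \<Rightarrow> bool" where
  "near x y \<longleftrightarrow> (\<exists>m\<in>M. N (x - y - m) \<le> 1)"

lemma near_close: "N (x - y) \<le> 1 \<Longrightarrow> near x y"
  unfolding near_def using M_0 by force

lemma near_lattice: "x - y \<in> M \<Longrightarrow> near x y"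
  unfolding near_def by force

lemma near_sym: "near x y \<Longrightarrow> near y x"
  unfolding near_def
proof (elim bexE)
  fix m assume "m \<in> M" "N (x - y - m) \<le> 1"
  moreover have "y - x - - m = - (x - y - m)" by simp
  ultimately show "\<exists>m\<in>M. N (y - x - m) \<le> 1" using M_minus by (intro bexI[of _ "- m"]) (simp_all only: N_minus)
qed

lemma near_trans: "near x y \<Longrightarrow> near y z \<Longrightarrow> near x z"
  unfolding near_def
proof (elim bexE)
  fix m m' assume *: "m \<in> M" "N (x - y - m) \<le> 1" "m' \<in> M" "N (y - z - m') \<le> 1"
  have "x - z - (m + m') = (x - y - m) + (y - z - m')" by simp
  also have "N \<dots> \<le> max (N (x - y - m)) (N (y - z - m'))" by (rule N_add)
  also have "\<dots> \<le> 1" using * by simp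
  finally have "N (x - z - (m + m')) \<le> 1" .
  then show "\<exists>m\<in>M. N (x - z - m) \<le> 1" using M_add *(1,3) by blast
qed

lemma near_T: "near x y \<Longrightarrow> near (T x) (T y)"
  unfolding near_def
proof (elim bexE)
  fix m assume "m \<in> M" "N (x - y - m) \<le> 1"
  then show "\<exists>m\<in>M. N (T x - T y - m) \<le> 1"
    using T_small[of "x - y - m"] M_T by (intro bexI[of _ "T m"]) (simp_all add: T_diff)
qed

lemma near_Tn: "near x y \<Longrightarrow> near ((T ^^ n) x) ((T ^^ n) y)"
  by (induction n) (auto intro: near_T)

text \<open>
  A coherent sequence of division points of lattice elements that stays in a discretely valued
  group \<open>U\<close> consists of lattice elements up to integral ones. After reduction to bounded size two
  members of the sequence are congruent by \<open>close_pair\<close>. Modulo \<open>near\<close> some member is then fixed by a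
  positive power of \<open>T\<close>; as a power of \<open>T\<close> also kills it, it is trivial, and with it the first
  member.
\<close>

lemma divisible_near_lattice:
  assumes U: "M \<subseteq> U" "\<And>x y. x \<in> U \<Longrightarrow> y \<in> U \<Longrightarrow> x - y \<in> U" "\<And>x. x \<in> U \<Longrightarrow> 1 < N x \<Longrightarrow> 2 \<le> N x"
    and y: "\<And>i. y i \<in> U" "\<And>i. T (y (Suc i)) - y i \<in> M" "(T ^^ n) (y 0) \<in> M"
  obtains m where "m \<in> M" "N (y 0 - m) \<le> 1"
proof -
  have torsion: "(T ^^ (n + i)) (y i) \<in> M" for i
  proof (induction i)
    case (Suc i)
    have "(T ^^ (n + Suc i)) (y (Suc i)) = (T ^^ (n + i)) (T (y (Suc i)) - y i) + (T ^^ (n + i)) (y i)"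
      by (simp add: Tn_diff funpow_swap1)
    then show ?case using Suc y(2) by (simp add: M_add Tn_M)
  qed (use y(3) in simp)
  have "\<forall>i. \<exists>m. m \<in> M \<and> N (y i - m) \<le> C"
  proof
    fix i show "\<exists>m. m \<in> M \<and> N (y i - m) \<le> C" using reduce_modulo_lattice[OF torsion[of i]] by metis
  qed
  then obtain m where m: "\<And>i. m i \<in> M" "\<And>i. N (y i - m i) \<le> C" by metis
  define z where "z i = y i - m i" for i
  have zy: "near (z i) (y i)" for i
    using M_minus m(1) by (intro near_lattice) (simp add: z_def)
  have step: "near (T (z (Suc i))) (z i)" for i
    using near_trans[OF near_trans[OF near_T[OF zy] near_lattice[OF y(2)]] near_sym[OF zy]] .
  have steps: "near ((T ^^ k) (z (i + k))) (z i)" for i k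
  proof (induction k)
    case 0
    then show ?case by (simp add: near_close)
  next
    case (Suc k)
    have "near ((T ^^ k) (T (z (Suc (i + k))))) ((T ^^ k) (z (i + k)))" by (intro near_Tn step)
    then show ?case using near_trans[OF _ Suc] by (simp add: funpow_swap1)
  qed
  obtain J :: nat where J: "\<And>y n. \<forall>i\<le>J. (T ^^ n) (y i) \<in> M \<and> N (y i) \<le> C \<Longrightarrow>
     \<forall>i\<le>J. \<forall>j\<le>J. 1 < N (y i - y j) \<longrightarrow> 2 \<le> N (y i - y j) \<Longrightarrow>
     \<exists>i j. i < j \<and> j \<le> J \<and> N (y i - y j) \<le> 1"
    using close_pair by blast
  have z_torsion: "(T ^^ (n + J)) (z i) \<in> M" if "i \<le> J" for i
  proof -
    have "(T ^^ (J - i)) ((T ^^ (n + i)) (y i)) \<in> M" by (intro Tn_M torsion)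
    moreover have "T ^^ (n + J) = T ^^ (J - i) \<circ> T ^^ (n + i)"
      unfolding funpow_add[symmetric] using that by (simp add: add.commute)
    ultimately have "(T ^^ (n + J)) (y i) \<in> M" by simp
    then show ?thesis by (simp add: z_def Tn_diff M_diff Tn_M m(1))
  qed
  have "\<exists>i j. i < j \<and> j \<le> J \<and> N (z i - z j) \<le> 1"
  proof (rule J)
    show "\<forall>i\<le>J. (T ^^ (n + J)) (z i) \<in> M \<and> N (z i) \<le> C" using z_torsion m(2) by (simp add: z_def)
    have "z i \<in> U" for i unfolding z_def using U(1,2) m(1) y(1) by blast
    then show "\<forall>i\<le>J. \<forall>j\<le>J. 1 < N (z i - z j) \<longrightarrow> 2 \<le> N (z i - z j)" using U(2,3) by blast
  qed
  then obtain i j where ij: "i < j" "j \<le> J" "N (z i - z j) \<le> 1" by blast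
  define d where "d = j - i"
  have d: "d > 0" "i + d = j" using ij(1) by (auto simp: d_def)
  have period: "near ((T ^^ d) (z j)) (z j)"
    using near_trans[OF steps[of d i] near_close] ij(3) d(2) by simp
  have periods: "near ((T ^^ (d * k)) (z j)) (z j)" for k
  proof (induction k)
    case 0
    then show ?case by (simp add: near_close)
  next
    case (Suc k)
    have "near ((T ^^ d) ((T ^^ (d * k)) (z j))) ((T ^^ d) (z j))" by (intro near_Tn Suc)
    from near_trans[OF this period] show ?case by (simp add: funpow_add)
  qed
  have "n + J \<le> d * (n + J)" using d(1) by simp
  then have "T ^^ (d * (n + J)) = T ^^ (d * (n + J) - (n + J)) \<circ> T ^^ (n + J)"
    unfolding funpow_add[symmetric] by simp
  then have "(T ^^ (d * (n + J))) (z j) \<in> M" using Tn_M[OF z_torsion[OF ij(2)]] by simp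
  then have "near ((T ^^ (d * (n + J))) (z j)) 0" by (intro near_lattice) simp
  then have "near (z j) 0" by (rule near_trans[OF near_sym[OF periods]])
  then have "near ((T ^^ j) (z j)) 0" using near_Tn[of "z j" 0 j] by (simp add: Tn_0)
  moreover have "near (z 0) ((T ^^ j) (z j))" using near_sym[OF steps[of j 0]] by simp
  ultimately have "near (z 0) 0" using near_trans by metis
  then have "near (y 0) 0" by (rule near_trans[OF near_sym[OF zy]])
  then show ?thesis using that unfolding near_def by auto
qed

end

section \<open>Subrings of function fields\<close>

lemma
  assumes "valuation v"
  shows valuation_mult: "x \<noteq> 0 \<Longrightarrow> y \<noteq> 0 \<Longrightarrow> v (x * y) = v x + v y"
    and valuation_add: "x \<noteq> 0 \<Longrightarrow> y \<noteq> 0 \<Longrightarrow> x + y \<noteq> 0 \<Longrightarrow> min (v x) (v y) \<le> v (x + y)"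
    and valuation_1: "v 1 = 0"
  using assms unfolding valuation_def by (blast, blast, metis add_cancel_right_left mult_1 zero_neq_one)

lemma valuation_minus:
  fixes v :: "'a::field \<Rightarrow> 'g::linordered_ab_group_add"
  assumes "valuation v" shows "v (- x) = v x"
proof (cases "x = 0")
  case False
  have "v (- 1) + v (- 1) = 0" using valuation_mult[OF assms, of "- 1" "- 1"] valuation_1[OF assms] by simp
  then have "v (- 1) = 0" by simp
  then show ?thesis using valuation_mult[OF assms, of "- 1" x] False by simp
qed simp

lemma valuation_power:
  fixes v :: "'a::field \<Rightarrow> int"
  assumes "valuation v" "x \<noteq> 0" shows "v (x ^ n) = int n * v x"
  using assms by (induction n) (simp_all add: valuation_1 valuation_mult algebra_simps)

lemma
  assumes v: "valuation v"
  shows val_ring_0: "0 \<in> val_ring v" and val_ring_1: "1 \<in> val_ring v"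
    and val_ring_add: "x \<in> val_ring v \<Longrightarrow> y \<in> val_ring v \<Longrightarrow> x + y \<in> val_ring v"
    and val_ring_mult: "x \<in> val_ring v \<Longrightarrow> y \<in> val_ring v \<Longrightarrow> x * y \<in> val_ring v"
    and val_ring_minus: "x \<in> val_ring v \<Longrightarrow> - x \<in> val_ring v"
proof -
  show "0 \<in> val_ring v" "1 \<in> val_ring v" by (simp_all add: val_ring_def valuation_1[OF v])
  show "x + y \<in> val_ring v" if "x \<in> val_ring v" "y \<in> val_ring v"
  proof (cases "x = 0 \<or> y = 0 \<or> x + y = 0")
    case True
    then show ?thesis using that by (auto simp: val_ring_def)
  next
    case False
    then have "0 \<le> min (v x) (v y)" using that by (simp add: val_ring_def)
    also have "\<dots> \<le> v (x + y)" using valuation_add[OF v] False by blast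
    finally show ?thesis by (simp add: val_ring_def)
  qed
  show "x * y \<in> val_ring v" if "x \<in> val_ring v" "y \<in> val_ring v"
    using that valuation_mult[OF v, of x y] by (cases "x = 0 \<or> y = 0") (auto simp: val_ring_def)
  show "- x \<in> val_ring v" if "x \<in> val_ring v"
    using that by (auto simp: val_ring_def valuation_minus[OF v])
qed

lemma
  assumes A: "A = regular_outside vinf"
  shows regular_0: "0 \<in> A" and regular_1: "1 \<in> A"
    and regular_add: "x \<in> A \<Longrightarrow> y \<in> A \<Longrightarrow> x + y \<in> A"
    and regular_mult: "x \<in> A \<Longrightarrow> y \<in> A \<Longrightarrow> x * y \<in> A"
    and regular_minus: "x \<in> A \<Longrightarrow> - x \<in> A"
  unfolding A regular_outside_def discrete_valuation_def
  by (auto intro: val_ring_0 val_ring_1 val_ring_add val_ring_mult val_ring_minus)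

section \<open>Finiteness of lattices\<close>

context local_closure
begin

text \<open>
  Peel off one digit of the expansion in a uniformizer at a time.
\<close>

lemma base_ball_finite:
  obtains S where "finite S" "\<And>c. N (to_ac c) \<le> 2 ^ n \<Longrightarrow> \<exists>s\<in>S. N (to_ac (c - s)) \<le> 1"
proof -
  obtain R where R: "finite R" "\<And>c. N (to_ac c) \<le> 1 \<Longrightarrow> \<exists>r\<in>R. N (to_ac (c - r)) < 1"
    using residue_representatives by metis
  have "v ` (UNIV - {0}) = UNIV" using local by (simp add: local_field_def discrete_valuation_def)
  then obtain u where "u \<noteq> 0" "v u = 1" by (metis Diff_iff UNIV_I imageE singletonI)
  then have u: "u \<noteq> 0" "N (to_ac u) = 1 / 2" by (simp_all add: N_def w_base powr_minus_divide)
  have "\<exists>S. finite S \<and> (\<forall>c. N (to_ac c) \<le> 2 ^ n \<longrightarrow> (\<exists>s\<in>S. N (to_ac (c - s)) \<le> 1))"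
  proof (induction n)
    case 0
    show ?case by (intro exI[of _ "{0}"]) auto
  next
    case (Suc n)
    then obtain S where S: "finite S" "\<And>c. N (to_ac c) \<le> 2 ^ n \<Longrightarrow> \<exists>s\<in>S. N (to_ac (c - s)) \<le> 1" by blast
    let ?S = "(\<lambda>(r, s). r / u ^ Suc n + s) ` (R \<times> S)"
    have "\<exists>s\<in>?S. N (to_ac (c - s)) \<le> 1" if c: "N (to_ac c) \<le> 2 ^ Suc n" for c
    proof -
      have "N (to_ac (u ^ Suc n * c)) = (1 / 2) ^ Suc n * N (to_ac c)"
        by (simp only: to_ac_mult to_ac_power N_mult N_power u(2))
      also have "\<dots> \<le> (1 / 2) ^ Suc n * 2 ^ Suc n" using c by (intro mult_left_mono) auto
      finally have "N (to_ac (u ^ Suc n * c)) \<le> 1" by (simp add: power_divide)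
      then obtain r where r: "r \<in> R" "N (to_ac (u ^ Suc n * c - r)) < 1" using R(2) by blast
      have "u ^ Suc n * c - r = u ^ Suc n * (c - r / u ^ Suc n)" using u(1) by (simp add: field_simps)
      then have "N (to_ac (u ^ Suc n * c - r)) = (1 / 2) ^ Suc n * N (to_ac (c - r / u ^ Suc n))"
        by (simp only: to_ac_mult to_ac_power N_mult N_power u(2))
      then have "(1 / 2) ^ Suc n * N (to_ac (c - r / u ^ Suc n)) \<le> 1 / 2"
        using base_discrete_small[OF r(2)] by simp
      then have "N (to_ac (c - r / u ^ Suc n)) \<le> 2 ^ n" by (simp add: power_divide field_simps)
      then obtain s where "s \<in> S" "N (to_ac (c - r / u ^ Suc n - s)) \<le> 1" using S(2) by blast
      then show ?thesis using r(1) by (intro bexI[of _ "r / u ^ Suc n + s"]) (auto simp: diff_diff_eq)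
    qed
    then show ?case using R(1) S(1) by (intro exI[of _ ?S]) auto
  qed
  then show ?thesis using that by blast
qed

text \<open>
  A bounded subset of \<open>K\<close> meets finitely many classes modulo the valuation ring, and two points
  of the lattice in the same class differ by an integral lattice element.
\<close>

lemma finite_bounded_lattice:
  assumes base: "M \<subseteq> range to_ac" and diff: "\<And>x y. x \<in> M \<Longrightarrow> y \<in> M \<Longrightarrow> x - y \<in> M"
    and separated: "\<And>x. x \<in> M \<Longrightarrow> N x \<le> 1 \<Longrightarrow> x = 0"
  shows "finite {m \<in> M. N m \<le> Y}"
proof -
  obtain n where n: "Y < 2 ^ n" using real_arch_pow[of 2 Y] by auto
  obtain S where S: "finite S" "\<And>c. N (to_ac c) \<le> 2 ^ n \<Longrightarrow> \<exists>s\<in>S. N (to_ac (c - s)) \<le> 1"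
    using base_ball_finite[of n] by metis
  have "\<exists>s\<in>S. N (m - to_ac s) \<le> 1" if m: "m \<in> M" "N m \<le> Y" for m
  proof -
    obtain c where c: "m = to_ac c" using m(1) base by blast
    then show ?thesis using S(2)[of c] m(2) n by simp
  qed
  then obtain s where s: "\<And>m. m \<in> {m \<in> M. N m \<le> Y} \<Longrightarrow> s m \<in> S \<and> N (m - to_ac (s m)) \<le> 1"
    by (metis (mono_tags, lifting) mem_Collect_eq)
  show ?thesis
  proof (rule inj_on_finite[of s _ S])
    show "s ` {m \<in> M. N m \<le> Y} \<subseteq> S" using s by blast
    show "inj_on s {m \<in> M. N m \<le> Y}"
    proof (rule inj_onI)
      fix x y assume x: "x \<in> {m \<in> M. N m \<le> Y}" and y: "y \<in> {m \<in> M. N m \<le> Y}" and eq: "s x = s y"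
      have "N (x - y) \<le> max (N (x - to_ac (s x))) (N (to_ac (s x) - y))" by (rule N_diff_triangle)
      also have "\<dots> \<le> 1" using s[OF x] s[OF y] eq N_diff_commute[of y] by simp
      finally show "x = y" using separated diff x y by force
    qed
  qed (rule S(1))
qed

end

text \<open>
  Representatives of \<open>A\<^sup>n / a A\<^sup>n\<close> are taken componentwise and projected to the direct summand \<open>M\<close>.
\<close>

lemma fg_projective_finite_quotient:
  fixes act :: "'f::field \<Rightarrow> 'l::ab_group_add \<Rightarrow> 'l"
  assumes proj: "fg_projective A act M" and a: "a \<in> A"
    and A: "0 \<in> A" "\<And>x y. x \<in> A \<Longrightarrow> y \<in> A \<Longrightarrow> x * y \<in> A"
    and fin: "finite Q" "Q \<subseteq> A" "\<And>x. x \<in> A \<Longrightarrow> \<exists>r\<in>Q. \<exists>b\<in>A. x = r + a * b"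
  obtains R where "finite R" "R \<subseteq> M" "\<And>m. m \<in> M \<Longrightarrow> \<exists>r\<in>R. \<exists>m'\<in>M. m = r + act a m'"
proof -
  from proj obtain n s \<pi> where *: "s \<in> M \<rightarrow> free_module A n \<and>
     (\<forall>x\<in>M. \<forall>y\<in>M. s (x + y) = (\<lambda>i. s x i + s y i)) \<and>
     (\<forall>a\<in>A. \<forall>x\<in>M. s (act a x) = (\<lambda>i. a * s x i)) \<and>
     \<pi> \<in> free_module A n \<rightarrow> M \<and>
     (\<forall>x\<in>free_module A n. \<forall>y\<in>free_module A n. \<pi> (\<lambda>i. x i + y i) = \<pi> x + \<pi> y) \<and>
     (\<forall>a\<in>A. \<forall>x\<in>free_module A n. \<pi> (\<lambda>i. a * x i) = act a (\<pi> x)) \<and>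
     (\<forall>x\<in>M. \<pi> (s x) = x)"
    unfolding fg_projective_def by (elim exE) (rule that)
  then have s: "s \<in> M \<rightarrow> free_module A n" and \<pi>: "\<pi> \<in> free_module A n \<rightarrow> M"
    and add: "\<And>x y. x \<in> free_module A n \<Longrightarrow> y \<in> free_module A n \<Longrightarrow> \<pi> (\<lambda>i. x i + y i) = \<pi> x + \<pi> y"
    and scale: "\<And>a x. a \<in> A \<Longrightarrow> x \<in> free_module A n \<Longrightarrow> \<pi> (\<lambda>i. a * x i) = act a (\<pi> x)"
    and id: "\<And>x. x \<in> M \<Longrightarrow> \<pi> (s x) = x"
    by simp_all
  define V where "V = {x. \<forall>i. (i \<in> {..<n} \<longrightarrow> x i \<in> Q) \<and> (i \<notin> {..<n} \<longrightarrow> x i = 0)}"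
  have V_fin: "finite V" unfolding V_def by (rule finite_set_of_finite_funs) (use fin(1) in auto)
  have V: "V \<subseteq> free_module A n" using fin(2) by (auto simp: V_def free_module_def)
  show ?thesis
  proof (rule that[of "\<pi> ` V"])
    show "finite (\<pi> ` V)" using V_fin by simp
    show "\<pi> ` V \<subseteq> M" using V \<pi> by blast
    fix m assume m: "m \<in> M"
    then have sm: "s m \<in> free_module A n" using s by blast
    have "\<forall>i. \<exists>r b. if i < n then r \<in> Q \<and> b \<in> A \<and> s m i = r + a * b else r = 0 \<and> b = 0"
    proof
      fix i
      show "\<exists>r b. if i < n then r \<in> Q \<and> b \<in> A \<and> s m i = r + a * b else r = 0 \<and> b = 0"
      proof (cases "i < n")
        case True
        then have "s m i \<in> A" using sm by (simp add: free_module_def)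
        then show ?thesis using fin(3)[of "s m i"] True by auto
      qed simp
    qed
    then obtain r b where rb: "\<And>i. if i < n then r i \<in> Q \<and> b i \<in> A \<and> s m i = r i + a * b i else r i = 0 \<and> b i = 0"
      by metis
    have r: "r \<in> V" unfolding V_def mem_Collect_eq
    proof
      fix i show "(i \<in> {..<n} \<longrightarrow> r i \<in> Q) \<and> (i \<notin> {..<n} \<longrightarrow> r i = 0)" using rb[of i] by (simp split: if_splits)
    qed
    have b: "b \<in> free_module A n" unfolding free_module_def mem_Collect_eq
    proof
      fix i show "if i < n then b i \<in> A else b i = 0" using rb[of i] by (simp split: if_splits)
    qed
    have "s m = (\<lambda>i. r i + a * b i)"
    proof
      fix i show "s m i = r i + a * b i"
        using rb[of i] sm by (cases "i < n") (simp_all add: free_module_def)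
    qed
    moreover have "(\<lambda>i. a * b i) \<in> free_module A n"
      unfolding free_module_def mem_Collect_eq
    proof
      fix i show "if i < n then a * b i \<in> A else a * b i = 0"
        using b a A(2) by (simp add: free_module_def split: if_splits)
    qed
    ultimately have "m = \<pi> r + act a (\<pi> b)" using id[OF m] add[of r] V r scale[OF a b] by auto
    then show "\<exists>r\<in>\<pi> ` V. \<exists>m'\<in>M. m = r + act a m'" using r b \<pi> by blast
  qed
qed

section \<open>Inertia invariants of the Tate module\<close>

locale tate_setting = local_closure p v w
  for p :: nat and v :: "'k::field \<Rightarrow> int" and w :: "'k alg_closure \<Rightarrow> real" +
  fixes red :: "'k \<Rightarrow> 'r::field" and A :: "'f::field set" and \<phi> \<psi> :: "'f \<Rightarrow> 'k poly"
    and M :: "'k alg_closure set" and e :: "'k fps" and P :: "'f set" and v\<^sub>P :: "'f \<Rightarrow> int"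
    and \<iota> :: "'f \<Rightarrow> 'c::field" and vc :: "'c \<Rightarrow> int"
  assumes A_0: "0 \<in> A" and A_1: "1 \<in> A" and A_add: "x \<in> A \<Longrightarrow> y \<in> A \<Longrightarrow> x + y \<in> A"
    and A_mult: "x \<in> A \<Longrightarrow> y \<in> A \<Longrightarrow> x * y \<in> A" and A_minus: "x \<in> A \<Longrightarrow> - x \<in> A"
    and residue: "residue_map v red" and drinfeld_\<phi>: "drinfeld_module p A \<phi>"
    and stable: "stable_reduction p v red A \<phi>"
    and uniformization: "tate_uniformization p v w A \<phi> \<psi> M e"
    and M_base: "M \<subseteq> range to_ac"
    and P_prime: "prime_of A P" and P_residual: "P \<noteq> residual_characteristic red A \<phi>"
    and P_valuation: "valuation_at A P v\<^sub>P" and P_completion: "completion v\<^sub>P \<iota> vc"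

sublocale tate_setting \<subseteq> tate_exponential p v w e
  by unfold_locales (use uniformization in \<open>auto simp: tate_uniformization_def\<close>)

context tate_setting
begin

lemma drinfeld_\<psi>: "drinfeld_module p A \<psi>"
  using uniformization by (simp add: tate_uniformization_def)

lemma drinfeld_hom:
  assumes "drinfeld_module p A (\<rho> :: 'f \<Rightarrow> 'k poly)"
  shows "x \<in> A \<Longrightarrow> y \<in> A \<Longrightarrow> \<rho> (x * y) = tau_mult p (\<rho> x) (\<rho> y)"
    and "x \<in> A \<Longrightarrow> y \<in> A \<Longrightarrow> \<rho> (x + y) = \<rho> x + \<rho> y" and "\<rho> 1 = 1"
  using assms by (auto simp: drinfeld_module_def ring_hom_def ring_of_type_algebra_def tau_ring_def)

lemmas \<psi>_hom = drinfeld_hom[OF drinfeld_\<psi>] and \<phi>_hom = drinfeld_hom[OF drinfeld_\<phi>]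

lemma A_power: "x \<in> A \<Longrightarrow> x ^ n \<in> A"
  by (induction n) (auto intro: A_1 A_mult)

lemma A_diff: "x \<in> A \<Longrightarrow> y \<in> A \<Longrightarrow> x - y \<in> A"
  using A_add[OF _ A_minus, of x y] by simp

lemma drinfeld_power:
  assumes \<rho>: "drinfeld_module p A \<rho>" and a: "a \<in> A"
  shows "tau_eval p (\<rho> (a ^ n)) x = (tau_eval p (\<rho> a :: 'k poly) ^^ n) x"
  using a by (induction n) (simp_all add: drinfeld_hom[OF \<rho>] A_power tau_eval_mult)

lemma const_mult:
  assumes \<rho>: "drinfeld_module p A \<rho>" and ab: "a \<in> A" "b \<in> A"
  shows "Polynomial.coeff (\<rho> (a * b) :: 'k poly) 0 = Polynomial.coeff (\<rho> a) 0 * Polynomial.coeff (\<rho> b) 0"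
  using p_ge_2 by (simp add: drinfeld_hom(1)[OF \<rho> ab] coeff_tau_mult)

lemma const_power:
  assumes \<rho>: "drinfeld_module p A \<rho>" and a: "a \<in> A"
  shows "Polynomial.coeff (\<rho> (a ^ n) :: 'k poly) 0 = Polynomial.coeff (\<rho> a) 0 ^ n"
  using a by (induction n) (simp_all add: drinfeld_hom(3)[OF \<rho>] const_mult[OF \<rho>] A_power)

lemma E_\<psi>: "a \<in> A \<Longrightarrow> E (tau_eval p (\<psi> a) x) = tau_eval p (\<phi> a) (E x)"
  by (rule E_intertwines) (use uniformization in \<open>auto simp: tate_uniformization_def\<close>)

lemma E_eq_0_iff: "E x = 0 \<longleftrightarrow> x \<in> M"
  using uniformization by (auto simp: tate_uniformization_def E_def)

lemma M_integral: "x \<in> M \<Longrightarrow> N x \<le> 1 \<Longrightarrow> x = 0"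
  using uniformization unfolding tate_uniformization_def val_ring_iff[symmetric] by blast

lemma M_diff: "x \<in> M \<Longrightarrow> y \<in> M \<Longrightarrow> x - y \<in> M"
  unfolding E_eq_0_iff[symmetric] by (simp add: E_diff)

lemma M_act: "a \<in> A \<Longrightarrow> x \<in> M \<Longrightarrow> tau_eval p (\<psi> a) x \<in> M"
  unfolding E_eq_0_iff[symmetric] by (simp add: E_\<psi>)

lemma E_inj_integral: "N x \<le> 1 \<Longrightarrow> N y \<le> 1 \<Longrightarrow> E x = E y \<Longrightarrow> x = y"
  using M_integral[of "x - y"] N_diff[of x y] by (simp add: E_diff flip: E_eq_0_iff)

lemma const_eq: "a \<in> A \<Longrightarrow> Polynomial.coeff (\<phi> a) 0 = Polynomial.coeff (\<psi> a) 0"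
proof -
  assume "a \<in> A"
  then have "fps_tau_mult p e (fps_of_poly (\<psi> a)) = fps_tau_mult p (fps_of_poly (\<phi> a)) e"
    using uniformization by (simp add: tate_uniformization_def)
  from arg_cong[OF this, of "\<lambda>f. fps_nth f 0"] show ?thesis by (simp add: fps_tau_mult_def e_0)
qed

lemma \<psi>_integral: "a \<in> A \<Longrightarrow> integral_poly (\<psi> a)"
  using uniformization
  by (auto simp: tate_uniformization_def good_reduction_def integral_coeffs_def integral_poly_def
      simp flip: val_ring_base_iff)

lemma \<psi>_lead: "a \<in> A \<Longrightarrow> a \<noteq> 0 \<Longrightarrow> N (to_ac (lead_coeff (\<psi> a))) = 1"
  using uniformization by (auto simp: tate_uniformization_def good_reduction_def N_def w_base)

lemma \<psi>_torsion_integral: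
  assumes "a \<in> A" "a \<noteq> 0" "tau_eval p (\<psi> a) x = 0" shows "N x \<le> 1"
proof (rule ccontr)
  assume "\<not> ?thesis"
  then have "1 < N x" by simp
  then have "N x ^ (p ^ degree (\<psi> a)) = 0"
    using N_tau_eval_large[OF \<psi>_integral[OF assms(1)] \<psi>_lead[OF assms(1,2)], of x] assms(3) by simp
  then show False using \<open>1 < N x\<close> by simp
qed

text \<open>
  The constant coefficients of \<open>\<phi>\<^sub>a\<close> and \<open>\<psi>\<^sub>a\<close> agree because that of \<open>e\<close> is 1, so the residual
  characteristic can be read off from \<open>\<psi>\<close>.
\<close>

lemma residual_iff:
  assumes a: "a \<in> A"
  shows "a \<in> residual_characteristic red A \<phi> \<longleftrightarrow> N (to_ac (Polynomial.coeff (\<psi> a) 0)) < 1"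
proof -
  have red: "red c = 0 \<longleftrightarrow> c \<in> max_ideal v" if "c \<in> val_ring v" for c
    using residue that unfolding residue_map_def by blast
  have "red 0 = 0" by (subst red) (simp_all add: val_ring_def max_ideal_def)
  moreover have "Polynomial.coeff (\<phi> a) 0 \<in> val_ring v"
    using stable a by (simp add: stable_reduction_def integral_coeffs_def)
  ultimately show ?thesis
    using a red by (simp add: residual_characteristic_def characteristic_ideal_def reduction_def
        coeff_map_poly const_eq[OF a] max_ideal_base_iff)
qed

lemma card_quotient:
  assumes a: "a \<in> A" "a \<noteq> 0"
  obtains r where "r > 0" "p ^ degree (\<psi> a) = card ((\<lambda>x. x +o ((*) a ` A)) ` A) ^ r"
  using drinfeld_\<psi> a unfolding drinfeld_module_def has_rank_def by blast

text \<open>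
  The rank formula equates a power of \<open>p\<close> with a positive power of the cardinality of \<open>A / aA\<close>; this
  cardinality is therefore not the value 0 that stands for infinite sets.
\<close>

lemma finite_quotient:
  assumes "a \<in> A" "a \<noteq> 0" shows "finite ((\<lambda>x. x +o ((*) a ` A)) ` A)"
proof -
  obtain r where r: "r > 0" "p ^ degree (\<psi> a) = card ((\<lambda>x. x +o ((*) a ` A)) ` A) ^ r"
    using card_quotient[OF assms] .
  have "p ^ degree (\<psi> a) > 0" using p_ge_2 by simp
  then have "card ((\<lambda>x. x +o ((*) a ` A)) ` A) \<noteq> 0" using r by (metis less_irrefl zero_power)
  then show ?thesis by (metis card.infinite)
qed

lemma coset_eqD: "x +o ((*) a ` A) = y +o ((*) a ` A) \<Longrightarrow> \<exists>b\<in>A. x = y + a * b"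
proof -
  assume eq: "x +o ((*) a ` A) = y +o ((*) a ` A)"
  have "x + a * 0 \<in> x +o ((*) a ` A)" using A_0 unfolding elt_set_plus_def by blast
  then have "x \<in> y +o ((*) a ` A)" by (simp add: eq)
  then show ?thesis by (auto simp: elt_set_plus_def)
qed

lemma vP: "valuation v\<^sub>P" and A_vP: "A \<subseteq> val_ring v\<^sub>P" and P_def: "P = A \<inter> max_ideal v\<^sub>P"
  using P_valuation by (auto simp: valuation_at_def discrete_valuation_def)

text \<open>
  Otherwise \<open>P\<close> is properly contained in the residual characteristic, which is impossible since \<open>P\<close>
  is maximal: for \<open>b \<notin> P\<close> two powers of \<open>b\<close> agree modulo a nonzero element of \<open>P\<close>, by finiteness
  of the quotient, so some positive power of \<open>b\<close> is congruent to 1 modulo \<open>P\<close>. If \<open>b\<close> is in the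
  residual characteristic, so is 1, but the constant coefficient of \<open>\<psi>\<^sub>1\<close> is 1.
\<close>

lemma exists_separating_element:
  obtains a where "a \<in> P" "a \<noteq> 0" "N (to_ac (Polynomial.coeff (\<psi> a) 0)) = 1"
proof -
  let ?r = "residual_characteristic red A \<phi>"
  have r_sub: "?r \<subseteq> A" by (auto simp: residual_characteristic_def characteristic_ideal_def)
  have const_1: "Polynomial.coeff (\<psi> 1) 0 = 1" by (simp add: \<psi>_hom(3))
  have "\<not> P \<subseteq> ?r"
  proof
    assume "P \<subseteq> ?r"
    then obtain b where b: "b \<in> ?r" "b \<notin> P" using P_residual by blast
    have bA: "b \<in> A" using b(1) r_sub by blast
    have "0 \<in> P" using A_0 by (simp add: P_def max_ideal_def)
    then obtain a where a: "a \<in> P" "a \<noteq> 0" using P_prime unfolding prime_of_def by blast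
    have aA: "a \<in> A" using a(1) by (simp add: P_def)
    let ?q = "\<lambda>i::nat. b ^ i +o ((*) a ` A)"
    have "\<not> inj ?q"
    proof
      assume "inj ?q"
      then have "infinite (range ?q)" by (rule range_inj_infinite)
      moreover have "range ?q \<subseteq> (\<lambda>x. x +o ((*) a ` A)) ` A" using A_power[OF bA] by blast
      ultimately show False using finite_subset finite_quotient[OF aA a(2)] by metis
    qed
    then obtain i0 j0 where ij0: "?q i0 = ?q j0" "i0 \<noteq> j0" unfolding inj_def by blast
    define i j where "i = min i0 j0" and "j = max i0 j0"
    have "i < j" "?q i = ?q j" using ij0 by (auto simp: i_def j_def min_def max_def)
    then obtain k where k: "j = i + Suc k" by (metis less_imp_Suc_add add_Suc_right)
    obtain c where c: "c \<in> A" "b ^ i = b ^ j + a * c" using coset_eqD[OF \<open>?q i = ?q j\<close>] by blast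
    have b0: "b \<noteq> 0" "v\<^sub>P b = 0"
    proof -
      show "b \<noteq> 0" using b(2) \<open>0 \<in> P\<close> by blast
      then show "v\<^sub>P b = 0" using b(2) bA A_vP by (auto simp: P_def val_ring_def max_ideal_def)
    qed
    define x where "x = 1 - b ^ Suc k"
    have xA: "x \<in> A" unfolding x_def by (intro A_diff A_1 A_power bA)
    have "b ^ i * x = a * c" using c(2) by (simp add: x_def k power_add algebra_simps)
    then have "x \<in> max_ideal v\<^sub>P"
    proof (cases "x = 0")
      case False
      then have "c \<noteq> 0" using \<open>b ^ i * x = a * c\<close> b0(1) by auto
      then have "v\<^sub>P (b ^ i) + v\<^sub>P x = v\<^sub>P a + v\<^sub>P c"
        using \<open>b ^ i * x = a * c\<close> False b0(1) a(2) by (metis valuation_mult[OF vP] power_not_zero)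
      moreover have "v\<^sub>P a > 0" "v\<^sub>P c \<ge> 0"
        using a c(1) A_vP \<open>c \<noteq> 0\<close> by (auto simp: P_def max_ideal_def val_ring_def)
      ultimately show ?thesis using b0 by (simp add: valuation_power[OF vP] max_ideal_def)
    qed (simp add: max_ideal_def)
    then have "x \<in> ?r" using \<open>P \<subseteq> ?r\<close> xA by (auto simp: P_def)
    then have x_small: "N (to_ac (Polynomial.coeff (\<psi> x) 0)) < 1" using residual_iff[OF xA] by simp
    have "N (to_ac (Polynomial.coeff (\<psi> b) 0)) < 1" using residual_iff[OF bA] b(1) by simp
    then have "N (to_ac (Polynomial.coeff (\<psi> b) 0)) ^ Suc k < 1" by (intro power_less_one_iff[THEN iffD2]) auto
    then have b_small: "N (to_ac (Polynomial.coeff (\<psi> (b ^ Suc k)) 0)) < 1"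
      by (simp only: const_power[OF drinfeld_\<psi> bA] to_ac_power N_power)
    have "\<psi> 1 = \<psi> x + \<psi> (b ^ Suc k)"
      using \<psi>_hom(2)[OF xA A_power[OF bA, of "Suc k"]] by (simp add: x_def)
    then have "1 = Polynomial.coeff (\<psi> x) 0 + Polynomial.coeff (\<psi> (b ^ Suc k)) 0"
      using const_1 by simp
    then have "N (to_ac (Polynomial.coeff (\<psi> x) 0) + to_ac (Polynomial.coeff (\<psi> (b ^ Suc k)) 0)) = 1"
      by (metis N_1 to_ac_1 to_ac_add)
    then show False using N_add_less[OF x_small b_small] by simp
  qed
  then obtain a where a: "a \<in> P" "a \<notin> ?r" by blast
  have aA: "a \<in> A" using a(1) by (simp add: P_def)
  have "N (to_ac (Polynomial.coeff (\<psi> a) 0)) \<le> 1" using \<psi>_integral[OF aA] by (simp add: integral_poly_def)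
  moreover have "\<not> N (to_ac (Polynomial.coeff (\<psi> a) 0)) < 1" using a(2) residual_iff[OF aA] by simp
  moreover have "\<psi> 0 = 0" using \<psi>_hom(2)[OF A_0 A_0] by (metis add_0 add_cancel_right_right)
  ultimately show ?thesis by (intro that[OF a(1)]) auto
qed

lemma iota_mult: "\<iota> (x * y) = \<iota> x * \<iota> y" and iota_1: "\<iota> 1 = 1" and vc_iota: "vc (\<iota> x) = v\<^sub>P x"
  and vc: "valuation vc"
  using P_completion
  by (auto simp: completion_def ring_hom_def ring_of_type_algebra_def discrete_valuation_def)

lemma iota_nonzero: "x \<noteq> 0 \<Longrightarrow> \<iota> x \<noteq> 0"
proof
  assume "x \<noteq> 0" "\<iota> x = 0"
  then have "\<iota> (x * inverse x) = 0" by (simp only: iota_mult mult_zero_left)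
  then show False using \<open>x \<noteq> 0\<close> iota_1 by simp
qed

lemma P_power_integral:
  assumes "a \<in> P" "a \<noteq> 0" obtains n where "\<iota> (a ^ n) * x \<in> val_ring vc"
proof (cases "x = 0")
  case True
  then show ?thesis using that[of 0] val_ring_0[OF vc] by simp
next
  case False
  have "v\<^sub>P a \<ge> 1" using assms by (simp add: P_def max_ideal_def)
  define n where "n = nat (- vc x)"
  have "int n * v\<^sub>P a \<ge> int n * 1" using \<open>v\<^sub>P a \<ge> 1\<close> by (intro mult_left_mono) auto
  moreover have "- vc x \<le> int n" by (simp add: n_def)
  ultimately have "0 \<le> int n * v\<^sub>P a + vc x" by linarith
  moreover have "vc (\<iota> (a ^ n) * x) = int n * v\<^sub>P a + vc x"
    using False assms(2) by (simp add: valuation_mult[OF vc] iota_nonzero vc_iota valuation_power[OF vP])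
  ultimately have "\<iota> (a ^ n) * x \<in> val_ring vc" by (simp add: val_ring_def)
  then show ?thesis by (rule that)
qed

abbreviation coset :: "'c \<Rightarrow> 'c set" where
  "coset x \<equiv> x +o val_ring vc"

lemma coset_in: "coset x \<in> torsion_quotient vc"
  by (simp add: torsion_quotient_def)

lemma coset_integral:
  assumes x: "x \<in> val_ring vc" shows "coset x = coset 0"
proof -
  have "x + y \<in> val_ring vc" "y - x \<in> val_ring vc" if "y \<in> val_ring vc" for y
    using val_ring_add[OF vc x that] val_ring_add[OF vc that val_ring_minus[OF vc x]] by simp_all
  then show ?thesis by (force simp: elt_set_plus_def)
qed

lemma tate_moduleD:
  assumes "f \<in> tate_module p A \<iota> vc (\<rho> :: 'f \<Rightarrow> 'k poly)"
  shows "f (coset (x + y)) = f (coset x) + f (coset y)"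
    and "a \<in> A \<Longrightarrow> f (coset (\<iota> a * x)) = tau_eval p (\<rho> a) (f (coset x))"
    and "x \<in> val_ring vc \<Longrightarrow> f (coset x) = 0"
proof -
  show add: "f (coset (x + y)) = f (coset x) + f (coset y)" for x y
    using assms by (simp add: tate_module_def)
  show "a \<in> A \<Longrightarrow> f (coset (\<iota> a * x)) = tau_eval p (\<rho> a) (f (coset x))"
    using assms by (simp add: tate_module_def)
  have "f (coset 0) = 0" using add[of 0 0] by (metis add_0 add_cancel_right_right)
  then show "x \<in> val_ring vc \<Longrightarrow> f (coset x) = 0" by (simp only: coset_integral)
qed

lemma unit_const_power:
  assumes "a \<in> A" "N (to_ac (Polynomial.coeff (\<psi> a) 0)) = 1"
  shows "N (to_ac (Polynomial.coeff (\<psi> (a ^ n)) 0)) = 1"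
  by (simp add: const_power[OF drinfeld_\<psi> assms(1)] N_power assms(2))

text \<open>
  Torsion prime to the residual characteristic is unramified: reduction is injective on it.
\<close>

lemma \<psi>_torsion_fixed:
  assumes b: "b \<in> A" "b \<noteq> 0" "N (to_ac (Polynomial.coeff (\<psi> b) 0)) = 1"
    and t: "tau_eval p (\<psi> b) t = 0" and \<sigma>: "\<sigma> \<in> inertia_group w"
  shows "\<sigma> t = t"
proof -
  have "N (\<sigma> t - t) < 1" by (rule inertiaD(5)[OF \<sigma> \<psi>_torsion_integral[OF b(1,2) t]])
  moreover have "\<sigma> 0 = 0" using inertiaD(3)[OF \<sigma>, of 0] by simp
  then have "tau_eval p (\<psi> b) (\<sigma> t - t) = 0"
    using inertia_tau_eval[OF \<sigma>, of "\<psi> b" t] t by (simp add: tau_eval_diff)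
  ultimately have "\<sigma> t - t = 0" by (rule tau_eval_small_root[OF \<psi>_integral[OF b(1)] b(3)])
  then show ?thesis by simp
qed

lemma image_invariant:
  assumes f: "f \<in> tate_module p A \<iota> vc \<psi>"
  shows "compose (torsion_quotient vc) E f \<in>
    tate_invariants (inertia_group w) vc (tate_module p A \<iota> vc \<phi>)"
proof -
  let ?g = "compose (torsion_quotient vc) E f"
  have g: "?g (coset x) = E (f (coset x))" for x by (simp add: compose_def coset_in)
  have "?g \<in> tate_module p A \<iota> vc \<phi>"
    unfolding tate_module_def mem_Collect_eq g
    by (auto simp: tate_moduleD(1,2)[OF f] E_add E_\<psi> compose_extensional)
  moreover have "compose (torsion_quotient vc) \<sigma> ?g = ?g" if \<sigma>: "\<sigma> \<in> inertia_group w" for \<sigma>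
  proof (rule extensionalityI[of _ "torsion_quotient vc"])
    fix c assume "c \<in> torsion_quotient vc"
    then obtain x where c: "c = coset x" by (auto simp: torsion_quotient_def)
    obtain a where a: "a \<in> P" "a \<noteq> 0" "N (to_ac (Polynomial.coeff (\<psi> a) 0)) = 1"
      using exists_separating_element .
    then have aA: "a \<in> A" by (simp add: P_def)
    obtain n where n: "\<iota> (a ^ n) * x \<in> val_ring vc" using P_power_integral[OF a(1,2)] .
    have "tau_eval p (\<psi> (a ^ n)) (f (coset x)) = 0"
      using tate_moduleD(2)[OF f A_power[OF aA, of n], of x] tate_moduleD(3)[OF f n] by simp
    then have "\<sigma> (f (coset x)) = f (coset x)"
      using a(2) by (intro \<psi>_torsion_fixed[OF A_power[OF aA] _ unit_const_power[OF aA a(3)] _ \<sigma>]) auto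
    then show "compose (torsion_quotient vc) \<sigma> ?g c = ?g c"
      by (simp add: compose_def c coset_in inertia_E[OF \<sigma>])
  qed (auto simp: compose_extensional)
  ultimately show ?thesis by (simp add: tate_invariants_def)
qed

text \<open>
  The exponent \<open>p ^ degree (\<psi> a)\<close> exceeds 1 by the rank formula, because elements of \<open>P\<close> are not
  invertible in \<open>A\<close>.
\<close>

lemma expanding_lattice_action:
  assumes a: "a \<in> P" "a \<noteq> 0"
  obtains R where "expanding_lattice N (tau_eval p (\<psi> a)) (p ^ degree (\<psi> a)) M R"
proof -
  have aA: "a \<in> A" and va: "v\<^sub>P a > 0" using a by (auto simp: P_def max_ideal_def)
  let ?c = "\<lambda>x. x +o ((*) a ` A)"
  have fin: "finite (?c ` A)" by (rule finite_quotient[OF aA a(2)])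
  then obtain Q where Q: "Q \<subseteq> A" "finite Q" "?c ` A = ?c ` Q"
    using finite_subset_image[OF _ subset_refl] by metis
  have cosets: "\<exists>r\<in>Q. \<exists>b\<in>A. x = r + a * b" if "x \<in> A" for x
  proof -
    have "?c x \<in> ?c ` Q" unfolding Q(3)[symmetric] using that by (rule imageI)
    then show ?thesis using coset_eqD by blast
  qed
  have proj: "fg_projective A (\<lambda>a. tau_eval p (\<psi> a)) M"
    using uniformization by (simp add: tate_uniformization_def)
  obtain R where R: "finite R" "R \<subseteq> M" "\<And>m. m \<in> M \<Longrightarrow> \<exists>r\<in>R. \<exists>m'\<in>M. m = r + tau_eval p (\<psi> a) m'"
    using fg_projective_finite_quotient[OF proj aA A_0 A_mult Q(2,1) cosets] by metis
  have "2 \<le> p ^ degree (\<psi> a)"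
  proof -
    obtain r where r: "r > 0" "p ^ degree (\<psi> a) = card (?c ` A) ^ r" using card_quotient[OF aA a(2)] .
    have "?c 1 \<noteq> ?c 0"
    proof
      assume eq: "?c 1 = ?c 0"
      obtain b where b: "b \<in> A" "1 = a * b" using coset_eqD[OF eq] by auto
      then have "b \<noteq> 0" by auto
      then have "v\<^sub>P a + v\<^sub>P b = 0" using valuation_mult[OF vP a(2)] b(2) valuation_1[OF vP] by metis
      moreover have "v\<^sub>P b \<ge> 0" using b(1) \<open>b \<noteq> 0\<close> A_vP by (auto simp: val_ring_def)
      ultimately show False using va by simp
    qed
    then have "card {?c 1, ?c 0} = 2" by simp
    moreover have "card {?c 1, ?c 0} \<le> card (?c ` A)" 
      by (intro card_mono fin) (use A_0 A_1 in blast)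
    ultimately have "2 \<le> card (?c ` A)" by simp
    also have "\<dots> \<le> card (?c ` A) ^ r" using r(1) \<open>2 \<le> card (?c ` A)\<close> by (intro self_le_power) auto
    finally show ?thesis by (simp add: r(2))
  qed
  then have "expanding_lattice N (tau_eval p (\<psi> a)) (p ^ degree (\<psi> a)) M R"
  proof unfold_locales
    show "tau_eval p (\<psi> a) (x + y) = tau_eval p (\<psi> a) x + tau_eval p (\<psi> a) y" for x y
      by (rule tau_eval_add)
    show "1 < N x \<Longrightarrow> N (tau_eval p (\<psi> a) x) = N x ^ (p ^ degree (\<psi> a))" for x
      by (rule N_tau_eval_large[OF \<psi>_integral[OF aA] \<psi>_lead[OF aA a(2)]])
    show "N x \<le> 1 \<Longrightarrow> N (tau_eval p (\<psi> a) x) \<le> 1" for x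
      by (rule tau_eval_integral[OF \<psi>_integral[OF aA]])
    show "0 \<in> M" using E_eq_0_iff[of 0] by simp
    show "finite {m \<in> M. N m \<le> Y}" for Y
      by (rule finite_bounded_lattice[OF M_base M_diff M_integral])
  qed (use R M_diff M_act[OF aA] in auto)
  then show ?thesis by (rule that)
qed

text \<open>
  For \<open>\<sigma>\<close> in inertia, \<open>\<sigma> y - y\<close> lies in the kernel \<open>M\<close> of \<open>E\<close> by invariance. It is also torsion,
  because \<open>\<sigma>\<close> fixes \<open>\<psi>\<^sub>b y \<in> M \<subseteq> K\<close>, hence integral, hence zero. Separability holds since the derivative
  of \<open>\<psi>\<^sub>b\<close> is its constant coefficient, a unit.
\<close>

lemma division_point_unramified:
  assumes b: "b \<in> A" "b \<noteq> 0" "N (to_ac (Polynomial.coeff (\<psi> b) 0)) = 1"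
    and y: "tau_eval p (\<psi> b) y \<in> M"
    and fixed: "\<And>\<sigma>. \<sigma> \<in> inertia_group w \<Longrightarrow> \<sigma> (E y) = E y"
  shows "y \<in> unramified"
proof (rule inertia_fixed_unramified)
  let ?m = "tau_eval p (\<psi> b) y"
  obtain c where c: "?m = to_ac c" using y M_base by blast
  show "\<sigma> y = y" if \<sigma>: "\<sigma> \<in> inertia_group w" for \<sigma>
  proof -
    have "E (\<sigma> y - y) = 0" using fixed[OF \<sigma>] by (simp add: E_diff inertia_E[OF \<sigma>])
    then have "\<sigma> y - y \<in> M" by (simp add: E_eq_0_iff)
    moreover have "tau_eval p (\<psi> b) (\<sigma> y - y) = 0"
      using inertia_tau_eval[OF \<sigma>, of "\<psi> b" y] c inertiaD(3)[OF \<sigma>, of c] by (simp add: tau_eval_diff)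
    then have "N (\<sigma> y - y) \<le> 1" by (rule \<psi>_torsion_integral[OF b(1,2)])
    ultimately have "\<sigma> y - y = 0" by (rule M_integral)
    then show ?thesis by simp
  qed
  let ?f = "tau_poly (\<psi> b) - [:?m:]"
  show "Polynomial.coeff ?f i \<in> range to_ac" for i
  proof -
    obtain d where "Polynomial.coeff (tau_poly (\<psi> b)) i = to_ac d"
      using coeff_tau_poly_base[of "\<psi> b" i] by blast
    then have "Polynomial.coeff ?f i = to_ac (d - (if i = 0 then c else 0))"
      by (simp add: c coeff_pCons split: nat.split)
    then show ?thesis by (rule range_eqI)
  qed
  show "poly ?f y = 0" by (simp add: poly_tau_poly)
  show "poly (pderiv ?f) y \<noteq> 0" using b(3) by (auto simp: pderiv_diff pderiv_tau_poly)
qed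

text \<open>
  Preimages under \<open>E\<close> of the values of \<open>f\<close> at \<open>x / a\<^sup>i\<close> form a coherent sequence of division
  points of \<open>M\<close> in the maximal unramified extension, to which \<open>divisible_near_lattice\<close> applies. Moving
  the preimage of the value at \<open>x\<close> by an element of \<open>M\<close> does not change its image.
\<close>

lemma invariant_value_uniformized:
  assumes f: "f \<in> tate_module p A \<iota> vc \<phi>"
    and inv: "\<And>\<sigma> x. \<sigma> \<in> inertia_group w \<Longrightarrow> \<sigma> (f (coset x)) = f (coset x)"
  obtains t where "N t \<le> 1" "E t = f (coset x)"
proof -
  obtain a where a: "a \<in> P" "a \<noteq> 0" "N (to_ac (Polynomial.coeff (\<psi> a) 0)) = 1"
    using exists_separating_element .
  then have aA: "a \<in> A" by (simp add: P_def)
  obtain R where R: "expanding_lattice N (tau_eval p (\<psi> a)) (p ^ degree (\<psi> a)) M R"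
    using expanding_lattice_action[OF a(1,2)] .
  interpret L: expanding_lattice N "tau_eval p (\<psi> a)" "p ^ degree (\<psi> a)" M R by fact
  define u where "u i = x / \<iota> a ^ i" for i
  have u: "\<iota> a * u (Suc i) = u i" for i using iota_nonzero[OF a(2)] by (simp add: u_def)
  have "\<forall>i. \<exists>y. E y = f (coset (u i))" using E_surj by metis
  then obtain y where y: "\<And>i. E (y i) = f (coset (u i))" by metis
  have step: "tau_eval p (\<psi> a) (y (Suc i)) - y i \<in> M" for i
    using tate_moduleD(2)[OF f aA, of "u (Suc i)"]
    by (simp add: E_diff E_\<psi>[OF aA] y u flip: E_eq_0_iff)
  have torsion: "\<exists>n. tau_eval p (\<psi> (a ^ n)) (y i) \<in> M" for i
  proof -
    obtain n where n: "\<iota> (a ^ n) * u i \<in> val_ring vc" using P_power_integral[OF a(1,2)] .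
    have "E (tau_eval p (\<psi> (a ^ n)) (y i)) = f (coset (\<iota> (a ^ n) * u i))"
      using A_power[OF aA] by (simp add: E_\<psi> y tate_moduleD(2)[OF f])
    then show ?thesis using tate_moduleD(3)[OF f n] E_eq_0_iff by metis
  qed
  have unram: "y i \<in> unramified" for i
  proof -
    obtain n where "tau_eval p (\<psi> (a ^ n)) (y i) \<in> M" using torsion by blast
    then show ?thesis
      using a(2) inv y by (intro division_point_unramified[OF A_power[OF aA] _ unit_const_power[OF aA a(3)]]) auto
  qed
  obtain n where n: "(tau_eval p (\<psi> a) ^^ n) (y 0) \<in> M"
    using torsion[of 0] by (auto simp: drinfeld_power[OF drinfeld_\<psi> aA])
  have "M \<subseteq> unramified" using M_base base_unramified by blast
  then obtain m where m: "m \<in> M" "N (y 0 - m) \<le> 1"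
    using L.divisible_near_lattice[OF _ unramified_diff unramified_discrete unram step n] by metis
  have "E (y 0 - m) = f (coset x)" using m(1) y[of 0] by (simp add: E_diff u_def flip: E_eq_0_iff)
  then show ?thesis using that m(2) by blast
qed

lemma invariant_in_image:
  assumes "f \<in> tate_invariants (inertia_group w) vc (tate_module p A \<iota> vc \<phi>)"
  shows "f \<in> compose (torsion_quotient vc) E ` tate_module p A \<iota> vc \<psi>"
proof -
  have f: "f \<in> tate_module p A \<iota> vc \<phi>"
    and inv: "\<And>\<sigma>. \<sigma> \<in> inertia_group w \<Longrightarrow> compose (torsion_quotient vc) \<sigma> f = f"
    using assms by (auto simp: tate_invariants_def)
  have inv': "\<sigma> (f (coset x)) = f (coset x)" if \<sigma>: "\<sigma> \<in> inertia_group w" for \<sigma> x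
    using fun_cong[OF inv[OF \<sigma>], of "coset x"] by (simp add: compose_def coset_in)
  have ex: "\<exists>t. N t \<le> 1 \<and> E t = f c" if "c \<in> torsion_quotient vc" for c
  proof -
    obtain x where "c = coset x" using \<open>c \<in> torsion_quotient vc\<close> by (auto simp: torsion_quotient_def)
    then show ?thesis using invariant_value_uniformized[where f = f and x = x] f inv' by metis
  qed
  define g where "g = (\<lambda>c\<in>torsion_quotient vc. SOME t. N t \<le> 1 \<and> E t = f c)"
  have g: "N (g (coset x)) \<le> 1" "E (g (coset x)) = f (coset x)" for x
    using someI_ex[OF ex[OF coset_in[of x]]] by (simp_all add: g_def coset_in)
  have "g \<in> tate_module p A \<iota> vc \<psi>"
    unfolding tate_module_def mem_Collect_eq
  proof (intro conjI allI ballI)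
    show "g \<in> extensional (torsion_quotient vc)" by (simp add: g_def)
    show "g (coset (x + y)) = g (coset x) + g (coset y)" for x y
    proof (rule E_inj_integral)
      show "N (g (coset x) + g (coset y)) \<le> 1"
        using N_add[of "g (coset x)" "g (coset y)"] g(1)[of x] g(1)[of y] by simp
    qed (simp_all add: g E_add tate_moduleD(1)[OF f])
    show "g (coset (\<iota> a * x)) = tau_eval p (\<psi> a) (g (coset x))" if "a \<in> A" for a x
      by (rule E_inj_integral)
        (simp_all add: g that E_\<psi> tate_moduleD(2)[OF f] tau_eval_integral \<psi>_integral)
  qed
  moreover have "f = compose (torsion_quotient vc) E g"
  proof (rule extensionalityI[of _ "torsion_quotient vc"])
    show "f \<in> extensional (torsion_quotient vc)" using f by (simp add: tate_module_def)
    fix c assume "c \<in> torsion_quotient vc"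
    then obtain x where "c = coset x" by (auto simp: torsion_quotient_def)
    then show "f c = compose (torsion_quotient vc) E g c" by (simp add: compose_def coset_in g(2))
  qed (rule compose_extensional)
  ultimately show ?thesis by blast
qed

end

theorem theorem14p23:
  fixes p :: nat
    and vinf :: "'f::field \<Rightarrow> int"
    and v :: "'k::field \<Rightarrow> int"
    and red :: "'k \<Rightarrow> 'r::field"
    and w :: "'k alg_closure \<Rightarrow> real"
    and A :: "'f set"
    and \<phi> \<psi> :: "'f \<Rightarrow> 'k poly"
    and M :: "'k alg_closure set"
    and e :: "'k fps"
    and P :: "'f set"
    and v\<^sub>P :: "'f \<Rightarrow> int"
    and \<iota> :: "'f \<Rightarrow> 'c::field"
    and vc :: "'c \<Rightarrow> int"
  assumes "global_function_field p TYPE('f)"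
    and "discrete_valuation vinf"
    and "A = regular_outside vinf"
    and "local_field p v"
    and "residue_map v red"
    and "valuation_extension v w"
    and "drinfeld_module p A \<phi>"
    and "stable_reduction p v red A \<phi>"
    and "tate_uniformization p v w A \<phi> \<psi> M e"
    and "M \<subseteq> range to_ac"
    and "prime_of A P"
    and "P \<noteq> residual_characteristic red A \<phi>"
    and "valuation_at A P v\<^sub>P"
    and "completion v\<^sub>P \<iota> vc"
  shows "(\<lambda>f. compose (torsion_quotient vc) (fps_tau_eval p w e) f) ` tate_module p A \<iota> vc \<psi>
           = tate_invariants (inertia_group w) vc (tate_module p A \<iota> vc \<phi>)"
proof -
  note A = assms(3)
  interpret tate_setting p v w red A \<phi> \<psi> M e P v\<^sub>P \<iota> vc
    by unfold_locales (use assms regular_0[OF A] regular_1[OF A] regular_add[OF A] regular_mult[OF A]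
        regular_minus[OF A] in auto)
  show ?thesis
    using image_invariant invariant_in_image unfolding E_def by auto
qed

end
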